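(* The operator $\mathcal H$ on $L^2(\Omega)$ has compact resolvent. Its spectrum consists of isolated (possibly complex) eigenvalues of finite multiplicity accumulating only at $\infty$ in modulus, i.e. $\sigma(\mathcal H)=\{\lambda_n\}_{n\ge1}$ with each $\lambda_n$ isolated and of finite algebraic multiplicity, and $|\lambda_n|\to\infty$. Furthermore, there exist (generalized) eigenfunctions $\{\varphi_n\}$ of $\mathcal H$ and corresponding eigenfunctions $\{\varphi_n^*\}$ of $\mathcal H^*$ such that $\langle\varphi_n,\varphi_m^*\rangle=\delta_{nm}$, and the linear spans of $\{\varphi_n\}$ and $\{\varphi_n^*\}$ are both dense in $L^2(\Omega)$.
   Context: Setting: $\Omega=\mathbb T^d=(\mathbb R/2\pi\mathbb Z)^d$, $\sigma>0$; $V\in W^{1,\infty}(\Omega)\cap W^{2,p}(\Omega)$ with $p=\max\{d,2+\epsilon\}$ for some $\epsilon>0$; $W\in W^{2,\infty}(\Omega)$ is even in each coordinate; moreover $V,W\in C^2(\Omega)$ and either $W$ is $H$-stable, i.e. $\int_{\Omega\times\Omega}W(x-y)\nu(x)\nu(y)\,dx\,dy\ge0$ for all $\nu\in L^2(\Omega)$, or $\|W\|_\infty<\sigma$. All functions are periodic. $\bar\mu$ is a fixed stationary state: a probability density with $\bar\mu=\frac1Z\exp(-\frac1\sigma v)$, where $v=V+W*\bar\mu$ and $Z$ is the normalizing constant (so $\bar\mu$ is continuous and bounded above and below by positive constants). $\langle\cdot,\cdot\rangle$ is the inner product of $L^2(\Omega)$. $\mathcal H=\mathcal H_{\mathrm{loc}}+\mathcal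 K$ with domain $H^2(\Omega)$, where $\mathcal H_{\mathrm{loc}}=-\sigma\Delta+\Psi$, $\Psi=\frac1{4\sigma}|\nabla v|^2-\frac12\Delta v$, and $\mathcal K[\phi](x)=\int_\Omega k(x,y)\phi(y)\,dy$ with $$k(x,y)=-\frac{\bar\mu(y)^{1/2}}{\bar\mu(x)^{1/2}}\Big(\nabla\bar\mu(x)\cdot\nabla W(x-y)+\bar\mu(x)\,\Delta W(x-y)\Big).$$ *)

theory Defs
  imports "HOL-Analysis.Analysis" "HOL-Probability.Essential_Supremum"
begin

section \<open>The torus\<close>

text \<open>
  Functions on the torus \<open>(\<real> / 2\<pi>\<int>)\<^sup>d\<close>, \<open>d = CARD('n)\<close>, are \<open>2\<pi>\<close>-periodic functions on
  \<open>real ^ 'n\<close>, and integrals over the torus are integrals over the cell \<open>[0, 2\<pi>]\<^sup>d\<close>.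
  Where functions matter only up to null sets (\<open>L\<^sup>p\<close> spaces, weak derivatives, essential
  suprema), only their values on the cell are used.
\<close>

definition torus :: "(real ^ 'n::finite) measure" where
  "torus = restrict_space lborel (cbox 0 (\<chi> i. 2 * pi))"

definition periodic :: "(real ^ 'n::finite \<Rightarrow> 'b) \<Rightarrow> bool" where
  "periodic f \<longleftrightarrow> (\<forall>x i. f (x + axis i (2 * pi)) = f x)"

subsection \<open>Classical derivatives\<close>

definition pd :: "'n::finite \<Rightarrow> (real ^ 'n \<Rightarrow> 'b::real_normed_vector) \<Rightarrow> real ^ 'n \<Rightarrow> 'b" where
  "pd i f x = frechet_derivative f (at x) (axis i 1)"

primrec Ck :: "nat \<Rightarrow> (real ^ 'n::finite \<Rightarrow> 'b::real_normed_vector) \<Rightarrow> bool" where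
  "Ck 0 f \<longleftrightarrow> continuous_on UNIV f"
| "Ck (Suc k) f \<longleftrightarrow> (\<forall>x. f differentiable (at x)) \<and> (\<forall>i. Ck k (pd i f))"

definition grad :: "(real ^ 'n::finite \<Rightarrow> real) \<Rightarrow> real ^ 'n \<Rightarrow> real ^ 'n" where
  "grad f x = (\<chi> i. pd i f x)"

definition lap :: "(real ^ 'n::finite \<Rightarrow> real) \<Rightarrow> real ^ 'n \<Rightarrow> real" where
  "lap f x = (\<Sum>i\<in>UNIV. pd i (pd i f) x)"

subsection \<open>Lebesgue and Sobolev classes, weak derivatives\<close>

definition Lp :: "real \<Rightarrow> (real ^ 'n::finite \<Rightarrow> 'b::{banach, second_countable_topology}) \<Rightarrow> bool" where
  "Lp p f \<longleftrightarrow> f \<in> borel_measurable torus \<and> integrable torus (\<lambda>x. norm (f x) powr p)"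

definition Linf :: "(real ^ 'n::finite \<Rightarrow> 'b::{banach, second_countable_topology}) \<Rightarrow> bool" where
  "Linf f \<longleftrightarrow> f \<in> borel_measurable torus \<and> esssup torus (\<lambda>x. ereal (norm (f x))) < \<infinity>"

definition test_function :: "(real ^ 'n::finite \<Rightarrow> real) \<Rightarrow> bool" where
  "test_function \<psi> \<longleftrightarrow> periodic \<psi> \<and> (\<forall>k. Ck k \<psi>)"

definition has_weak_pd ::
  "'n::finite \<Rightarrow> (real ^ 'n \<Rightarrow> 'b::{banach, second_countable_topology}) \<Rightarrow> (real ^ 'n \<Rightarrow> 'b) \<Rightarrow> bool" where
  "has_weak_pd i f g \<longleftrightarrow> integrable torus f \<and> integrable torus g \<and>
     (\<forall>\<psi>. test_function \<psi> \<longrightarrow>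
        (LINT x|torus. pd i \<psi> x *\<^sub>R f x) = - (LINT x|torus. \<psi> x *\<^sub>R g x))"

text \<open>\<open>sobolev X k f\<close>: all weak derivatives of \<open>f\<close> of order at most \<open>k\<close> exist and lie in \<open>X\<close>;
  \<open>X = Lp p\<close> gives \<open>W\<^bsup>k,p\<^esup>\<close> and \<open>X = Linf\<close> gives \<open>W\<^bsup>k,\<infinity>\<^esup>\<close>.\<close>

primrec sobolev ::
  "((real ^ 'n::finite \<Rightarrow> 'b::{banach, second_countable_topology}) \<Rightarrow> bool) \<Rightarrow> nat \<Rightarrow>
     (real ^ 'n \<Rightarrow> 'b) \<Rightarrow> bool" where
  "sobolev X 0 f \<longleftrightarrow> X f"
| "sobolev X (Suc k) f \<longleftrightarrow> X f \<and> (\<forall>i. \<exists>g. has_weak_pd i f g \<and> sobolev X k g)"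


section \<open>The complex Hilbert space \<open>L\<^sup>2\<close> of the torus\<close>

lemma Lp2_iff:
  fixes f :: "real ^ 'n::finite \<Rightarrow> complex"
  shows "Lp 2 f \<longleftrightarrow> f \<in> borel_measurable torus \<and> integrable torus (\<lambda>x. (norm (f x))\<^sup>2)"
  unfolding Lp_def by simp

lemma Lp2_measurable [measurable_dest]: "Lp 2 (f :: _ \<Rightarrow> complex) \<Longrightarrow> f \<in> borel_measurable torus"
  by (simp add: Lp2_iff)

lemma Lp2_integrable_mult:
  fixes f g :: "real ^ 'n::finite \<Rightarrow> complex"
  assumes "Lp 2 f" "Lp 2 g"
  shows "integrable torus (\<lambda>x. f x * cnj (g x))"
proof (rule Bochner_Integration.integrable_bound)
  show "integrable torus (\<lambda>x. (norm (f x))\<^sup>2 + (norm (g x))\<^sup>2)"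
    using assms by (auto simp: Lp2_iff)
  have "f \<in> borel_measurable torus" "g \<in> borel_measurable torus"
    using assms by (auto simp: Lp2_iff)
  then show "(\<lambda>x. f x * cnj (g x)) \<in> borel_measurable torus"
    by (intro borel_measurable_times borel_measurable_continuous_on[of cnj] continuous_on_cnj continuous_on_id)
  have "a * b \<le> a\<^sup>2 + b\<^sup>2" if "a \<ge> 0" "b \<ge> 0" for a b :: real
    using sum_squares_bound[of a b] mult_nonneg_nonneg[OF that] by linarith
  then show "AE x in torus. norm (f x * cnj (g x)) \<le> norm ((norm (f x))\<^sup>2 + (norm (g x))\<^sup>2)"
    by (simp add: norm_mult)
qed

lemma Lp2_zero: "Lp 2 (\<lambda>x. 0 :: complex)"
  by (simp add: Lp2_iff)

lemma Lp2_cmult: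
  fixes f :: "real ^ 'n::finite \<Rightarrow> complex"
  assumes "Lp 2 f" shows "Lp 2 (\<lambda>x. c * f x)"
  using assms by (auto simp: Lp2_iff norm_mult power_mult_distrib)

lemma Lp2_add:
  fixes f g :: "real ^ 'n::finite \<Rightarrow> complex"
  assumes "Lp 2 f" "Lp 2 g" shows "Lp 2 (\<lambda>x. f x + g x)"
  unfolding Lp2_iff
proof
  show m: "(\<lambda>x. f x + g x) \<in> borel_measurable torus"
    using assms by (auto simp: Lp2_iff)
  show "integrable torus (\<lambda>x. (norm (f x + g x))\<^sup>2)"
  proof (rule Bochner_Integration.integrable_bound)
    show "integrable torus (\<lambda>x. 2 * (norm (f x))\<^sup>2 + 2 * (norm (g x))\<^sup>2)"
      using assms by (auto simp: Lp2_iff)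
    show "(\<lambda>x. (norm (f x + g x))\<^sup>2) \<in> borel_measurable torus"
      using m by measurable
    have "(norm (a + b))\<^sup>2 \<le> 2 * (norm a)\<^sup>2 + 2 * (norm b)\<^sup>2" for a b :: complex
    proof -
      have "(norm (a + b))\<^sup>2 \<le> (norm a + norm b)\<^sup>2"
        by (intro power_mono norm_triangle_ineq) auto
      also have "\<dots> \<le> 2 * (norm a)\<^sup>2 + 2 * (norm b)\<^sup>2"
        using sum_squares_bound[of "norm a" "norm b"] by (simp add: power2_sum)
      finally show ?thesis .
    qed
    then show "AE x in torus. norm ((norm (f x + g x))\<^sup>2)
        \<le> norm (2 * (norm (f x))\<^sup>2 + 2 * (norm (g x))\<^sup>2)"
      by simp
  qed
qed

definition L2rel :: "(real ^ 'n::finite \<Rightarrow> complex) \<Rightarrow> (real ^ 'n \<Rightarrow> complex) \<Rightarrow> bool" where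
  "L2rel f g \<longleftrightarrow> Lp 2 f \<and> Lp 2 g \<and> (AE x in torus. f x = g x)"

lemma L2rel_part_equivp: "part_equivp L2rel"
proof (rule part_equivpI)
  show "\<exists>f. L2rel f f"
    using Lp2_zero unfolding L2rel_def by (intro exI[of _ "\<lambda>x. 0"]) simp
  show "symp L2rel"
    unfolding L2rel_def by (auto intro!: sympI elim!: AE_mp)
  show "transp L2rel"
    unfolding L2rel_def by (auto intro!: transpI elim!: AE_mp)
qed

quotient_type 'n L2 = "real ^ 'n::finite \<Rightarrow> complex" / partial: L2rel
  morphisms rep_L2 mk_L2
  by (rule L2rel_part_equivp)

lift_definition scaleC :: "complex \<Rightarrow> 'n::finite L2 \<Rightarrow> 'n L2"  (infixr \<open>*\<^sub>C\<close> 75)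
  is "\<lambda>c f x. c * f x"
  by (auto simp: L2rel_def Lp2_cmult)

lift_definition cinner :: "'n::finite L2 \<Rightarrow> 'n L2 \<Rightarrow> complex"
  is "\<lambda>f g. LINT x|torus. f x * cnj (g x)"
proof -
  fix f f' g g' :: "real ^ 'n \<Rightarrow> complex"
  assume a: "L2rel f f'" "L2rel g g'"
  then have "AE x in torus. f x * cnj (g x) = f' x * cnj (g' x)"
    unfolding L2rel_def by auto
  moreover have "(\<lambda>x. f x * cnj (g x)) \<in> borel_measurable torus"
    "(\<lambda>x. f' x * cnj (g' x)) \<in> borel_measurable torus"
    using a by (auto simp: L2rel_def intro!: borel_measurable_integrable Lp2_integrable_mult)
  ultimately show "(LINT x|torus. f x * cnj (g x)) = (LINT x|torus. f' x * cnj (g' x))"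
    by (intro integral_cong_AE)
qed

instantiation L2 :: (finite) real_vector
begin

lift_definition zero_L2 :: "'a L2" is "\<lambda>x. 0"
  by (simp add: L2rel_def Lp2_zero)

lift_definition plus_L2 :: "'a L2 \<Rightarrow> 'a L2 \<Rightarrow> 'a L2" is "\<lambda>f g x. f x + g x"
  by (auto simp: L2rel_def Lp2_add)

definition scaleR_L2 :: "real \<Rightarrow> 'a L2 \<Rightarrow> 'a L2" where
  "scaleR_L2 r u = complex_of_real r *\<^sub>C u"

definition uminus_L2 :: "'a L2 \<Rightarrow> 'a L2" where
  "uminus_L2 u = (- 1) *\<^sub>C u"

definition minus_L2 :: "'a L2 \<Rightarrow> 'a L2 \<Rightarrow> 'a L2" where
  "minus_L2 u w = u + - w"

instance
proof
  fix u v w :: "'a L2" and r s :: real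
  show "u + v + w = u + (v + w)"
    by transfer (auto simp: L2rel_def add.assoc intro!: Lp2_add)
  show "u + v = v + u"
    by transfer (auto simp: L2rel_def add.commute intro!: Lp2_add)
  show "0 + u = u"
    by transfer (auto simp: L2rel_def)
  show "- u + u = 0"
    unfolding uminus_L2_def
    by transfer (auto simp: L2rel_def Lp2_zero)
  show "u - v = u + - v"
    by (simp add: minus_L2_def)
  show "r *\<^sub>R (u + v) = r *\<^sub>R u + r *\<^sub>R v"
    unfolding scaleR_L2_def
    by transfer (auto simp: L2rel_def distrib_left distrib_right intro!: Lp2_add Lp2_cmult)
  show "(r + s) *\<^sub>R u = r *\<^sub>R u + s *\<^sub>R u"
    unfolding scaleR_L2_def
    by transfer (auto simp: L2rel_def distrib_left distrib_right intro!: Lp2_add Lp2_cmult)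
  show "r *\<^sub>R s *\<^sub>R u = (r * s) *\<^sub>R u"
    unfolding scaleR_L2_def
    by transfer (auto simp: L2rel_def mult.assoc intro!: Lp2_cmult)
  show "1 *\<^sub>R u = u"
    unfolding scaleR_L2_def
    by transfer (auto simp: L2rel_def)
qed

end

instantiation L2 :: (finite) real_inner
begin

definition inner_L2 :: "'a L2 \<Rightarrow> 'a L2 \<Rightarrow> real" where
  "inner_L2 u w = Re (cinner u w)"

definition norm_L2 :: "'a L2 \<Rightarrow> real" where
  "norm_L2 u = sqrt (inner u u)"

definition sgn_L2 :: "'a L2 \<Rightarrow> 'a L2" where
  "sgn_L2 u = inverse (norm u) *\<^sub>R u"

definition dist_L2 :: "'a L2 \<Rightarrow> 'a L2 \<Rightarrow> real" where
  "dist_L2 u w = norm (u - w)"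

definition uniformity_L2 :: "('a L2 \<times> 'a L2) filter" where
  "uniformity_L2 = (INF e\<in>{0<..}. principal {(u, w). dist u w < e})"

definition open_L2 :: "'a L2 set \<Rightarrow> bool" where
  "open_L2 U \<longleftrightarrow> (\<forall>u\<in>U. eventually (\<lambda>(u', w). u' = u \<longrightarrow> w \<in> U) uniformity)"

instance
proof
  fix u v w :: "'a L2" and r s :: real
  show "sgn u = u /\<^sub>R norm u"
    by (simp add: sgn_L2_def)
  show "dist u v = norm (u - v)"
    by (simp add: dist_L2_def)
  show "inner u v = inner v u"
  proof -
    have "cinner u v = cnj (cinner v u)"
      by transfer (subst Bochner_Integration.integral_cnj[symmetric], simp add: mult.commute)
    then show ?thesis
      by (simp add: inner_L2_def)
  qed
  have add: "cinner (u + v) w = cinner u w + cinner v w"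
  proof transfer
    fix f g h :: "real ^ 'a \<Rightarrow> complex"
    assume "L2rel f f" "L2rel g g" "L2rel h h"
    then have "integrable torus (\<lambda>x. f x * cnj (h x))" "integrable torus (\<lambda>x. g x * cnj (h x))"
      by (auto simp: L2rel_def intro: Lp2_integrable_mult)
    then show "(LINT x|torus. (f x + g x) * cnj (h x)) =
        (LINT x|torus. f x * cnj (h x)) + (LINT x|torus. g x * cnj (h x))"
      by (simp add: distrib_right)
  qed
  show "inner (u + v) w = inner u w + inner v w"
    by (simp add: inner_L2_def add)
  have scale: "cinner (r *\<^sub>R u) v = of_real r * cinner u v"
    unfolding scaleR_L2_def by transfer (simp add: mult.assoc)
  show "inner (r *\<^sub>R u) v = r * inner u v"
    by (simp add: inner_L2_def scale)
  have sq: "inner u u = (LINT x|torus. (norm (rep_L2 u x))\<^sup>2)"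
  proof -
    have "cinner u u = (LINT x|torus. rep_L2 u x * cnj (rep_L2 u x))"
      by (simp add: cinner.rep_eq)
    also have "\<dots> = of_real (LINT x|torus. (norm (rep_L2 u x))\<^sup>2)"
      by (simp only: complex_norm_square integral_complex_of_real[symmetric])
    finally show ?thesis
      by (simp add: inner_L2_def)
  qed
  show "0 \<le> inner u u"
    unfolding sq by simp
  have rep: "L2rel (rep_L2 u) (rep_L2 u)"
    by (rule Quotient3_rep_reflp[OF Quotient3_L2])
  then have int: "integrable torus (\<lambda>x. (norm (rep_L2 u x))\<^sup>2)"
    by (simp add: L2rel_def Lp2_iff)
  have "inner u u = 0 \<longleftrightarrow> (AE x in torus. rep_L2 u x = 0)"
    unfolding sq by (subst integral_nonneg_eq_0_iff_AE[OF int]) auto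
  also have "\<dots> \<longleftrightarrow> L2rel (rep_L2 u) (\<lambda>x. 0)"
    using rep by (simp add: L2rel_def Lp2_zero)
  also have "\<dots> \<longleftrightarrow> u = 0"
    using Quotient3_rel[OF Quotient3_L2, of "rep_L2 u" "\<lambda>x. 0"] rep
    by (simp add: Quotient3_abs_rep[OF Quotient3_L2] zero_L2_def L2rel_def Lp2_zero)
  finally show "inner u u = 0 \<longleftrightarrow> u = 0" .
  show "norm u = sqrt (inner u u)"
    by (simp add: norm_L2_def)
  show "uniformity = (INF e\<in>{0<..}. principal {(u, w :: 'a L2). dist u w < e})"
    by (simp add: uniformity_L2_def)
  fix U :: "'a L2 set"
  show "open U \<longleftrightarrow> (\<forall>u\<in>U. eventually (\<lambda>(u', w). u' = u \<longrightarrow> w \<in> U) uniformity)"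
    by (simp add: open_L2_def)
qed

end

global_interpretation cvec: vector_space "scaleC :: complex \<Rightarrow> 'n::finite L2 \<Rightarrow> 'n L2"
proof
  fix a b :: complex and u v :: "'n L2"
  show "a *\<^sub>C (u + v) = a *\<^sub>C u + a *\<^sub>C v"
    by transfer (auto simp: L2rel_def distrib_left distrib_right intro!: Lp2_add Lp2_cmult)
  show "(a + b) *\<^sub>C u = a *\<^sub>C u + b *\<^sub>C u"
    by transfer (auto simp: L2rel_def distrib_left distrib_right intro!: Lp2_add Lp2_cmult)
  show "a *\<^sub>C b *\<^sub>C u = (a * b) *\<^sub>C u"
    by transfer (auto simp: L2rel_def mult.assoc intro!: Lp2_cmult)
  show "1 *\<^sub>C u = u"
    by transfer (auto simp: L2rel_def)
qed


section \<open>Unbounded operators on \<open>L\<^sup>2\<close>\<close>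

text \<open>
  An unbounded operator is given by its domain \<open>D\<close> and a total function \<open>A\<close> whose values outside
  \<open>D\<close> are irrelevant.
\<close>

definition resolvent :: "'n::finite L2 set \<Rightarrow> ('n L2 \<Rightarrow> 'n L2) \<Rightarrow> complex \<Rightarrow> 'n L2 \<Rightarrow> 'n L2" where
  "resolvent D A z = inv_into D (\<lambda>u. A u - z *\<^sub>C u)"

definition resolvent_set :: "'n::finite L2 set \<Rightarrow> ('n L2 \<Rightarrow> 'n L2) \<Rightarrow> complex set" where
  "resolvent_set D A =
     {z. bij_betw (\<lambda>u. A u - z *\<^sub>C u) D UNIV \<and> bounded_linear (resolvent D A z)}"

definition spectrum :: "'n::finite L2 set \<Rightarrow> ('n L2 \<Rightarrow> 'n L2) \<Rightarrow> complex set" where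
  "spectrum D A = - resolvent_set D A"

definition compact_operator :: "('n::finite L2 \<Rightarrow> 'n L2) \<Rightarrow> bool" where
  "compact_operator T \<longleftrightarrow> bounded_linear T \<and> compact (closure (T ` ball 0 1))"

definition has_compact_resolvent :: "'n::finite L2 set \<Rightarrow> ('n L2 \<Rightarrow> 'n L2) \<Rightarrow> bool" where
  "has_compact_resolvent D A \<longleftrightarrow> resolvent_set D A \<noteq> {} \<and>
     (\<forall>z\<in>resolvent_set D A. compact_operator (resolvent D A z))"

definition eigenvalue :: "'n::finite L2 set \<Rightarrow> ('n L2 \<Rightarrow> 'n L2) \<Rightarrow> complex \<Rightarrow> bool" where
  "eigenvalue D A z \<longleftrightarrow> (\<exists>u\<in>D. u \<noteq> 0 \<and> A u = z *\<^sub>C u)"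

text \<open>\<open>ker_pow D A z m\<close> is the kernel of \<open>(A - z)\<^sup>m\<close>, including the requirement that all
  intermediate vectors lie in the domain.\<close>

primrec ker_pow :: "'n::finite L2 set \<Rightarrow> ('n L2 \<Rightarrow> 'n L2) \<Rightarrow> complex \<Rightarrow> nat \<Rightarrow> 'n L2 set" where
  "ker_pow D A z 0 = {0}"
| "ker_pow D A z (Suc m) = {u \<in> D. A u - z *\<^sub>C u \<in> ker_pow D A z m}"

definition root_space :: "'n::finite L2 set \<Rightarrow> ('n L2 \<Rightarrow> 'n L2) \<Rightarrow> complex \<Rightarrow> 'n L2 set" where
  "root_space D A z = (\<Union>m. ker_pow D A z m)"

definition finite_alg_multiplicity ::
  "'n::finite L2 set \<Rightarrow> ('n L2 \<Rightarrow> 'n L2) \<Rightarrow> complex \<Rightarrow> bool" where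
  "finite_alg_multiplicity D A z \<longleftrightarrow> (\<exists>B. finite B \<and> root_space D A z \<subseteq> cvec.span B)"

definition generalized_eigenfunction ::
  "'n::finite L2 set \<Rightarrow> ('n L2 \<Rightarrow> 'n L2) \<Rightarrow> complex \<Rightarrow> 'n L2 \<Rightarrow> bool" where
  "generalized_eigenfunction D A z u \<longleftrightarrow> u \<noteq> 0 \<and> u \<in> root_space D A z"

definition adj_dom :: "'n::finite L2 set \<Rightarrow> ('n L2 \<Rightarrow> 'n L2) \<Rightarrow> 'n L2 set" where
  "adj_dom D A = {w. \<exists>h. \<forall>u\<in>D. cinner (A u) w = cinner u h}"

text \<open>Well defined on \<open>adj_dom D A\<close> for dense \<open>D\<close>.\<close>

definition adj_op :: "'n::finite L2 set \<Rightarrow> ('n L2 \<Rightarrow> 'n L2) \<Rightarrow> 'n L2 \<Rightarrow> 'n L2" where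
  "adj_op D A w = (THE h. \<forall>u\<in>D. cinner (A u) w = cinner u h)"


section \<open>The operator \<open>\<H>\<close>\<close>

definition H2 :: "'n::finite L2 set" where
  "H2 = {u. sobolev (Lp 2) 2 (rep_L2 u)}"

definition weak_pd :: "'n::finite \<Rightarrow> 'n L2 \<Rightarrow> 'n L2" where
  "weak_pd i u = (THE w. has_weak_pd i (rep_L2 u) (rep_L2 w))"

definition weak_lap :: "'n::finite L2 \<Rightarrow> 'n L2" where
  "weak_lap u = (\<Sum>i\<in>UNIV. weak_pd i (weak_pd i u))"

definition conv :: "(real ^ 'n::finite \<Rightarrow> real) \<Rightarrow> (real ^ 'n \<Rightarrow> real) \<Rightarrow> real ^ 'n \<Rightarrow> real" where
  "conv W \<mu> x = (LINT y|torus. W (x - y) * \<mu> y)"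

definition eff_potential ::
  "(real ^ 'n::finite \<Rightarrow> real) \<Rightarrow> (real ^ 'n \<Rightarrow> real) \<Rightarrow> (real ^ 'n \<Rightarrow> real) \<Rightarrow> real ^ 'n \<Rightarrow> real" where
  "eff_potential V W \<mu> x = V x + conv W \<mu> x"

definition probability_density :: "(real ^ 'n::finite \<Rightarrow> real) \<Rightarrow> bool" where
  "probability_density \<mu> \<longleftrightarrow>
     (\<forall>x. 0 \<le> \<mu> x) \<and> integrable torus \<mu> \<and> (LINT x|torus. \<mu> x) = 1"

definition stationary_state ::
  "real \<Rightarrow> (real ^ 'n::finite \<Rightarrow> real) \<Rightarrow> (real ^ 'n \<Rightarrow> real) \<Rightarrow> (real ^ 'n \<Rightarrow> real) \<Rightarrow> bool" where
  "stationary_state \<sigma> V W \<mu> \<longleftrightarrow> periodic \<mu> \<and> probability_density \<mu> \<and>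
     (let v = eff_potential V W \<mu>; Z = (LINT x|torus. exp (- (1 / \<sigma>) * v x))
      in \<forall>x. \<mu> x = 1 / Z * exp (- (1 / \<sigma>) * v x))"

definition Psi :: "real \<Rightarrow> (real ^ 'n::finite \<Rightarrow> real) \<Rightarrow> real ^ 'n \<Rightarrow> real" where
  "Psi \<sigma> v x = 1 / (4 * \<sigma>) * (norm (grad v x))\<^sup>2 - 1 / 2 * lap v x"

definition H_loc :: "real \<Rightarrow> (real ^ 'n::finite \<Rightarrow> real) \<Rightarrow> 'n L2 \<Rightarrow> 'n L2" where
  "H_loc \<sigma> v u =
     - (\<sigma> *\<^sub>R weak_lap u) + mk_L2 (\<lambda>x. complex_of_real (Psi \<sigma> v x) * rep_L2 u x)"

definition kern ::
  "(real ^ 'n::finite \<Rightarrow> real) \<Rightarrow> (real ^ 'n \<Rightarrow> real) \<Rightarrow> real ^ 'n \<Rightarrow> real ^ 'n \<Rightarrow> real" where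
  "kern W \<mu> x y = - (sqrt (\<mu> y) / sqrt (\<mu> x)) *
     (grad \<mu> x \<bullet> grad W (x - y) + \<mu> x * lap W (x - y))"

definition K_op :: "(real ^ 'n::finite \<Rightarrow> real) \<Rightarrow> (real ^ 'n \<Rightarrow> real) \<Rightarrow> 'n L2 \<Rightarrow> 'n L2" where
  "K_op W \<mu> u = mk_L2 (\<lambda>x. LINT y|torus. complex_of_real (kern W \<mu> x y) * rep_L2 u y)"

definition H_op ::
  "real \<Rightarrow> (real ^ 'n::finite \<Rightarrow> real) \<Rightarrow> (real ^ 'n \<Rightarrow> real) \<Rightarrow> (real ^ 'n \<Rightarrow> real) \<Rightarrow>
     'n L2 \<Rightarrow> 'n L2" where
  "H_op \<sigma> V W \<mu> u = H_loc \<sigma> (eff_potential V W \<mu>) u + K_op W \<mu> u"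


section \<open>Conditions on the interaction potential\<close>

definition even_in_each_coordinate :: "(real ^ 'n::finite \<Rightarrow> real) \<Rightarrow> bool" where
  "even_in_each_coordinate W \<longleftrightarrow> (\<forall>x i. W (\<chi> j. if j = i then - x $ j else x $ j) = W x)"

definition H_stable :: "(real ^ 'n::finite \<Rightarrow> real) \<Rightarrow> bool" where
  "H_stable W \<longleftrightarrow> (\<forall>\<nu> :: real ^ 'n \<Rightarrow> real. Lp 2 \<nu> \<longrightarrow>
     0 \<le> (LINT p|(torus \<Otimes>\<^sub>M torus). W (fst p - snd p) * \<nu> (fst p) * \<nu> (snd p)))"

end

theory Submission
  imports Defs
begin

text \<open>
  With \<open>s = sqrt \<mu>\<close>, the nonlocal part factors through the local one:
  \<open>\<K> = \<H>\<^sub>l\<^sub>o\<^sub>c C\<close> with \<open>C = s (W * (s \<cdot>)) / \<sigma>\<close>, because \<open>\<sigma> \<Delta>s = \<Psi> s\<close>. Hence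
  \<open>\<H> = \<H>\<^sub>l\<^sub>o\<^sub>c M\<close>, where \<open>M = 1 + C\<close> is bounded, self-adjoint (as \<open>W\<close> is even) and coercive: either \<open>C \<ge> 0\<close>
  by \<open>H\<close>-stability, or \<open>\<parallel>C\<parallel> \<le> \<parallel>W\<parallel>\<^sub>\<infinity> / \<sigma> < 1\<close> as \<open>s\<close> has norm one. So \<open>\<H>\<close> is symmetric for the equivalent inner
  product \<open>\<langle>M u, w\<rangle>\<close>, and semibounded. For large \<open>c\<close> the inverse of \<open>\<H> + c\<close> exists by a Neumann series around
  \<open>-\<sigma>\<Delta> + c\<close>, which is diagonal in the Fourier basis; it is compact, positive and symmetric for that inner
  product. Its eigenvectors \<open>\<phi>\<^sub>n\<close> form an orthonormal basis for it, the spectrum is real, and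
  \<open>\<phi>\<^sub>n\<^sup>* = M \<phi>\<^sub>n\<close> is the biorthogonal system.
\<close>

text \<open>\<open>H\<close> is not self-adjoint, and for a general operator of this kind density of
  the generalized eigenfunctions is the hard claim. The factorization removes the difficulty: M H =
  M H_loc M is symmetric, so in the new inner product H has no Jordan chains, every root vector is
  an eigenvector, and completeness becomes the spectral theorem for compact symmetric operators. The
  same identity reads H* M = M H on \<open>H2\<close>, which explains the dual eigenfunctions. The
  obstacle is invertibility. H_loc annihilates s, so it has no inverse to combine with that of M,
  and H + c differs in general from (H_loc + c) M. The shifted inverse is therefore built without
  the factorization, from Psi + K as a bounded perturbation. This needs a separate proof that K is
  bounded, and c must be large for two reasons: the perturbation has to be a contraction, and H + c
  has to be positive in the new inner product. Derivatives act diagonally on Fourier coefficients,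
  so membership in \<open>H2\<close>, symmetry of the Laplacian and compactness of its resolvent
  become statements about square summable sequences.\<close>

section \<open>The quotient space L2: representatives, complex inner product and norm\<close>

lemma L2rel_rep: "L2rel (rep_L2 u) (rep_L2 u)"
  by (rule Quotient3_rep_reflp[OF Quotient3_L2])

lemma Lp2_rep: "Lp 2 (rep_L2 u)"
  using L2rel_rep[of u] by (simp add: L2rel_def)

lemma mk_L2_rep [simp]: "mk_L2 (rep_L2 u) = u"
  by (rule Quotient3_abs_rep[OF Quotient3_L2])

lemma mk_L2_eq_iff:
  assumes "Lp 2 f" "Lp 2 g"
  shows "mk_L2 f = mk_L2 g \<longleftrightarrow> (AE x in torus. f x = g x)"
  using Quotient3_rel[OF Quotient3_L2, of f g] assms by (simp add: L2rel_def)

lemma AE_rep_mk_L2: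
  assumes "Lp 2 f"
  shows "AE x in torus. rep_L2 (mk_L2 f) x = f x"
  using mk_L2_eq_iff[OF Lp2_rep assms, of "mk_L2 f"] by simp

lemma mk_L2_add: "Lp 2 f \<Longrightarrow> Lp 2 g \<Longrightarrow> mk_L2 f + mk_L2 g = mk_L2 (\<lambda>x. f x + g x)"
  by (simp add: plus_L2.abs_eq eq_onp_def L2rel_def)

lemma mk_L2_scaleC: "Lp 2 f \<Longrightarrow> c *\<^sub>C mk_L2 f = mk_L2 (\<lambda>x. c * f x)"
  by (simp add: scaleC.abs_eq L2rel_def)

lemma cinner_mk_L2: "Lp 2 f \<Longrightarrow> Lp 2 g \<Longrightarrow> cinner (mk_L2 f) (mk_L2 g) = (LINT x|torus. f x * cnj (g x))"
  by (simp add: cinner.abs_eq L2rel_def)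

lemma scaleR_scaleC: "r *\<^sub>R (u :: 'n::finite L2) = of_real r *\<^sub>C u"
  by (simp add: scaleR_L2_def)

lemma cinner_add_left: "cinner (u + v) w = cinner u w + cinner v w"
proof transfer
  fix f g h :: "real ^ 'a \<Rightarrow> complex"
  assume "L2rel f f" "L2rel g g" "L2rel h h"
  then have "integrable torus (\<lambda>x. f x * cnj (h x))" "integrable torus (\<lambda>x. g x * cnj (h x))"
    by (auto simp: L2rel_def intro: Lp2_integrable_mult)
  then show "(LINT x|torus. (f x + g x) * cnj (h x)) =
      (LINT x|torus. f x * cnj (h x)) + (LINT x|torus. g x * cnj (h x))"
    by (simp add: distrib_right)
qed

lemma cinner_commute: "cinner u v = cnj (cinner v u)"
  by transfer (subst Bochner_Integration.integral_cnj[symmetric], simp add: mult.commute)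

lemma cinner_scaleC_left [simp]: "cinner (c *\<^sub>C u) v = c * cinner u v"
  by transfer (simp add: mult.assoc)

lemma cinner_scaleC_right [simp]: "cinner u (c *\<^sub>C v) = cnj c * cinner u v"
  by (subst (1 2) cinner_commute) simp

lemma cinner_add_right: "cinner u (v + w) = cinner u v + cinner u w"
  by (subst (1 2 3) cinner_commute) (simp add: cinner_add_left)

lemma cinner_self: "cinner u u = of_real ((norm u)\<^sup>2)"
proof -
  have "cinner u u \<in> \<real>"
    using cinner_commute[of u u] by (metis Reals_cnj_iff)
  moreover have "Re (cinner u u) = (norm u)\<^sup>2"
    by (simp add: power2_norm_eq_inner inner_L2_def)
  ultimately show ?thesis
    by (metis of_real_Re)
qed

lemma norm_scaleC [simp]: "norm (c *\<^sub>C u) = norm c * norm (u :: 'n::finite L2)"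
proof -
  have "cinner (c *\<^sub>C u) (c *\<^sub>C u) = (c * cnj c) * cinner u u"
    by simp
  also have "\<dots> = of_real ((norm c * norm u)\<^sup>2)"
    by (simp only: cinner_self power_mult_distrib of_real_mult complex_norm_square[symmetric])
  finally have "cinner (c *\<^sub>C u) (c *\<^sub>C u) = of_real ((norm c * norm u)\<^sup>2)" .
  then have "(norm (c *\<^sub>C u))\<^sup>2 = (norm c * norm u)\<^sup>2"
    by (simp only: cinner_self of_real_eq_iff)
  then show ?thesis
    by (simp add: power2_eq_iff_nonneg)
qed

text \<open>Cauchy-Schwarz is available for \<open>inner\<close>, the real part of
  \<open>cinner\<close>. A unimodular factor \<open>a\<close> turns \<open>cinner u v\<close> into a
  nonnegative real, so its modulus is a value of \<open>inner\<close>.\<close>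

lemma norm_cinner_le: "norm (cinner u v) \<le> norm u * norm v"
proof -
  obtain a where a: "norm a = 1" "a * cinner u v = of_real (norm (cinner u v))"
  proof (cases "cinner u v = 0")
    case True
    then show ?thesis by (intro that[of 1]) auto
  next
    case False
    then show ?thesis
      by (intro that[of "cnj (cinner u v) / of_real (norm (cinner u v))"])
         (auto simp: norm_divide mult.commute[of "cnj _"] power2_eq_square complex_norm_square[symmetric])
  qed
  have "norm (cinner u v) = inner (a *\<^sub>C u) v"
    using a(2) by (simp add: inner_L2_def)
  also have "\<dots> \<le> norm (a *\<^sub>C u) * norm v"
    by (rule norm_cauchy_schwarz)
  finally show ?thesis
    by (simp add: a)
qed

lemma scaleC_scaleR_commute: "c *\<^sub>C r *\<^sub>R (u :: 'n::finite L2) = r *\<^sub>R c *\<^sub>C u"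
  by (simp add: scaleR_scaleC mult.commute)

lemma bounded_bilinear_cinner: "bounded_bilinear (cinner :: 'n::finite L2 \<Rightarrow> _)"
proof
  show "\<exists>K. \<forall>a b :: 'n L2. norm (cinner a b) \<le> norm a * norm b * K"
    using norm_cinner_le by (intro exI[of _ 1]) auto
qed (auto simp: cinner_add_left cinner_add_right scaleR_scaleC scaleR_conv_of_real)

lemma bounded_bilinear_scaleC: "bounded_bilinear (scaleC :: complex \<Rightarrow> 'n::finite L2 \<Rightarrow> _)"
proof
  show "\<exists>K. \<forall>a (b :: 'n L2). norm (a *\<^sub>C b) \<le> norm a * norm b * K"
    by (intro exI[of _ 1]) auto
qed (auto simp: cvec.scale_left_distrib cvec.scale_right_distrib scaleR_scaleC scaleR_conv_of_real mult_ac)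

interpretation cinner: bounded_bilinear "cinner :: 'n::finite L2 \<Rightarrow> _"
  by (rule bounded_bilinear_cinner)

interpretation scaleC: bounded_bilinear "scaleC :: complex \<Rightarrow> 'n::finite L2 \<Rightarrow> _"
  by (rule bounded_bilinear_scaleC)

lemma norm_mk_L2:
  assumes "Lp 2 f"
  shows "(norm (mk_L2 f))\<^sup>2 = (LINT x|torus. (norm (f x))\<^sup>2)"
proof -
  have "of_real ((norm (mk_L2 f))\<^sup>2) = (LINT x|torus. f x * cnj (f x))"
    by (simp only: cinner_self[symmetric] cinner_mk_L2 assms)
  also have "\<dots> = of_real (LINT x|torus. (norm (f x))\<^sup>2)"
    by (simp only: complex_norm_square integral_complex_of_real[symmetric])
  finally show ?thesis
    by (simp only: of_real_eq_iff)
qed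

lemma norm_rep_L2: "(norm u)\<^sup>2 = (LINT x|torus. (norm (rep_L2 u x))\<^sup>2)"
  using norm_mk_L2[OF Lp2_rep, of u] by simp

section \<open>Finite measure of the torus and completeness of L2\<close>

lemma space_torus: "space torus = cbox 0 (\<chi> i. 2 * pi)"
  by (simp add: torus_def space_restrict_space)

interpretation torus: finite_measure "torus :: (real ^ 'n::finite) measure"
proof
  have "emeasure torus (space (torus :: (real^'n) measure)) =
      emeasure lborel (cbox 0 (\<chi> i. 2 * pi) :: (real^'n) set)"
    unfolding space_torus by (subst torus_def, subst emeasure_restrict_space) auto
  also have "\<dots> < \<infinity>"
    by (rule emeasure_lborel_cbox_finite)
  finally show "emeasure torus (space (torus :: (real^'n) measure)) \<noteq> \<infinity>"
    by simp
qed

lemma Lp2_integrable: "Lp 2 f \<Longrightarrow> integrable torus (f :: _ \<Rightarrow> complex)"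
  using Lp2_integrable_mult[of f "\<lambda>_. 1"] by (simp add: Lp2_iff)

lemma Lp2_diff:
  fixes f g :: "real ^ 'n::finite \<Rightarrow> complex"
  assumes "Lp 2 f" "Lp 2 g" shows "Lp 2 (\<lambda>x. f x - g x)"
  using Lp2_add[OF assms(1) Lp2_cmult[OF assms(2), of "-1"]] by simp

lemma AE_rep_diff: "AE x in torus. rep_L2 (u - v) x = rep_L2 u x - rep_L2 v x"
proof -
  have "u - v = mk_L2 (rep_L2 u) + (- 1) *\<^sub>C mk_L2 (rep_L2 v)"
    by simp
  also have "\<dots> = mk_L2 (\<lambda>x. rep_L2 u x - rep_L2 v x)"
    by (simp only: mk_L2_scaleC mk_L2_add Lp2_rep Lp2_cmult) simp
  finally show ?thesis
    using AE_rep_mk_L2[OF Lp2_diff[OF Lp2_rep Lp2_rep], of u v] by simp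
qed

lemma nn_integral_norm_L2:
  "(\<integral>\<^sup>+x. ennreal ((norm (rep_L2 u x))\<^sup>2) \<partial>torus) = ennreal ((norm u)\<^sup>2)"
  using Lp2_rep[of u] unfolding Lp2_iff
  by (subst nn_integral_eq_integral) (auto simp: norm_rep_L2)

text \<open>Cauchy-Schwarz against the constant 1: on a space of finite measure the L1 norm is
  controlled by the L2 norm. The extended integral suits the summation of infinitely many increments
  below.\<close>

lemma nn_integral_norm_le:
  "(\<integral>\<^sup>+x. ennreal (norm (rep_L2 (u :: 'n::finite L2) x)) \<partial>torus) \<le>
    ennreal (sqrt (measure (torus :: (real^'n) measure) (space torus)) * norm u)"
proof -
  have 1: "Lp 2 (\<lambda>x::real^'n. 1 :: complex)" by (simp add: Lp2_iff)
  have n: "Lp 2 (\<lambda>x. complex_of_real (norm (rep_L2 u x)))"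
    using Lp2_rep[of u] by (auto simp: Lp2_iff)
  have i: "integrable torus (\<lambda>x. norm (rep_L2 u x))"
    using Lp2_integrable[OF Lp2_rep, of u] by simp
  have "(LINT x|torus. norm (rep_L2 u x)) = norm (cinner (mk_L2 (\<lambda>x. complex_of_real (norm (rep_L2 u x)))) (mk_L2 (\<lambda>x. 1)))"
    by (simp add: cinner_mk_L2 1 n integral_complex_of_real integral_nonneg_AE)
  also have "\<dots> \<le> norm (mk_L2 (\<lambda>x. complex_of_real (norm (rep_L2 u x)))) * norm (mk_L2 (\<lambda>x::real^'n. 1))"
    by (rule norm_cinner_le)
  also have "norm (mk_L2 (\<lambda>x. complex_of_real (norm (rep_L2 u x)))) = norm u"
    by (rule power2_eq_imp_eq) (simp_all add: norm_mk_L2 n norm_rep_L2[of u])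
  also have "norm (mk_L2 (\<lambda>x::real^'n. 1)) = sqrt (measure (torus :: (real^'n) measure) (space torus))"
    by (rule power2_eq_imp_eq) (simp_all add: norm_mk_L2 1)
  finally show ?thesis
    using i by (subst nn_integral_eq_integral) (auto simp: mult.commute ennreal_leI)
qed

text \<open>The Riesz-Fischer argument. Increments summable in L2, hence in L1, have an almost
  everywhere finite sum, so the representatives converge pointwise almost everywhere; Fatou's lemma
  then makes the pointwise limit an L2 limit.\<close>

lemma L2_fast_Cauchy_convergent:
  fixes u :: "nat \<Rightarrow> 'n::finite L2"
  assumes fast: "\<And>n. norm (u (Suc n) - u n) \<le> (1/2) ^ n"
    and Cauchy: "Cauchy u"
  shows "convergent u"
proof -
  define f where "f n = rep_L2 (u n)" for n
  have fm [measurable]: "f n \<in> borel_measurable torus" for n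
    using Lp2_rep[of "u n"] by (simp add: f_def Lp2_iff)
  define C where "C = sqrt (measure (torus :: (real^'n) measure) (space torus))"
  have "(\<integral>\<^sup>+x. (\<Sum>n. ennreal (norm (f (Suc n) x - f n x))) \<partial>torus)
      = (\<Sum>n. \<integral>\<^sup>+x. ennreal (norm (f (Suc n) x - f n x)) \<partial>torus)"
    by (rule nn_integral_suminf) measurable
  also have "\<dots> \<le> (\<Sum>n. ennreal (C * (1/2) ^ n))"
  proof (rule suminf_le)
    fix n
    have "(\<integral>\<^sup>+x. ennreal (norm (f (Suc n) x - f n x)) \<partial>torus)
        = (\<integral>\<^sup>+x. ennreal (norm (rep_L2 (u (Suc n) - u n) x)) \<partial>torus)"
      using AE_rep_diff[of "u (Suc n)" "u n"] by (intro nn_integral_cong_AE) (auto simp: f_def)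
    also have "\<dots> \<le> ennreal (C * norm (u (Suc n) - u n))"
      unfolding C_def by (rule nn_integral_norm_le)
    also have "\<dots> \<le> ennreal (C * (1/2) ^ n)"
      using fast[of n] by (intro ennreal_leI mult_left_mono) (auto simp: C_def)
    finally show "(\<integral>\<^sup>+x. ennreal (norm (f (Suc n) x - f n x)) \<partial>torus) \<le> ennreal (C * (1/2) ^ n)" .
  qed auto
  also have "\<dots> = ennreal (\<Sum>n. C * (1/2) ^ n)"
    by (rule suminf_ennreal2) (auto simp: C_def intro!: summable_mult summable_geometric)
  also have "\<dots> < \<infinity>"
    by simp
  finally have "AE x in torus. (\<Sum>n. ennreal (norm (f (Suc n) x - f n x))) \<noteq> \<infinity>"
    by (intro nn_integral_PInf_AE) auto
  then have conv: "AE x in torus. convergent (\<lambda>n. f n x)"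
  proof eventually_elim
    case (elim x)
    then have "summable (\<lambda>n. norm (f (Suc n) x - f n x))"
      by (intro summable_suminf_not_top) auto
    then have "summable (\<lambda>n. f (Suc n) x - f n x)"
      by (rule summable_norm_cancel)
    then have "convergent (\<lambda>n. \<Sum>i<n. f (Suc i) x - f i x)"
      by (simp add: summable_iff_convergent)
    then have "convergent (\<lambda>n. f n x - f 0 x)"
      by (subst (asm) sum_lessThan_telescope)
    then show ?case
      using convergent_add[OF _ convergent_const[of "f 0 x"], of "\<lambda>n. f n x - f 0 x"] by simp
  qed
  define g where "g x = lim (\<lambda>n. f n x)" for x
  have gm [measurable]: "g \<in> borel_measurable torus"
    unfolding g_def by measurable
  \<comment> \<open>Fatou: a bound \<open>e\<close> on all later distances from \<open>u m\<close>
    passes to the pointwise limit. It serves twice, to put \<open>g\<close> in L2 and to prove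
    convergence in norm.\<close>
  have tail: "(\<integral>\<^sup>+x. ennreal ((norm (g x - f m x))\<^sup>2) \<partial>torus) \<le> ennreal (e\<^sup>2)"
    if "\<And>n. n \<ge> m \<Longrightarrow> norm (u n - u m) \<le> e" "e \<ge> 0" for m e
  proof -
    have "(\<integral>\<^sup>+x. ennreal ((norm (g x - f m x))\<^sup>2) \<partial>torus) =
      (\<integral>\<^sup>+x. liminf (\<lambda>n. ennreal ((norm (f n x - f m x))\<^sup>2)) \<partial>torus)"
    proof (rule nn_integral_cong_AE)
      show "AE x in torus. ennreal ((norm (g x - f m x))\<^sup>2) = liminf (\<lambda>n. ennreal ((norm (f n x - f m x))\<^sup>2))"
        using conv
      proof eventually_elim
        case (elim x)
        then have "(\<lambda>n. f n x) \<longlonglongrightarrow> g x"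
          by (simp add: g_def convergent_LIMSEQ_iff)
        then have "(\<lambda>n. ennreal ((norm (f n x - f m x))\<^sup>2)) \<longlonglongrightarrow> ennreal ((norm (g x - f m x))\<^sup>2)"
          by (intro tendsto_intros)
        then show ?case
          using lim_imp_Liminf by (metis sequentially_bot)
      qed
    qed
    also have "\<dots> \<le> liminf (\<lambda>n. \<integral>\<^sup>+x. ennreal ((norm (f n x - f m x))\<^sup>2) \<partial>torus)"
      by (rule nn_integral_liminf) measurable
    also have "\<dots> \<le> liminf (\<lambda>n. ennreal (e\<^sup>2))"
    proof (rule Liminf_mono)
      show "eventually (\<lambda>n. (\<integral>\<^sup>+x. ennreal ((norm (f n x - f m x))\<^sup>2) \<partial>torus) \<le> ennreal (e\<^sup>2)) sequentially"
        using eventually_ge_at_top[of m]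
      proof eventually_elim
        case (elim n)
        have "(\<integral>\<^sup>+x. ennreal ((norm (f n x - f m x))\<^sup>2) \<partial>torus)
            = (\<integral>\<^sup>+x. ennreal ((norm (rep_L2 (u n - u m) x))\<^sup>2) \<partial>torus)"
          using AE_rep_diff[of "u n" "u m"] by (intro nn_integral_cong_AE) (auto simp: f_def)
        also have "\<dots> = ennreal ((norm (u n - u m))\<^sup>2)"
          by (rule nn_integral_norm_L2)
        also have "\<dots> \<le> ennreal (e\<^sup>2)"
          using that elim by (intro ennreal_leI power_mono) auto
        finally show ?case .
      qed
    qed
    also have "\<dots> = ennreal (e\<^sup>2)"
      by (simp add: Liminf_const)
    finally show ?thesis .
  qed
  have gL: "Lp 2 (\<lambda>x. g x - f m x)" if "\<And>n. n \<ge> m \<Longrightarrow> norm (u n - u m) \<le> e" "e \<ge> 0" for m e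
    unfolding Lp2_iff
  proof
    show "integrable torus (\<lambda>x. (norm (g x - f m x))\<^sup>2)"
      using order_le_less_trans[OF tail[OF that] ennreal_less_top]
      by (intro integrableI_bounded) (auto simp: infinity_ennreal_def)
  qed auto
  have nb: "norm (mk_L2 g - u m) \<le> e" if "\<And>n. n \<ge> m \<Longrightarrow> norm (u n - u m) \<le> e" "e \<ge> 0" for m e
  proof -
    have gL': "Lp 2 g"
      using Lp2_add[OF gL[OF that] Lp2_rep[of "u m"]] by (simp add: f_def)
    have "mk_L2 g - u m = mk_L2 g + (-1) *\<^sub>C mk_L2 (f m)"
      by (simp add: f_def)
    also have "\<dots> = mk_L2 (\<lambda>x. g x - f m x)"
      by (simp only: f_def mk_L2_scaleC mk_L2_add Lp2_rep Lp2_cmult gL') simp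
    finally have "ennreal ((norm (mk_L2 g - u m))\<^sup>2) = (\<integral>\<^sup>+x. ennreal ((norm (g x - f m x))\<^sup>2) \<partial>torus)"
      using gL[OF that] unfolding Lp2_iff
      by (subst nn_integral_eq_integral) (auto simp: norm_mk_L2[OF gL[OF that]])
    also have "\<dots> \<le> ennreal (e\<^sup>2)"
      by (rule tail[OF that])
    finally have "(norm (mk_L2 g - u m))\<^sup>2 \<le> e\<^sup>2"
      by (simp add: ennreal_le_iff)
    then show ?thesis
      using that(2) by (rule power2_le_imp_le)
  qed
  have "u \<longlonglongrightarrow> mk_L2 g"
  proof (rule LIMSEQ_I)
    fix r :: real assume "r > 0"
    then obtain M where M: "\<And>m n. m \<ge> M \<Longrightarrow> n \<ge> M \<Longrightarrow> norm (u m - u n) < r/2"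
      using CauchyD[OF Cauchy, of "r/2"] by auto
    have "norm (mk_L2 g - u m) \<le> r/2" if "m \<ge> M" for m
      using that M \<open>r > 0\<close> by (intro nb) (auto intro!: less_imp_le)
    then have "norm (u m - mk_L2 g) < r" if "m \<ge> M" for m
      using that \<open>r > 0\<close> norm_minus_commute[of "u m" "mk_L2 g"] by force
    then show "\<exists>no. \<forall>n\<ge>no. norm (u n - mk_L2 g) < r"
      by blast
  qed
  then show ?thesis
    by (auto simp: convergent_def)
qed

instance L2 :: (finite) complete_space
proof
  fix u :: "nat \<Rightarrow> 'a L2"
  assume C: "Cauchy u"
  \<comment> \<open>Requiring \<open>M > k\<close> makes the chosen indices strictly increasing, and
    the bound for all \<open>m \<ge> M\<close> covers the next index, which gives the geometric rate
    of the subsequence.\<close>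
  have "\<exists>M. M > k \<and> (\<forall>m\<ge>M. norm (u m - u M) \<le> (1/2) ^ n)" for k n
  proof -
    have "(1/2::real) ^ n > 0" by simp
    then obtain M where M: "\<And>i j. i \<ge> M \<Longrightarrow> j \<ge> M \<Longrightarrow> norm (u i - u j) < (1/2) ^ n"
      using CauchyD[OF C, of "(1/2) ^ n"] by blast
    then show ?thesis
      by (intro exI[of _ "max M (Suc k)"]) (auto intro!: less_imp_le)
  qed
  then have "\<exists>r. \<forall>n. (\<forall>m\<ge>r n. norm (u m - u (r n)) \<le> (1/2) ^ n) \<and> r n < r (Suc n)"
    by (intro dependent_nat_choice) blast+
  then obtain r where r: "\<And>n. r n < r (Suc n)" "\<And>n m. m \<ge> r n \<Longrightarrow> norm (u m - u (r n)) \<le> (1/2) ^ n"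
    by auto
  have sm: "strict_mono r"
    using r(1) by (simp add: strict_mono_Suc_iff)
  have "convergent (u \<circ> r)"
    using r sm C by (intro L2_fast_Cauchy_convergent Cauchy_subseq_Cauchy) (auto simp: less_imp_le)
  then obtain l where "(u \<circ> r) \<longlonglongrightarrow> l"
    by (auto simp: convergent_def)
  then show "convergent u"
    using C sm by (metis Cauchy_converges_subseq convergentI)
qed

section \<open>Compact operators\<close>

lemma compact_operator_iff:
  "compact_operator T \<longleftrightarrow> bounded_linear T \<and>
     (\<forall>u. (\<forall>n. norm (u n) < 1) \<longrightarrow> (\<exists>l r. strict_mono (r :: nat \<Rightarrow> nat) \<and> (\<lambda>n. T (u (r n))) \<longlonglongrightarrow> l))"
    (is "_ \<longleftrightarrow> _ \<and> ?S")
proof -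
  have "?S" if c: "compact (closure (T ` ball 0 1))"
  proof (intro allI impI)
    fix u :: "nat \<Rightarrow> 'a L2" assume "\<forall>n. norm (u n) < 1"
    then have "\<forall>n. T (u n) \<in> closure (T ` ball 0 1)"
      by (auto intro!: subsetD[OF closure_subset])
    with c[unfolded compact_eq_seq_compact_metric seq_compact_def, THEN spec, of "\<lambda>n. T (u n)"]
    show "\<exists>l r. strict_mono (r :: nat \<Rightarrow> nat) \<and> (\<lambda>n. T (u (r n))) \<longlonglongrightarrow> l"
      unfolding o_def by blast
  qed
  moreover have "compact (closure (T ` ball 0 1))" if s: ?S
    unfolding compact_eq_seq_compact_metric seq_compact_def
  proof (intro allI impI)
    fix y :: "nat \<Rightarrow> 'a L2" assume y: "\<forall>n. y n \<in> closure (T ` ball 0 1)"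
    \<comment> \<open>Points of the closure need not be values of \<open>T\<close>, so each is
      replaced by a value within 1/(n+1); the error vanishes along every subsequence.\<close>
    have "\<exists>x. norm x < 1 \<and> dist (T x) (y n) < inverse (real (Suc n))" for n
    proof -
      have "\<exists>z\<in>T ` ball 0 1. dist z (y n) < inverse (real (Suc n))"
        using y[rule_format, of n] unfolding closure_approachable by (simp del: of_nat_Suc)
      then show ?thesis by (auto simp del: of_nat_Suc)
    qed
    then obtain x where x: "\<And>n. norm (x n) < 1" "\<And>n. dist (T (x n)) (y n) < inverse (real (Suc n))"
      by metis
    obtain l r where r: "strict_mono (r :: nat \<Rightarrow> nat)" "(\<lambda>n. T (x (r n))) \<longlonglongrightarrow> l"
      using s x(1) by blast
    have "(\<lambda>n. inverse (real (Suc (r n)))) \<longlonglongrightarrow> 0"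
      using LIMSEQ_subseq_LIMSEQ[OF LIMSEQ_inverse_real_of_nat r(1)] by (simp add: o_def)
    then have "(\<lambda>n. dist (T (x (r n))) (y (r n))) \<longlonglongrightarrow> 0"
      by (rule Lim_null_comparison[rotated]) (simp del: of_nat_Suc add: less_imp_le[OF x(2)])
    then have "(\<lambda>n. norm (y (r n) - T (x (r n)))) \<longlonglongrightarrow> 0"
      by (simp add: dist_norm norm_minus_commute)
    then have "(\<lambda>n. y (r n) - T (x (r n))) \<longlonglongrightarrow> 0"
      by (rule tendsto_norm_zero_cancel)
    from tendsto_add[OF this r(2)] have "(y \<circ> r) \<longlonglongrightarrow> l"
      by (simp only: o_def diff_add_cancel add_0_left)
    moreover have "l \<in> closure (T ` ball 0 1)"
      unfolding closure_sequential
      by (intro exI[of _ "\<lambda>n. T (x (r n))"] conjI allI imageI r(2)) (simp add: x(1))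
    ultimately show "\<exists>l\<in>closure (T ` ball 0 1). \<exists>r. strict_mono (r :: nat \<Rightarrow> nat) \<and> (y \<circ> r) \<longlonglongrightarrow> l"
      using r(1) by blast
  qed
  ultimately have "compact (closure (T ` ball 0 1)) \<longleftrightarrow> ?S"
    by (intro iffI)
  then show ?thesis
    unfolding compact_operator_def by simp
qed

lemma compact_operator_linear: "compact_operator T \<Longrightarrow> bounded_linear T"
  by (simp add: compact_operator_def)

lemma compact_operator_subseq:
  fixes u :: "nat \<Rightarrow> 'n::finite L2"
  assumes T: "compact_operator T" and B: "\<And>n. norm (u n) \<le> B"
  shows "\<exists>l r. strict_mono (r :: nat \<Rightarrow> nat) \<and> (\<lambda>n. T (u (r n))) \<longlonglongrightarrow> l"
proof -
  interpret T: bounded_linear T using T by (rule compact_operator_linear)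
  have B0: "B \<ge> 0" using B[of 0] norm_ge_zero order_trans by blast
  \<comment> \<open>The unit ball is open: dividing by B + 1 keeps the vectors strictly inside it,
    also when B = 0.\<close>
  define v where "v n = (1 / (B + 1)) *\<^sub>R u n" for n
  have "norm (v n) < 1" for n
    using B[of n] B0 by (simp add: v_def divide_less_eq)
  then obtain l r where r: "strict_mono (r :: nat \<Rightarrow> nat)" "(\<lambda>n. T (v (r n))) \<longlonglongrightarrow> l"
    using T unfolding compact_operator_iff by blast
  have "(\<lambda>n. (B + 1) *\<^sub>R T (v (r n))) \<longlonglongrightarrow> (B + 1) *\<^sub>R l"
    by (intro tendsto_intros r)
  moreover have "(B + 1) *\<^sub>R T (v (r n)) = T (u (r n))" for n
    using B0 by (simp add: v_def T.scaleR)
  ultimately show ?thesis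
    using r(1) by auto
qed

lemma compact_operator_compose_right:
  assumes T: "compact_operator T" and S: "bounded_linear S"
  shows "compact_operator (\<lambda>u. T (S u))"
  unfolding compact_operator_iff
proof (intro conjI allI impI)
  show "bounded_linear (\<lambda>u. T (S u))"
    using compact_operator_linear[OF T] S by (rule bounded_linear_compose)
  obtain K where K: "K \<ge> 0" "\<And>u. norm (S u) \<le> norm u * K"
    using bounded_linear.nonneg_bounded[OF S] by blast
  fix u :: "nat \<Rightarrow> 'a L2" assume u: "\<forall>n. norm (u n) < 1"
  have "norm (S (u n)) \<le> K" for n
  proof -
    have "norm (S (u n)) \<le> norm (u n) * K" by (rule K)
    also have "\<dots> \<le> 1 * K" using u K(1) by (intro mult_right_mono) (auto intro: less_imp_le)
    finally show ?thesis by simp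
  qed
  then obtain l r where "strict_mono (r :: nat \<Rightarrow> nat)" "(\<lambda>n. T (S (u (r n)))) \<longlonglongrightarrow> l"
    using compact_operator_subseq[OF T, of "\<lambda>n. S (u n)" K] by blast
  then show "\<exists>l r. strict_mono (r :: nat \<Rightarrow> nat) \<and> (\<lambda>n. T (S (u (r n)))) \<longlonglongrightarrow> l"
    by blast
qed

lemma compact_operator_add:
  assumes T: "compact_operator T" and S: "compact_operator S"
  shows "compact_operator (\<lambda>u. T u + S u)"
  unfolding compact_operator_iff
proof (intro conjI allI impI)
  show "bounded_linear (\<lambda>u. T u + S u)"
    using compact_operator_linear[OF T] compact_operator_linear[OF S] by (rule bounded_linear_add)
  fix u :: "nat \<Rightarrow> 'a L2" assume "\<forall>n. norm (u n) < 1"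
  then have u: "\<And>n. norm (u n) \<le> 1" by (simp add: less_imp_le)
  then obtain l r where r: "strict_mono (r :: nat \<Rightarrow> nat)" "(\<lambda>n. T (u (r n))) \<longlonglongrightarrow> l"
    using compact_operator_subseq[OF T, of u 1] by blast
  obtain l' r' where r': "strict_mono (r' :: nat \<Rightarrow> nat)" "(\<lambda>n. S (u (r (r' n)))) \<longlonglongrightarrow> l'"
    using compact_operator_subseq[OF S, of "\<lambda>n. u (r n)" 1] u by blast
  have "(\<lambda>n. T (u (r (r' n)))) \<longlonglongrightarrow> l"
    using LIMSEQ_subseq_LIMSEQ[OF r(2) r'(1)] by (simp add: o_def)
  then have "(\<lambda>n. T (u ((r \<circ> r') n)) + S (u ((r \<circ> r') n))) \<longlonglongrightarrow> l + l'"
    using tendsto_add[OF _ r'(2)] by simp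
  then show "\<exists>l r. strict_mono (r :: nat \<Rightarrow> nat) \<and> (\<lambda>n. T (u (r n)) + S (u (r n))) \<longlonglongrightarrow> l"
    using strict_mono_o[OF r(1) r'(1)] by blast
qed

lemma compact_operator_zero: "compact_operator (\<lambda>u. 0)"
  unfolding compact_operator_iff
  by (auto intro!: exI[of _ 0] exI[of _ "\<lambda>n. n"] simp: strict_mono_def)

lemma compact_operator_sum:
  "finite I \<Longrightarrow> (\<And>i. i \<in> I \<Longrightarrow> compact_operator (T i)) \<Longrightarrow> compact_operator (\<lambda>u. \<Sum>i\<in>I. T i u)"
  by (induction I rule: finite_induct) (auto intro: compact_operator_zero compact_operator_add)

lemma compact_operator_rank1: "compact_operator (\<lambda>u. cinner u a *\<^sub>C b)"
  unfolding compact_operator_iff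
proof (intro conjI allI impI)
  show "bounded_linear (\<lambda>u. cinner u a *\<^sub>C b)"
    by (rule bounded_linear_compose[OF scaleC.bounded_linear_left cinner.bounded_linear_left])
  fix u :: "nat \<Rightarrow> 'a L2" assume u: "\<forall>n. norm (u n) < 1"
  have "cinner (u n) a \<in> cball 0 (norm a)" for n
  proof -
    have "norm (cinner (u n) a) \<le> norm (u n) * norm a" by (rule norm_cinner_le)
    also have "\<dots> \<le> 1 * norm a" using u by (intro mult_right_mono) (auto intro: less_imp_le)
    finally show ?thesis by simp
  qed
  then obtain c r where r: "strict_mono (r :: nat \<Rightarrow> nat)" "(\<lambda>n. cinner (u (r n)) a) \<longlonglongrightarrow> c"
    using compact_cball[of "0::complex" "norm a",
        unfolded compact_eq_seq_compact_metric seq_compact_def, THEN spec, of "\<lambda>n. cinner (u n) a"]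
    unfolding o_def by blast
  have "(\<lambda>n. cinner (u (r n)) a *\<^sub>C b) \<longlonglongrightarrow> c *\<^sub>C b"
    by (rule scaleC.tendsto[OF r(2) tendsto_const])
  then show "\<exists>l r. strict_mono (r :: nat \<Rightarrow> nat) \<and> (\<lambda>n. cinner (u (r n)) a *\<^sub>C b) \<longlonglongrightarrow> l"
    using r(1) by blast
qed

text \<open>Total boundedness survives uniform approximation: on the unit ball the error is at most
  e/4, so an e/4-net for the values of \<open>S\<close> is an e/2-net for those of \<open>T\<close>.
  Closed balls of radius e/2 let the finite cover pass to the closure before the radius grows to
  e.\<close>

lemma compact_operator_approx:
  assumes T: "bounded_linear T"
    and approx: "\<And>e. e > 0 \<Longrightarrow> \<exists>S. compact_operator S \<and> (\<forall>u. norm (T u - S u) \<le> e * norm u)"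
  shows "compact_operator T"
  unfolding compact_operator_def
proof
  show "bounded_linear T" by (rule T)
  show "compact (closure (T ` ball 0 1))"
    unfolding compact_eq_totally_bounded
  proof (intro conjI allI impI)
    show "complete (closure (T ` ball 0 1))"
      by (simp add: complete_eq_closed)
    fix e :: real assume "e > 0"
    then obtain S where S: "compact_operator S" "\<And>u. norm (T u - S u) \<le> e/4 * norm u"
      using approx[of "e/4"] by auto
    have "e/4 > 0" using \<open>e > 0\<close> by simp
    then obtain k where k: "finite k" "closure (S ` ball 0 1) \<subseteq> (\<Union>x\<in>k. ball x (e/4))"
      using S(1) unfolding compact_operator_def compact_eq_totally_bounded by blast
    have "T ` ball 0 1 \<subseteq> (\<Union>x\<in>k. cball x (e/2))"
    proof safe
      fix u :: "'a L2" assume u: "u \<in> ball 0 1"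
      then have "S u \<in> closure (S ` ball 0 1)"
        by (intro subsetD[OF closure_subset]) auto
      then obtain x where x: "x \<in> k" "dist x (S u) < e/4"
        using k by fastforce
      have "norm (T u - S u) \<le> e/4 * 1"
      proof (rule order_trans[OF S(2)])
        show "e/4 * norm u \<le> e/4 * 1"
          using u \<open>e > 0\<close> by (intro mult_left_mono) (auto intro: less_imp_le)
      qed
      then have "dist x (T u) \<le> e/2"
        using dist_triangle[of x "T u" "S u"] x(2) by (simp add: dist_norm norm_minus_commute)
      then show "T u \<in> (\<Union>x\<in>k. cball x (e/2))"
        using x(1) by auto
    qed
    moreover have "closed (\<Union>x\<in>k. cball x (e/2))"
      using k(1) by (intro closed_UN) auto
    ultimately have "closure (T ` ball 0 1) \<subseteq> (\<Union>x\<in>k. cball x (e/2))"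
      by (rule closure_minimal)
    also have "\<dots> \<subseteq> (\<Union>x\<in>k. ball x e)"
      using \<open>e > 0\<close> by force
    finally show "\<exists>k. finite k \<and> closure (T ` ball 0 1) \<subseteq> (\<Union>x\<in>k. ball x e)"
      using k(1) by blast
  qed
qed

text \<open>In place of summing the Neumann series, Banach's fixed point theorem for the map taking
  u to f - P u solves u + P u = f. The lower bound (1 - q) |u| gives injectivity and the norm of the
  inverse.\<close>

lemma bij_add_contraction:
  fixes P :: "'n::finite L2 \<Rightarrow> 'n L2"
  assumes P: "bounded_linear P" and q: "0 \<le> q" "q < 1" and le: "\<And>u. norm (P u) \<le> q * norm u"
  shows "bij (\<lambda>u. u + P u)" and "bounded_linear (inv (\<lambda>u. u + P u))"
proof -
  interpret P: bounded_linear P by (rule P)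
  let ?G = "\<lambda>u. u + P u"
  have below: "(1 - q) * norm u \<le> norm (?G u)" for u
  proof -
    have "norm u \<le> norm (?G u) + norm (P u)"
      using norm_triangle_ineq4[of "?G u" "P u"] by simp
    then show ?thesis
      using le[of u] by (simp add: algebra_simps)
  qed
  have "\<exists>u. ?G u = f" for f
  proof -
    have "\<exists>!u. f - P u = u"
    proof (rule banach_fix_type[OF q], intro allI)
      fix u v
      show "dist (f - P u) (f - P v) \<le> q * dist u v"
        using le[of "v - u"] by (simp add: dist_norm P.diff norm_minus_commute)
    qed
    then show ?thesis by (metis diff_add_cancel)
  qed
  then have "surj ?G" by (metis surj_def)
  moreover have inj: "inj ?G"
  proof (rule injI)
    fix u v assume "?G u = ?G v"
    moreover have "?G (u - v) = ?G u - ?G v" by (simp add: P.diff)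
    ultimately have "?G (u - v) = 0" by simp
    then show "u = v" using below[of "u - v"] q by (simp add: mult_le_0_iff)
  qed
  ultimately show bij: "bij ?G" by (simp add: bij_def)
  have r: "?G (inv ?G f) = f" for f
    by (rule surj_f_inv_f[OF bij_is_surj[OF bij], of f])
  have l: "inv ?G (?G u) = u" for u
    by (rule inv_f_f[OF inj])
  show "bounded_linear (inv ?G)"
  proof (rule bounded_linear_intro)
    fix f g :: "'n L2" and c :: real
    have "inv ?G (?G (inv ?G f + inv ?G g)) = inv ?G f + inv ?G g" by (rule l)
    moreover have "?G (inv ?G f + inv ?G g) = f + g"
      using r[of f] r[of g] by (simp add: P.add algebra_simps)
    ultimately show "inv ?G (f + g) = inv ?G f + inv ?G g" by simp
    have "inv ?G (?G (c *\<^sub>R inv ?G f)) = c *\<^sub>R inv ?G f" by (rule l)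
    moreover have "?G (c *\<^sub>R inv ?G f) = c *\<^sub>R f"
      using arg_cong[OF r[of f], of "\<lambda>u. c *\<^sub>R u"] by (simp add: P.scaleR algebra_simps)
    ultimately show "inv ?G (c *\<^sub>R f) = c *\<^sub>R inv ?G f" by simp
    show "norm (inv ?G f) \<le> norm f * (1 / (1 - q))"
      using below[of "inv ?G f"] q by (simp add: r field_simps)
  qed
qed

section \<open>Compact operators symmetric for an equivalent inner product\<close>

text \<open>Boundedness and coercivity of \<open>M\<close> make the norm of the form
  \<open>b\<close> below equivalent to the original one, so compactness, closures and limits can be
  taken in either.\<close>

locale equivalent_form =
  fixes M :: "'n::finite L2 \<Rightarrow> 'n L2" and m :: real
  assumes M_bounded: "bounded_linear M"
    and M_scaleC: "M (c *\<^sub>C u) = c *\<^sub>C M u"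
    and M_sym: "cinner (M u) v = cinner u (M v)"
    and m_pos: "m > 0"
    and M_coercive: "m * (norm u)\<^sup>2 \<le> Re (cinner (M u) u)"
begin

sublocale M: bounded_linear M by (rule M_bounded)

definition b :: "'n L2 \<Rightarrow> 'n L2 \<Rightarrow> complex" where
  "b u v = cinner (M u) v"

definition sq :: "'n L2 \<Rightarrow> real" where
  "sq u = Re (b u u)"

sublocale b: bounded_bilinear b
  unfolding b_def using cinner.comp1[OF M_bounded] by simp

lemma b_scaleC_left [simp]: "b (c *\<^sub>C u) v = c * b u v"
  by (simp add: b_def M_scaleC)

lemma b_scaleC_right [simp]: "b u (c *\<^sub>C v) = cnj c * b u v"
  by (simp add: b_def)

lemma b_commute: "b u v = cnj (b v u)"
  unfolding b_def by (subst cinner_commute) (simp add: M_sym)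

lemma b_self: "b u u = of_real (sq u)"
  unfolding sq_def using b_commute[of u u] by (metis Reals_cnj_iff of_real_Re)

lemma sq_ge: "m * (norm u)\<^sup>2 \<le> sq u"
  using M_coercive[of u] by (simp add: sq_def b_def)

lemma sq_nonneg [simp]: "0 \<le> sq u"
  using order_trans[OF _ sq_ge[of u]] m_pos by simp

lemma sq_eq_0 [simp]: "sq u = 0 \<longleftrightarrow> u = 0"
  using sq_ge[of u] m_pos by (auto simp: sq_def b.zero_left mult_le_0_iff)

lemma sq_pos: "u \<noteq> 0 \<Longrightarrow> 0 < sq u"
  using sq_nonneg[of u] sq_eq_0[of u] by linarith

lemma sq_scaleC: "sq (c *\<^sub>C u) = (norm c)\<^sup>2 * sq u"
proof -
  have "b (c *\<^sub>C u) (c *\<^sub>C u) = (c * cnj c) * b u u" by simp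
  also have "\<dots> = of_real ((norm c)\<^sup>2 * sq u)"
    by (simp only: b_self complex_norm_square[symmetric] of_real_mult)
  finally show ?thesis by (simp add: sq_def)
qed

lemma sq_scaleR: "sq (r *\<^sub>R u) = r\<^sup>2 * sq u"
  by (simp add: scaleR_scaleC sq_scaleC)

lemma norm_le_sq: "norm u \<le> sqrt (sq u / m)"
  using sq_ge[of u] m_pos by (intro real_le_rsqrt) (simp add: field_simps)

lemma tendsto_sq: "(f \<longlongrightarrow> l) F \<Longrightarrow> ((\<lambda>x. sq (f x)) \<longlongrightarrow> sq l) F"
  unfolding sq_def by (intro tendsto_intros b.tendsto)

lemma sq_tendsto_0: "(\<lambda>n. sq (f n)) \<longlonglongrightarrow> 0 \<Longrightarrow> f \<longlonglongrightarrow> 0"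
proof -
  assume "(\<lambda>n. sq (f n)) \<longlonglongrightarrow> 0"
  then have "(\<lambda>n. sqrt (sq (f n) / m)) \<longlonglongrightarrow> sqrt (0 / m)"
    using m_pos by (intro tendsto_intros) auto
  then have "(\<lambda>n. sqrt (sq (f n) / m)) \<longlonglongrightarrow> 0" by simp
  then show ?thesis
    by (rule Lim_null_comparison[rotated]) (simp add: norm_le_sq)
qed

text \<open>Lax-Milgram: for a suitable step t the map 1 - t M is a strict contraction, so t M is a
  small perturbation of the identity. Surjectivity is what later makes the image of a dense span
  under \<open>M\<close> dense.\<close>

lemma M_surj: "surj M"
proof -
  obtain K where K: "K \<ge> 0" "\<And>u. norm (M u) \<le> norm u * K"
    using M.nonneg_bounded by blast
  define L where "L = K\<^sup>2 + m\<^sup>2 + 1"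
  \<comment> \<open>This t minimizes 1 - 2 t m + \<open>t\<^sup>2\<close> L. The minimum 1 -
    \<open>m\<^sup>2\<close> / L is the square of the contraction factor, and including
    \<open>m\<^sup>2\<close> in \<open>L\<close> keeps it nonnegative.\<close>
  define t where "t = m / L"
  have L: "L > 0" unfolding L_def by (simp add: add_nonneg_pos)
  have t: "t > 0" using m_pos L by (simp add: t_def)
  define q where "q = sqrt (1 - m\<^sup>2 / L)"
  have q: "0 \<le> q" "q < 1" "q\<^sup>2 = 1 - m\<^sup>2 / L"
    using m_pos L by (auto simp: q_def L_def field_simps)
  have le: "norm (- (u - t *\<^sub>R M u)) \<le> q * norm u" for u
  proof (rule power2_le_imp_le)
    have "(norm (- (u - t *\<^sub>R M u)))\<^sup>2 = (norm u)\<^sup>2 - 2 * t * inner (M u) u + t\<^sup>2 * (norm (M u))\<^sup>2"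
      unfolding norm_minus_cancel power2_norm_eq_inner inner_diff_left inner_diff_right inner_scaleR_left inner_scaleR_right
      by (simp add: inner_commute[of u "M u"] power2_eq_square algebra_simps)
    also have "\<dots> \<le> (norm u)\<^sup>2 - 2 * t * (m * (norm u)\<^sup>2) + t\<^sup>2 * (norm u * K)\<^sup>2"
      using M_coercive[of u] t K(2)[of u] K(1)
      by (intro add_mono diff_mono mult_left_mono power_mono) (auto simp: inner_L2_def)
    also have "\<dots> = (1 - 2 * t * m + t\<^sup>2 * K\<^sup>2) * (norm u)\<^sup>2"
      by (simp add: algebra_simps power_mult_distrib)
    also have "\<dots> \<le> (1 - m\<^sup>2 / L) * (norm u)\<^sup>2"
    proof (rule mult_right_mono)
      have "t\<^sup>2 * K\<^sup>2 \<le> t\<^sup>2 * L" by (intro mult_left_mono) (auto simp: L_def)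
      also have "\<dots> = m\<^sup>2 / L" using L by (simp add: t_def power2_eq_square)
      finally have "t\<^sup>2 * K\<^sup>2 \<le> m\<^sup>2 / L" .
      moreover have "2 * t * m = 2 * (m\<^sup>2 / L)" by (simp add: t_def power2_eq_square)
      ultimately show "1 - 2 * t * m + t\<^sup>2 * K\<^sup>2 \<le> 1 - m\<^sup>2 / L" by linarith
    qed auto
    finally show "(norm (- (u - t *\<^sub>R M u)))\<^sup>2 \<le> (q * norm u)\<^sup>2"
      by (simp add: power_mult_distrib q)
  qed (use q in auto)
  have "bounded_linear (\<lambda>u. - (u - t *\<^sub>R M u))"
    by (intro bounded_linear_minus bounded_linear_sub bounded_linear_ident bounded_linear_compose[OF bounded_linear_scaleR_right] M_bounded)
  from bij_add_contraction(1)[OF this q(1,2) le] have "surj (\<lambda>u. t *\<^sub>R M u)"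
    by (simp add: bij_def)
  then have "\<exists>u. f = M (t *\<^sub>R u)" for f
    unfolding surj_def by (simp add: M.scaleR)
  then show ?thesis unfolding surj_def by blast
qed

end

section \<open>Eigenvectors of a compact positive operator by successive maximization of its
  quadratic form\<close>

locale positive_compact = equivalent_form +
  fixes T :: "'a L2 \<Rightarrow> 'a L2"
  assumes T_compact: "compact_operator T"
    and T_scaleC: "T (c *\<^sub>C u) = c *\<^sub>C T u"
    and T_sym: "b (T u) v = b u (T v)"
    and T_pos: "u \<noteq> 0 \<Longrightarrow> 0 < Re (b (T u) u)"
begin

sublocale T: bounded_linear T by (rule compact_operator_linear[OF T_compact])

definition q :: "'a L2 \<Rightarrow> real" where
  "q u = Re (b (T u) u)"

lemma q_nonneg: "0 \<le> q u"
  using T_pos[of u] by (cases "u = 0") (auto simp: q_def b.zero_right)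

text \<open>Expand \<open>0 \<le> q (T u / s - u)\<close>.\<close>

lemma sq_T_le:
  assumes "s > 0" and max: "q (T u) \<le> s * sq (T u)"
  shows "sq (T u) \<le> s * q u"
proof -
  have "0 \<le> q ((1/s) *\<^sub>R T u - u)" by (rule q_nonneg)
  also have "\<dots> = (1/s)\<^sup>2 * q (T u) - (1/s) * (Re (b (T (T u)) u) + Re (b (T u) (T u))) + q u"
    unfolding q_def by (simp add: T.diff T.scaleR b.diff_left b.diff_right b.scaleR_left b.scaleR_right
      power2_eq_square algebra_simps)
  also have "Re (b (T (T u)) u) = sq (T u)" by (simp add: T_sym sq_def)
  also have "Re (b (T u) (T u)) = sq (T u)" by (simp add: sq_def)
  also have "(1/s)\<^sup>2 * q (T u) \<le> (1/s)\<^sup>2 * (s * sq (T u))"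
    by (intro mult_left_mono max) auto
  finally have "0 \<le> - sq (T u) / s + q u"
    using assms(1) by (simp add: power2_eq_square field_simps)
  then show ?thesis using assms(1) by (simp add: field_simps)
qed

text \<open>The form \<open>q\<close> is maximized over the unit sphere of an invariant subspace. By
  \<open>sq_T_le\<close>, unit vectors satisfy sq (T u - s u) \<le> s (s - q u), so a maximizing
  sequence consists of approximate eigenvectors and compactness extracts a limit. A general
  \<open>N\<close> allows repetition on orthogonal complements.\<close>

lemma max_eigenvector:
  assumes N: "closed N" "cvec.subspace N" "\<And>u. u \<in> N \<Longrightarrow> T u \<in> N" and u0: "u0 \<in> N" "u0 \<noteq> 0"
  obtains s f where "s > 0" "f \<in> N" "sq f = 1" "T f = s *\<^sub>R f" "\<And>u. u \<in> N \<Longrightarrow> q u \<le> s * sq u"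
proof -
  define S where "S = q ` {u \<in> N. sq u = 1}"
  have Nr: "r *\<^sub>R u \<in> N" if "u \<in> N" for r u
    using N(2) that by (simp add: scaleR_scaleC cvec.subspace_scale)
  have normalize: "(1 / sqrt (sq u)) *\<^sub>R u \<in> {u \<in> N. sq u = 1}" if "u \<in> N" "u \<noteq> 0" for u
    using that Nr sq_pos[of u] by (simp add: sq_scaleR power_divide)
  have q_scaleR: "q (r *\<^sub>R u) = r\<^sup>2 * q u" for r u
    by (simp add: q_def T.scaleR b.scaleR_left b.scaleR_right power2_eq_square)
  obtain K where K: "K \<ge> 0" "\<And>u. norm (T u) \<le> norm u * K"
    using T.nonneg_bounded by blast
  obtain K' where K': "K' \<ge> 0" "\<And>u v. norm (b u v) \<le> norm u * norm v * K'"
    using b.nonneg_bounded by blast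
  have bdd: "bdd_above S"
    unfolding S_def
  proof (rule bdd_aboveI2)
    fix u assume "u \<in> {u \<in> N. sq u = 1}"
    then have u: "(norm u)\<^sup>2 \<le> 1 / m"
      using sq_ge[of u] m_pos by (simp add: field_simps)
    have "q u \<le> norm (b (T u) u)" by (simp add: q_def complex_Re_le_cmod)
    also have "\<dots> \<le> norm (T u) * norm u * K'" by (rule K')
    also have "\<dots> \<le> (norm u * K) * norm u * K'" by (intro mult_right_mono K K') auto
    also have "\<dots> = (norm u)\<^sup>2 * (K * K')" by (simp add: power2_eq_square)
    also have "\<dots> \<le> 1 / m * (K * K')" using u K(1) K'(1) by (intro mult_right_mono) auto
    finally show "q u \<le> 1 / m * (K * K')" .
  qed
  have ne: "S \<noteq> {}" using normalize[OF u0] by (auto simp: S_def)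
  define s where "s = Sup S"
  have le1: "q u \<le> s" if "u \<in> N" "sq u = 1" for u
    unfolding s_def using bdd that by (intro cSup_upper) (auto simp: S_def)
  have max: "q u \<le> s * sq u" if "u \<in> N" for u
  proof (cases "u = 0")
    case True then show ?thesis by (simp add: q_def b.zero_right sq_def)
  next
    case False
    have "q ((1 / sqrt (sq u)) *\<^sub>R u) \<le> s"
      using normalize[OF that False] le1 by blast
    then show ?thesis
      using sq_pos[OF False] by (simp add: q_scaleR power_divide field_simps)
  qed
  have "0 < q u0" using T_pos[OF u0(2)] by (simp add: q_def)
  also have "\<dots> \<le> s * sq u0" by (rule max[OF u0(1)])
  finally have s: "s > 0" using sq_nonneg[of u0] by (simp add: zero_less_mult_iff)
  have "\<exists>u. u \<in> N \<and> sq u = 1 \<and> s - inverse (real (Suc n)) < q u" for n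
  proof -
    have "s - inverse (real (Suc n)) < Sup S" by (simp add: s_def)
    then obtain y where "y \<in> S" "s - inverse (real (Suc n)) < y"
      using less_cSup_iff[OF ne bdd] by blast
    then show ?thesis by (auto simp: S_def)
  qed
  then obtain u where u: "\<And>n. u n \<in> N" "\<And>n. sq (u n) = 1" "\<And>n. s - inverse (real (Suc n)) < q (u n)"
    by metis
  have "norm (u n) \<le> sqrt (1 / m)" for n
    using norm_le_sq[of "u n"] u(2)[of n] by simp
  then obtain w r where r: "strict_mono (r :: nat \<Rightarrow> nat)" "(\<lambda>n. T (u (r n))) \<longlonglongrightarrow> w"
    using compact_operator_subseq[OF T_compact, of u "sqrt (1 / m)"] by blast
  have "sq (T (u n) - s *\<^sub>R u n) \<le> s * inverse (real (Suc n))" for n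
  proof -
    have "sq (T (u n) - s *\<^sub>R u n) = sq (T (u n)) - s * (Re (b (T (u n)) (u n)) + Re (b (u n) (T (u n)))) + s\<^sup>2 * sq (u n)"
      by (simp add: sq_def b.diff_left b.diff_right b.scaleR_left b.scaleR_right power2_eq_square algebra_simps)
    also have "b (u n) (T (u n)) = b (T (u n)) (u n)" by (simp add: T_sym)
    also have "sq (T (u n)) \<le> s * q (u n)"
      by (intro sq_T_le s max N u)
    finally have "sq (T (u n) - s *\<^sub>R u n) \<le> s * q (u n) - s * (q (u n) + q (u n)) + s\<^sup>2"
      using u(2) by (simp add: q_def)
    also have "\<dots> = s * (s - q (u n))" by (simp add: algebra_simps power2_eq_square)
    also have "\<dots> \<le> s * inverse (real (Suc n))"
      using s u(3)[of n] by (intro mult_left_mono) auto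
    finally show ?thesis .
  qed
  moreover have "(\<lambda>n. s * inverse (real (Suc n))) \<longlonglongrightarrow> s * 0"
    by (intro tendsto_intros LIMSEQ_inverse_real_of_nat)
  ultimately have "(\<lambda>n. sq (T (u n) - s *\<^sub>R u n)) \<longlonglongrightarrow> 0"
    by - (rule Lim_null_comparison[of _ "\<lambda>n. s * inverse (real (Suc n))"], simp_all del: of_nat_Suc)
  then have "(\<lambda>n. T (u n) - s *\<^sub>R u n) \<longlonglongrightarrow> 0"
    by (rule sq_tendsto_0)
  then have "(\<lambda>n. T (u (r n)) - s *\<^sub>R u (r n)) \<longlonglongrightarrow> 0"
    using LIMSEQ_subseq_LIMSEQ[OF _ r(1)] by (fastforce simp: o_def)
  \<comment> \<open>Compactness only makes \<open>T u\<close> converge; since T u - s u tends to 0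
    and s > 0, the vectors \<open>u\<close> themselves converge along the subsequence.\<close>
  from tendsto_diff[OF r(2) this] have su: "(\<lambda>n. s *\<^sub>R u (r n)) \<longlonglongrightarrow> w"
    by simp
  define f where "f = (1/s) *\<^sub>R w"
  have lim: "(\<lambda>n. u (r n)) \<longlonglongrightarrow> f"
    using tendsto_scaleR[OF tendsto_const[of "1/s"] su] s by (simp add: f_def)
  show thesis
  proof
    show "s > 0" by (rule s)
    show "f \<in> N" using closed_sequentially[OF N(1) u(1) lim] .
    have "(\<lambda>n. sq (u (r n))) \<longlonglongrightarrow> sq f" by (rule tendsto_sq[OF lim])
    then show "sq f = 1" by (simp add: u(2) LIMSEQ_const_iff)
    have "(\<lambda>n. T (u (r n))) \<longlonglongrightarrow> T f" by (rule T.tendsto[OF lim])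
    then have "T f = w" using r(2) LIMSEQ_unique by blast
    then show "T f = s *\<^sub>R f" using s by (simp add: f_def)
  qed (rule max)
qed

text \<open>Only the first \<open>n\<close> members of \<open>f\<close> enter, so in a recursion the
  set is determined by the vectors already chosen; for n = 0 it is the whole space.\<close>

definition ortho :: "nat \<Rightarrow> (nat \<Rightarrow> 'a L2) \<Rightarrow> 'a L2 set" where
  "ortho n f = {u. \<forall>k<n. b u (f k) = 0}"

lemma closed_ortho: "closed (ortho n f)"
proof -
  have "ortho n f = (\<Inter>k<n. {u. b u (f k) = 0})"
    by (auto simp: ortho_def)
  moreover have "closed {u. b u (f k) = 0}" for k
    by (intro closed_Collect_eq continuous_intros b.continuous_on)
  ultimately show ?thesis by (auto intro: closed_INT)
qed

lemma subspace_ortho: "cvec.subspace (ortho n f)"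
  by (auto simp: cvec.subspace_def ortho_def b.zero_left b.add_left)

text \<open>Each eigenvector is chosen in the complement of its predecessors. Maximality of
  \<open>s n\<close> over that whole complement is recorded as well: it yields the monotonicity of
  the eigenvalues and the tail estimate in \<open>eigenbasis\<close>.\<close>

lemma eigensequence:
  assumes inf_dim: "\<And>B. finite B \<Longrightarrow> cvec.span B \<noteq> (UNIV :: 'a L2 set)"
  obtains s :: "nat \<Rightarrow> real" and f :: "nat \<Rightarrow> 'a L2"
  where "\<And>n. s n > 0" "\<And>n. T (f n) = s n *\<^sub>R f n" "\<And>n. sq (f n) = 1"
    "\<And>n. f n \<in> ortho n f" "\<And>n u. u \<in> ortho n f \<Longrightarrow> q u \<le> s n * sq u"
proof -
  \<comment> \<open>Course-of-values choice: the n-th pair depends on all earlier ones, and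
    \<open>P\<close> inspects \<open>g\<close> only below n, as the choice rule demands.\<close>
  define P where "P g n r \<longleftrightarrow> fst r > 0 \<and> T (snd r) = fst r *\<^sub>R snd r \<and> sq (snd r) = 1 \<and>
     snd r \<in> ortho n (\<lambda>k. snd (g k)) \<and> (\<forall>u \<in> ortho n (\<lambda>k. snd (g k)). q u \<le> fst r * sq u)"
    for g :: "nat \<Rightarrow> real \<times> 'a L2" and n r
  have "\<exists>g. \<forall>n. P g n (g n)"
  proof (rule dependent_wf_choice[OF wf_less])
    fix f g :: "nat \<Rightarrow> real \<times> 'a L2" and n r
    assume "\<And>z. (z, n) \<in> {(x, y). x < y} \<Longrightarrow> f z = g z"
    then have "ortho n (\<lambda>k. snd (f k)) = ortho n (\<lambda>k. snd (g k))"
      by (auto simp: ortho_def)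
    then show "P f n r = P g n r" by (simp add: P_def)
  next
    fix n and g :: "nat \<Rightarrow> real \<times> 'a L2"
    assume IH: "\<And>y. (y, n) \<in> {(x, y). x < y} \<Longrightarrow> P g y (g y)"
    define f where "f k = snd (g k)" for k
    have eig: "T (f k) = fst (g k) *\<^sub>R f k" "sq (f k) = 1" "f k \<in> ortho k f" if "k < n" for k
      using IH[of k] that by (auto simp: P_def f_def[symmetric])
    have TN: "T u \<in> ortho n f" if "u \<in> ortho n f" for u
      using that eig(1) by (auto simp: ortho_def T_sym b.scaleR_right)
    have bf: "b (f j) (f k) = (if j = k then 1 else 0)" if "j < n" "k < n" for j k
    proof (cases j k rule: linorder_cases)
      case less
      then show ?thesis using eig(3)[OF \<open>k < n\<close>] b_commute[of "f j" "f k"] by (auto simp: ortho_def)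
    next
      case greater
      then show ?thesis using eig(3)[OF \<open>j < n\<close>] by (auto simp: ortho_def)
    qed (use eig(2) that in \<open>auto simp: b_self\<close>)
    \<comment> \<open>If the complement were trivial, the n vectors found so far would span
      everything, because subtracting the projection onto them leaves an element of the
      complement.\<close>
    have "\<exists>u \<in> ortho n f. u \<noteq> 0"
    proof (rule ccontr)
      assume "\<not> ?thesis"
      then have triv: "u = 0" if "u \<in> ortho n f" for u using that by blast
      have "u \<in> cvec.span (f ` {..<n})" for u
      proof -
        have "b (\<Sum>k<n. b u (f k) *\<^sub>C f k) (f j) = b u (f j)" if "j < n" for j
          using that by (simp add: b.sum_left bf if_distrib cong: if_cong)
        then have "u - (\<Sum>k<n. b u (f k) *\<^sub>C f k) \<in> ortho n f"
          by (auto simp: ortho_def b.diff_left)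
        then have "u = (\<Sum>k<n. b u (f k) *\<^sub>C f k)"
          using triv by fastforce
        also have "\<dots> \<in> cvec.span (f ` {..<n})"
          by (intro cvec.span_sum cvec.span_scale cvec.span_base) auto
        finally show ?thesis .
      qed
      then show False using inf_dim[of "f ` {..<n}"] by auto
    qed
    then obtain u0 where u0: "u0 \<in> ortho n f" "u0 \<noteq> 0" by blast
    obtain s h where "s > 0" "h \<in> ortho n f" "sq h = 1" "T h = s *\<^sub>R h"
      "\<And>u. u \<in> ortho n f \<Longrightarrow> q u \<le> s * sq u"
      using max_eigenvector[OF closed_ortho subspace_ortho TN u0] by metis
    then have "P g n (s, h)"
      by (simp add: P_def f_def[symmetric])
    then show "\<exists>r. P g n r" by blast
  qed
  then obtain g where g: "\<And>n. P g n (g n)" by blast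
  show thesis
    by (rule that[of "\<lambda>n. fst (g n)" "\<lambda>n. snd (g n)"]) (use g in \<open>auto simp: P_def\<close>)
qed

text \<open>The eigenvectors are shown to approximate the range of \<open>T\<close> rather than
  arbitrary vectors: on the complement of the first n of them T has size at most s n, so T w - T (p
  n w) tends to 0. Density of the range then gives density of the span.\<close>

theorem eigenbasis:
  assumes inf_dim: "\<And>B. finite B \<Longrightarrow> cvec.span B \<noteq> (UNIV :: 'a L2 set)"
    and dense: "closure (range T) = UNIV"
  obtains s :: "nat \<Rightarrow> real" and f :: "nat \<Rightarrow> 'a L2"
  where "\<And>n. s n > 0" "\<And>n. T (f n) = s n *\<^sub>R f n"
    "\<And>i j. b (f i) (f j) = (if i = j then 1 else 0)"
    "s \<longlonglongrightarrow> 0" "closure (cvec.span (range f)) = UNIV"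
proof -
  obtain s :: "nat \<Rightarrow> real" and f :: "nat \<Rightarrow> 'a L2"
    where s: "\<And>n. s n > 0" and Tf: "\<And>n. T (f n) = s n *\<^sub>R f n" and sqf: "\<And>n. sq (f n) = 1"
    and fo: "\<And>n. f n \<in> ortho n f" and max: "\<And>n u. u \<in> ortho n f \<Longrightarrow> q u \<le> s n * sq u"
    using eigensequence[OF inf_dim] by metis
  have bf: "b (f i) (f j) = (if i = j then 1 else 0)" for i j
  proof (cases i j rule: linorder_cases)
    case less
    then show ?thesis using fo[of j] b_commute[of "f i" "f j"] by (auto simp: ortho_def)
  next
    case greater
    then show ?thesis using fo[of i] by (auto simp: ortho_def)
  qed (use sqf in \<open>auto simp: b_self\<close>)
  have dec: "s n \<le> s k" if "k \<le> n" for k n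
  proof -
    have "f n \<in> ortho k f" using fo[of n] that by (auto simp: ortho_def)
    then have "q (f n) \<le> s k" using max[of "f n" k] sqf by simp
    then show ?thesis by (simp add: q_def Tf b.scaleR_left b_self sqf)
  qed
  \<comment> \<open>A decreasing positive sequence that does not tend to 0 stays above some e > 0.
    The vectors T (f n) are then pairwise orthogonal with \<open>sq\<close> at least
    \<open>e\<^sup>2\<close>, so no subsequence is Cauchy, against compactness.\<close>
  have s0: "s \<longlonglongrightarrow> 0"
  proof (rule ccontr)
    assume nlim: "\<not> s \<longlonglongrightarrow> 0"
    have "\<exists>e>0. \<forall>n. e \<le> s n"
    proof (rule ccontr)
      assume "\<not> ?thesis"
      then have ex: "\<exists>n. s n < e" if "e > 0" for e using that by (meson not_le)
      have "s \<longlonglongrightarrow> 0"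
      proof (rule LIMSEQ_I)
        fix e :: real assume "e > 0"
        then obtain N where "s N < e" using ex by blast
        then show "\<exists>no. \<forall>n\<ge>no. norm (s n - 0) < e"
          using dec s by (intro exI[of _ N]) (auto simp: abs_of_pos intro: le_less_trans)
      qed
      with nlim show False by blast
    qed
    then obtain e where e: "e > 0" "\<And>n. e \<le> s n" by blast
    have "norm (f n) \<le> sqrt (1 / m)" for n
      using norm_le_sq[of "f n"] by (simp add: sqf)
    then obtain l r where r: "strict_mono (r :: nat \<Rightarrow> nat)" "(\<lambda>n. T (f (r n))) \<longlonglongrightarrow> l"
      using compact_operator_subseq[OF T_compact, of f "sqrt (1 / m)"] by blast
    have "(\<lambda>n. T (f (r (Suc n))) - T (f (r n))) \<longlonglongrightarrow> l - l"
      by (intro tendsto_diff r(2) LIMSEQ_Suc)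
    from tendsto_sq[OF this] have "(\<lambda>n. sq (T (f (r (Suc n))) - T (f (r n)))) \<longlonglongrightarrow> 0"
      by (simp add: sq_def b.zero_right)
    moreover have "e\<^sup>2 \<le> sq (T (f (r (Suc n))) - T (f (r n)))" for n
    proof -
      have "r (Suc n) \<noteq> r n" using r(1) by (simp add: strict_mono_eq)
      then have "sq (T (f (r (Suc n))) - T (f (r n))) = (s (r (Suc n)))\<^sup>2 + (s (r n))\<^sup>2"
        by (simp add: Tf sq_def b.diff_left b.diff_right b.scaleR_left b.scaleR_right bf power2_eq_square)
      moreover have "e\<^sup>2 \<le> (s (r n))\<^sup>2" using e by (intro power_mono) (auto intro: less_imp_le)
      ultimately show ?thesis by (simp add: add_increasing)
    qed
    ultimately have "e\<^sup>2 \<le> 0" by (intro LIMSEQ_le_const) auto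
    with e(1) show False by simp
  qed
  define p where "p n w = (\<Sum>k<n. b w (f k) *\<^sub>C f k)" for n w
  have p_ortho: "w - p n w \<in> ortho n f" for n w
    by (auto simp: ortho_def p_def b.diff_left b.sum_left bf if_distrib cong: if_cong)
  have bp: "b (w - p n w) (p n v) = 0" for n w v
    using p_ortho[of w n] by (simp add: p_def b.sum_right ortho_def)
  have sq_rest: "sq (w - p n w) \<le> sq w" for n w
  proof -
    have "w = (w - p n w) + p n w" by simp
    then have "b w w = b ((w - p n w) + p n w) ((w - p n w) + p n w)" by simp
    also have "\<dots> = b (w - p n w) (w - p n w) + b (w - p n w) (p n w) + b (p n w) (w - p n w) + b (p n w) (p n w)"
      by (simp only: b.add_left b.add_right add_ac)
    also have "b (p n w) (w - p n w) = 0"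
      by (subst b_commute) (simp add: bp)
    finally have "sq w = sq (w - p n w) + sq (p n w)"
      by (simp add: bp sq_def)
    then show ?thesis by simp
  qed
  have TN: "T u \<in> ortho n f" if "u \<in> ortho n f" for u n
    using that by (auto simp: ortho_def T_sym Tf b.scaleR_right)
  have lim: "(\<lambda>n. T (p n w)) \<longlonglongrightarrow> T w" for w
  proof -
    \<comment> \<open>Maximality on the complement is used twice: \<open>sq_T_le\<close> supplies
      one factor s n and the bound on \<open>q\<close> the other.\<close>
    have "sq (T w - T (p n w)) \<le> (s n)\<^sup>2 * sq w" for n
    proof -
      have "sq (T (w - p n w)) \<le> s n * q (w - p n w)"
        by (intro sq_T_le s max TN p_ortho)
      also have "\<dots> \<le> s n * (s n * sq (w - p n w))"
        using s[of n] by (intro mult_left_mono max p_ortho) auto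
      also have "\<dots> \<le> s n * (s n * sq w)"
        using s[of n] by (intro mult_left_mono sq_rest) auto
      finally show ?thesis by (simp add: T.diff power2_eq_square mult.assoc)
    qed
    moreover have "(\<lambda>n. (s n)\<^sup>2 * sq w) \<longlonglongrightarrow> 0\<^sup>2 * sq w"
      by (intro tendsto_intros s0)
    ultimately have "(\<lambda>n. sq (T w - T (p n w))) \<longlonglongrightarrow> 0"
      by - (rule Lim_null_comparison[of _ "\<lambda>n. (s n)\<^sup>2 * sq w"], simp_all del: of_nat_Suc)
    then have "(\<lambda>n. T w - T (p n w)) \<longlonglongrightarrow> 0" by (rule sq_tendsto_0)
    from tendsto_diff[OF tendsto_const[of "T w"] this] show ?thesis by simp
  qed
  have "T (p n w) \<in> cvec.span (range f)" for n w
    unfolding p_def T.sum T_scaleC Tf scaleR_scaleC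
    by (intro cvec.span_sum cvec.span_scale cvec.span_base) auto
  then have "T w \<in> closure (cvec.span (range f))" for w
    using lim[of w] unfolding closure_sequential by (intro exI[of _ "\<lambda>n. T (p n w)"]) auto
  then have "closure (range T) \<subseteq> closure (cvec.span (range f))"
    by (intro closure_minimal) auto
  then have "closure (cvec.span (range f)) = UNIV"
    using dense by auto
  then show thesis
    using that[of s f] s Tf bf s0 by blast
qed

end

section \<open>Operators with a compact resolvent, symmetric for an equivalent inner product\<close>

lemma (in equivalent_form) b_eq_0_dense:
  assumes "closure (cvec.span (range f)) = UNIV" and "\<And>n. b w (f n) = 0"
  shows "w = 0"
proof -
  have "b w v = 0" if "v \<in> cvec.span (range f)" for v
    using that
  proof (induction rule: cvec.span_induct_alt)
    case base
    then show ?case by (simp add: b.zero_right)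
  next
    case (step c x y)
    then show ?case using assms(2) by (auto simp: b.add_right)
  qed
  then have "cvec.span (range f) \<subseteq> {v. b w v = 0}" by blast
  moreover have "closed {v. b w v = 0}"
    by (intro closed_Collect_eq continuous_intros b.continuous_on)
  ultimately have "closure (cvec.span (range f)) \<subseteq> {v. b w v = 0}"
    by (rule closure_minimal)
  then have "b w w = 0" using assms(1) by blast
  then show ?thesis by (simp add: b_self)
qed

text \<open>\<open>R\<close> is the inverse of A + c, stated as two one-sided identities because the
  values of \<open>A\<close> outside \<open>D\<close> carry no meaning. Symmetry and positivity are
  demanded of \<open>A\<close> for the form \<open>b\<close> and are then transferred to
  \<open>R\<close>.\<close>

locale symmetric_compact_resolvent = equivalent_form +
  fixes D :: "'a L2 set" and A R :: "'a L2 \<Rightarrow> 'a L2" and c :: real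
  assumes R_compact: "compact_operator R"
    and R_scaleC: "R (z *\<^sub>C u) = z *\<^sub>C R u"
    and R_dom: "R f \<in> D"
    and A_R: "A (R f) + c *\<^sub>R R f = f"
    and R_A: "u \<in> D \<Longrightarrow> R (A u + c *\<^sub>R u) = u"
    and dense: "closure D = UNIV"
    and inf_dim: "finite B \<Longrightarrow> cvec.span B \<noteq> (UNIV :: 'a L2 set)"
    and A_sym: "u \<in> D \<Longrightarrow> v \<in> D \<Longrightarrow> b (A u) v = b u (A v)"
    and A_pos: "u \<in> D \<Longrightarrow> u \<noteq> 0 \<Longrightarrow> 0 < Re (b (A u + c *\<^sub>R u) u)"
begin

sublocale R: bounded_linear R by (rule compact_operator_linear[OF R_compact])

lemma D_range: "D = range R"
proof
  show "D \<subseteq> range R" using R_A by (metis rangeI subsetI)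
  show "range R \<subseteq> D" using R_dom by blast
qed

lemma A_R': "A (R f) = f - c *\<^sub>R R f"
  using A_R[of f] by (simp add: algebra_simps)

lemma D_zero: "0 \<in> D"
  using R_dom[of 0] by (simp add: R.zero)

lemma A_zero: "A 0 = 0"
  using A_R'[of 0] by (simp add: R.zero)

lemma bij_shift: "bij_betw (\<lambda>u. A u - (- of_real c) *\<^sub>C u) D UNIV"
  by (rule bij_betwI[of _ _ _ R]) (auto simp: R_dom A_R R_A scaleR_scaleC[symmetric] cvec.scale_minus_left)

lemma resolvent_eqI:
  assumes "bij_betw (\<lambda>u. A u - z *\<^sub>C u) D UNIV" "u \<in> D" "A u - z *\<^sub>C u = f"
  shows "resolvent D A z f = u"
  using inv_into_f_f[OF bij_betw_imp_inj_on[OF assms(1)] assms(2)] assms(3)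
  by (simp add: resolvent_def)

lemma resolvent_set_shift: "- of_real c \<in> resolvent_set D A"
proof -
  have "resolvent D A (- of_real c) = R"
  proof
    fix f show "resolvent D A (- of_real c) f = R f"
      by (rule resolvent_eqI[OF bij_shift R_dom])
         (simp add: cvec.scale_minus_left scaleR_scaleC[symmetric] A_R)
  qed
  then show ?thesis
    using bij_shift R.bounded_linear_axioms by (simp add: resolvent_set_def)
qed

text \<open>By the resolvent identity every resolvent \<open>Z\<close> equals R (1 + (z + c) Z),
  that is, the compact \<open>R\<close> after a bounded operator.\<close>

theorem compact_resolvent: "has_compact_resolvent D A"
  unfolding has_compact_resolvent_def
proof (intro conjI ballI)
  show "resolvent_set D A \<noteq> {}" using resolvent_set_shift by blast
  fix z assume z: "z \<in> resolvent_set D A"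
  define Z where "Z = resolvent D A z"
  have bij: "bij_betw (\<lambda>u. A u - z *\<^sub>C u) D UNIV" and Zb: "bounded_linear Z"
    using z by (auto simp: resolvent_set_def Z_def)
  have Z: "Z f \<in> D" "A (Z f) - z *\<^sub>C Z f = f" for f
    using bij_betw_imp_surj_on[OF bij]
    unfolding Z_def resolvent_def by (auto intro!: inv_into_into f_inv_into_f[of f "\<lambda>u. A u - z *\<^sub>C u" D])
  have Z_eq: "Z = (\<lambda>f. R (f + (z + of_real c) *\<^sub>C Z f))"
  proof
    fix f
    have "f + (z + of_real c) *\<^sub>C Z f = A (Z f) + c *\<^sub>R Z f"
      using Z(2)[of f] by (simp add: cvec.scale_left_distrib scaleR_scaleC algebra_simps)
    then show "Z f = R (f + (z + of_real c) *\<^sub>C Z f)"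
      using R_A[OF Z(1)] by simp
  qed
  have "compact_operator (\<lambda>f. R (f + (z + of_real c) *\<^sub>C Z f))"
    by (intro compact_operator_compose_right[OF R_compact] bounded_linear_add bounded_linear_ident
          bounded_linear_compose[OF scaleC.bounded_linear_right] Zb)
  from ssubst[where P = compact_operator, OF Z_eq this] have "compact_operator Z" .
  then show "compact_operator (resolvent D A z)"
    by (simp only: Z_def)
qed

lemma R_sym: "b (R f) g = b f (R g)"
proof -
  have "b (R f) g = b (R f) (A (R g) + c *\<^sub>R R g)" by (simp add: A_R)
  also have "\<dots> = b (A (R f) + c *\<^sub>R R f) (R g)"
    by (simp only: b.add_left b.add_right b.scaleR_left b.scaleR_right A_sym[OF R_dom R_dom])
  finally show ?thesis by (simp add: A_R)
qed

lemma R_pos: "0 < Re (b (R f) f)" if "f \<noteq> 0"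
proof -
  have "R f \<noteq> 0" using A_R[of f] that by (auto simp: A_zero)
  then show ?thesis using A_pos[OF R_dom, of f] by (simp add: A_R R_sym)
qed

sublocale positive_compact M m R
  by unfold_locales (fact R_compact R_scaleC R_sym R_pos)+

lemma eigenvalue_in_spectrum:
  assumes "u \<in> D" "u \<noteq> 0" "A u = z *\<^sub>C u"
  shows "z \<in> spectrum D A"
proof (rule ccontr)
  assume "z \<notin> spectrum D A"
  then have "inj_on (\<lambda>u. A u - z *\<^sub>C u) D"
    by (auto simp: spectrum_def resolvent_set_def bij_betw_def)
  then have "u = 0"
    by (rule inj_onD) (auto simp: assms D_zero A_zero)
  with assms show False by simp
qed

text \<open>Fredholm alternative for \<open>1 - \<zeta> R\<close>: bounded below by compactness, onto because the range is
  closed and contains the eigenvectors of \<open>R\<close>.\<close>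

lemma resolvent_setI:
  assumes s: "\<And>n. s n > 0" and Rf: "\<And>n. R (f n) = s n *\<^sub>R f n"
    and span: "closure (cvec.span (range f)) = UNIV"
    and z: "\<And>n. z \<noteq> of_real (1 / s n - c)"
  shows "z \<in> resolvent_set D A"
proof -
  define \<zeta> where "\<zeta> = z + of_real c"
  have \<zeta>: "\<zeta> * of_real (s n) \<noteq> 1" for n
  proof
    assume "\<zeta> * of_real (s n) = 1"
    then have "\<zeta> = of_real (1 / s n)" using s[of n] by (simp add: field_simps)
    then show False using z[of n] by (simp add: \<zeta>_def algebra_simps)
  qed
  \<comment> \<open>Since A R = 1 - c R, the composite (A - z) R equals G. Inverting A - z on
    \<open>D\<close> thus reduces to inverting a bounded operator on the whole space.\<close>
  define G where "G w = w - \<zeta> *\<^sub>C R w" for w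
  have G: "bounded_linear G"
    unfolding G_def by (intro bounded_linear_sub bounded_linear_ident
      bounded_linear_compose[OF scaleC.bounded_linear_right] R.bounded_linear_axioms)
  interpret G: bounded_linear G by (rule G)
  have G_scaleC: "G (a *\<^sub>C w) = a *\<^sub>C G w" for a w
    by (simp add: G_def R_scaleC cvec.scale_right_diff_distrib mult.commute)
  \<comment> \<open>Pairing G w = 0 with f n gives (1 - \<zeta> s n) b w (f n) = 0, and the first
    factor is nonzero because z avoids every 1 / s n - c.\<close>
  have ker: "w = 0" if "G w = 0" for w
  proof (rule b_eq_0_dense[OF span])
    fix n
    have "b w (f n) = \<zeta> * b (R w) (f n)" using that by (simp add: G_def) (metis b_scaleC_left)
    also have "\<dots> = \<zeta> * of_real (s n) * b w (f n)"
      by (simp add: R_sym Rf b.scaleR_right scaleR_conv_of_real)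
    finally show "b w (f n) = 0" using \<zeta>[of n] by (metis mult_cancel_right1)
  qed
  \<comment> \<open>Otherwise there are unit vectors v with G v tending to 0. Along a subsequence R
    v converges, hence so does v = G v + \<zeta> R v, and the limit is a unit vector in the
    kernel.\<close>
  have "\<exists>a>0. \<forall>w. a * norm w \<le> norm (G w)"
  proof (rule ccontr)
    assume "\<not> ?thesis"
    then have "\<exists>w. norm (G w) < inverse (real (Suc n)) * norm w" for n
      by (metis inverse_positive_iff_positive not_le of_nat_0_less_iff zero_less_Suc)
    then obtain w where w: "\<And>n. norm (G (w n)) < inverse (real (Suc n)) * norm (w n)" by metis
    then have w0: "w n \<noteq> 0" for n
      by (metis mult_zero_right norm_zero not_less norm_ge_zero)
    define v where "v n = (1 / norm (w n)) *\<^sub>R w n" for n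
    have v1: "norm (v n) = 1" for n using w0 by (simp add: v_def)
    have Gv: "norm (G (v n)) \<le> inverse (real (Suc n))" for n
      using w[of n] w0[of n] by (simp add: v_def G.scaleR divide_le_eq del: of_nat_Suc)
    have Gv0: "(\<lambda>n. G (v n)) \<longlonglongrightarrow> 0"
      by (rule Lim_null_comparison[OF _ LIMSEQ_inverse_real_of_nat]) (use Gv in simp)
    obtain l r where r: "strict_mono (r :: nat \<Rightarrow> nat)" "(\<lambda>n. R (v (r n))) \<longlonglongrightarrow> l"
      using compact_operator_subseq[where u = v and B = 1, OF R_compact eq_refl[OF v1]] by blast
    have "(\<lambda>n. G (v (r n))) \<longlonglongrightarrow> 0"
      using LIMSEQ_subseq_LIMSEQ[OF Gv0 r(1)] by (simp add: o_def)
    from tendsto_add[OF this scaleC.tendsto[OF tendsto_const[of \<zeta>] r(2)]]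
    have lim: "(\<lambda>n. v (r n)) \<longlonglongrightarrow> \<zeta> *\<^sub>C l" by (simp add: G_def)
    have "(\<lambda>n. norm (v (r n))) \<longlonglongrightarrow> norm (\<zeta> *\<^sub>C l)" by (rule tendsto_norm[OF lim])
    then have "norm (\<zeta> *\<^sub>C l) = 1" by (simp only: v1 LIMSEQ_const_iff)
    moreover have "G (\<zeta> *\<^sub>C l) = 0"
      using G.tendsto[OF lim] \<open>(\<lambda>n. G (v (r n))) \<longlonglongrightarrow> 0\<close> by (rule LIMSEQ_unique)
    then have "\<zeta> *\<^sub>C l = 0" by (rule ker)
    ultimately show False by (metis norm_zero zero_neq_one)
  qed
  then obtain a where a: "a > 0" "\<And>w. a * norm w \<le> norm (G w)" by blast
  have "closed (range G)"
    unfolding closed_sequential_limits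
  proof (intro allI impI)
    fix y l assume y: "(\<forall>n. y n \<in> range G) \<and> y \<longlonglongrightarrow> l"
    then have "\<forall>n. \<exists>x. y n = G x" by blast
    then obtain x where x: "\<And>n. y n = G (x n)" by metis
    have "Cauchy x"
    proof (rule CauchyI)
      fix e :: real assume "e > 0"
      then have "a * e > 0" using a(1) by simp
      moreover have "Cauchy y" using y LIMSEQ_imp_Cauchy by blast
      ultimately obtain N where N: "\<And>i j. i \<ge> N \<Longrightarrow> j \<ge> N \<Longrightarrow> norm (y i - y j) < a * e"
        using CauchyD by blast
      have "norm (x i - x j) < e" if "i \<ge> N" "j \<ge> N" for i j
      proof -
        have "a * norm (x i - x j) < a * e"
          using a(2)[of "x i - x j"] N[OF that] by (simp add: x G.diff)
        then show ?thesis using a(1) by simp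
      qed
      then show "\<exists>M. \<forall>m\<ge>M. \<forall>n\<ge>M. norm (x m - x n) < e" by blast
    qed
    then obtain k where "x \<longlonglongrightarrow> k" by (auto simp: Cauchy_convergent_iff convergent_def)
    from G.tendsto[OF this] have "y \<longlonglongrightarrow> G k" by (simp only: x[symmetric])
    then have "l = G k" using y LIMSEQ_unique by blast
    then show "l \<in> range G" by blast
  qed
  moreover have "cvec.span (range f) \<subseteq> range G"
  proof (rule cvec.span_minimal)
    show "range f \<subseteq> range G"
    proof safe
      fix n
      have "G (f n) = (1 - \<zeta> * of_real (s n)) *\<^sub>C f n"
        by (simp add: G_def Rf scaleR_scaleC cvec.scale_left_diff_distrib)
      then have "G (inverse (1 - \<zeta> * of_real (s n)) *\<^sub>C f n) = f n"
        using \<zeta>[of n] by (simp add: G_scaleC)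
      then show "f n \<in> range G" by (metis rangeI)
    qed
    show "cvec.subspace (range G)"
      unfolding cvec.subspace_def
      by (auto simp: G.add[symmetric] G_scaleC[symmetric] intro: image_eqI[of _ _ 0] simp: G.zero)
  qed
  ultimately have "closure (cvec.span (range f)) \<subseteq> range G" by (intro closure_minimal)
  then have surj: "surj G" using span by auto
  have inj: "inj G" using ker by (metis G.diff eq_iff_diff_eq_0 injI)
  have Ginv: "G (inv G h) = h" "inv G (G h) = h" for h
    using surj inj by (simp_all add: surj_f_inv_f)
  have Gi: "bounded_linear (inv G)"
  proof (rule bounded_linear_intro)
    show "inv G (x + y) = inv G x + inv G y" for x y
      by (rule injD[OF inj]) (simp add: G.add Ginv)
    show "inv G (k *\<^sub>R x) = k *\<^sub>R inv G x" for k x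
      by (rule injD[OF inj]) (simp add: G.scaleR Ginv)
    show "norm (inv G x) \<le> norm x * (1 / a)" for x
      using a(2)[of "inv G x"] a(1) by (simp add: Ginv field_simps)
  qed
  have sol: "A (R (inv G h)) - z *\<^sub>C R (inv G h) = h" for h
  proof -
    have "A (R (inv G h)) - z *\<^sub>C R (inv G h) = G (inv G h)"
      by (simp add: A_R' G_def \<zeta>_def scaleR_scaleC cvec.scale_left_distrib)
    then show ?thesis by (simp add: Ginv)
  qed
  have uniq: "R (inv G (A u - z *\<^sub>C u)) = u" if "u \<in> D" for u
  proof -
    have "A u - z *\<^sub>C u = G (A u + c *\<^sub>R u)"
      unfolding G_def R_A[OF that] by (simp add: \<zeta>_def cvec.scale_left_distrib scaleR_scaleC)
    then show ?thesis using R_A[OF that] by (simp add: Ginv)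
  qed
  have bij: "bij_betw (\<lambda>u. A u - z *\<^sub>C u) D UNIV"
    by (rule bij_betwI[of _ _ _ "\<lambda>h. R (inv G h)"]) (auto simp: R_dom sol uniq)
  moreover have "resolvent D A z = (\<lambda>h. R (inv G h))"
    by (rule ext, rule resolvent_eqI[OF bij R_dom sol])
  ultimately show ?thesis
    using bounded_linear_compose[OF R.bounded_linear_axioms Gi] by (simp add: resolvent_set_def)
qed

theorem spectral_decomposition:
  "\<exists>(ev :: nat \<Rightarrow> complex) (\<phi> :: nat \<Rightarrow> 'a L2) (\<phi>' :: nat \<Rightarrow> 'a L2).
     spectrum D A = range ev \<and>
     (\<forall>n. ev n isolated_in spectrum D A \<and> eigenvalue D A (ev n) \<and> finite_alg_multiplicity D A (ev n)) \<and>
     filterlim (\<lambda>n. norm (ev n)) at_top sequentially \<and>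
     (\<forall>n. generalized_eigenfunction D A (ev n) (\<phi> n)) \<and>
     (\<forall>n. generalized_eigenfunction (adj_dom D A) (adj_op D A) (cnj (ev n)) (\<phi>' n)) \<and>
     (\<forall>n m. cinner (\<phi> n) (\<phi>' m) = (if n = m then 1 else 0)) \<and>
     closure (cvec.span (range \<phi>)) = UNIV \<and> closure (cvec.span (range \<phi>')) = UNIV"
proof -
  have "closure (range R) = UNIV" using dense by (simp add: D_range)
  then obtain s :: "nat \<Rightarrow> real" and f :: "nat \<Rightarrow> 'a L2"
    where s: "\<And>n. s n > 0" and Rf: "\<And>n. R (f n) = s n *\<^sub>R f n"
    and bf: "\<And>i j. b (f i) (f j) = (if i = j then 1 else 0)"
    and s0: "s \<longlonglongrightarrow> 0" and span: "closure (cvec.span (range f)) = UNIV"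
    using eigenbasis[OF inf_dim] by metis
  \<comment> \<open>R f = s f says that (A + c) f = f / s, so the eigenvalues of A are 1 / s -
    c.\<close>
  define ev :: "nat \<Rightarrow> complex" where "ev n = of_real (1 / s n - c)" for n
  have f0: "f n \<noteq> 0" for n using bf[of n n] by (auto simp: b.zero_left)
  have fD: "f n \<in> D" for n
  proof -
    have "f n = R ((1 / s n) *\<^sub>R f n)" using s[of n] by (simp add: R.scaleR Rf)
    then show ?thesis by (metis R_dom)
  qed
  have Af: "A (f n) = ev n *\<^sub>C f n" for n
  proof -
    have "A (R ((1 / s n) *\<^sub>R f n)) = (1 / s n) *\<^sub>R f n - c *\<^sub>R R ((1 / s n) *\<^sub>R f n)"
      by (rule A_R')
    moreover have "R ((1 / s n) *\<^sub>R f n) = f n" using s[of n] by (simp add: R.scaleR Rf)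
    ultimately show ?thesis
      by (simp add: ev_def scaleR_scaleC cvec.scale_left_diff_distrib)
  qed
  have spec: "spectrum D A = range ev"
  proof
    show "range ev \<subseteq> spectrum D A" using eigenvalue_in_spectrum[OF fD f0 Af] by blast
    show "spectrum D A \<subseteq> range ev"
    proof
      fix z assume "z \<in> spectrum D A"
      then have "z \<notin> resolvent_set D A" by (simp add: spectrum_def)
      then obtain n where "z = ev n" using resolvent_setI[OF s Rf span, of z] by (auto simp: ev_def)
      then show "z \<in> range ev" by blast
    qed
  qed
  have lim: "filterlim (\<lambda>n. norm (ev n)) at_top sequentially"
  proof (rule filterlim_at_top_mono)
    have "filterlim s (at_right 0) sequentially"
      using s0 s by (simp add: filterlim_at less_imp_neq[OF s, symmetric])
    then have "filterlim (\<lambda>n. inverse (s n)) at_top sequentially"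
      by (rule filterlim_compose[OF filterlim_inverse_at_top_right])
    then show "filterlim (\<lambda>n. - c + inverse (s n)) at_top sequentially"
      by (rule filterlim_tendsto_add_at_top[OF tendsto_const])
    show "\<forall>\<^sub>F n in sequentially. - c + inverse (s n) \<le> norm (ev n)"
      by (intro always_eventually allI) (simp add: ev_def norm_of_real inverse_eq_divide del: of_real_diff of_real_divide)
  qed
  have fin: "finite {n. norm (ev n) \<le> C}" for C
  proof -
    obtain N where "\<And>n. n \<ge> N \<Longrightarrow> C + 1 \<le> norm (ev n)"
      using lim unfolding filterlim_at_top eventually_sequentially by blast
    then have "{n. norm (ev n) \<le> C} \<subseteq> {..<N}"
      by (force simp: not_le[symmetric])
    then show ?thesis by (rule finite_subset) simp
  qed
  \<comment> \<open>Only finitely many eigenvalues have modulus at most |ev n| + 1. Removing those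
    different from ev n from the unit ball leaves an isolating neighbourhood.\<close>
  have isol: "ev n isolated_in spectrum D A" for n
    unfolding isolated_in_def
  proof (intro conjI exI)
    let ?F = "ev ` {k. norm (ev k) \<le> norm (ev n) + 1} - {ev n}"
    show "ev n \<in> spectrum D A" by (simp add: spec)
    show "open (ball (ev n) 1 - ?F)"
      using fin by (intro open_Diff finite_imp_closed) auto
    show "(ball (ev n) 1 - ?F) \<inter> spectrum D A = {ev n}"
    proof -
      have "norm (ev k) \<le> norm (ev n) + 1" if "dist (ev n) (ev k) < 1" for k
        using norm_triangle_ineq2[of "ev k" "ev n"] that by (simp add: dist_norm norm_minus_commute)
      then show ?thesis by (auto simp: spec)
    qed
  qed
  \<comment> \<open>Symmetry excludes Jordan chains. Inductively w = (A - ev n) u already satisfies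
    (A - ev n) w = 0, and since ev n is real, b w w = b u ((A - ev n) w) = 0.\<close>
  have root: "root_space D A (ev n) \<subseteq> {u \<in> D. A u = ev n *\<^sub>C u}" for n
  proof -
    have "ker_pow D A (ev n) k \<subseteq> {u \<in> D. A u = ev n *\<^sub>C u}" for k
    proof (induction k)
      case 0
      then show ?case by (auto simp: D_zero A_zero)
    next
      case (Suc k)
      show ?case
      proof
        fix u assume u: "u \<in> ker_pow D A (ev n) (Suc k)"
        define w where "w = A u - ev n *\<^sub>C u"
        have uD: "u \<in> D" using u by simp
        have w: "w \<in> D" "A w = ev n *\<^sub>C w" using u Suc by (auto simp: w_def)
        have "b w w = b (A u) w - ev n * b u w" by (simp add: w_def b.diff_left)
        also have "b (A u) w = b u (A w)" using uD w(1) by (rule A_sym)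
        also have "b u (A w) = ev n * b u w" by (simp add: w(2) ev_def)
        finally have "w = 0" by (simp add: b_self)
        then show "u \<in> {u \<in> D. A u = ev n *\<^sub>C u}" using uD by (simp add: w_def)
      qed
    qed
    then show ?thesis unfolding root_space_def by blast
  qed
  \<comment> \<open>A root vector is an eigenvector, hence \<open>b\<close>-orthogonal to every f k
    with another eigenvalue. Subtracting its expansion in the finitely many remaining f k leaves a
    vector orthogonal to the whole dense family.\<close>
  have mult: "finite_alg_multiplicity D A (ev n)" for n
    unfolding finite_alg_multiplicity_def
  proof (intro exI conjI subsetI)
    define F where "F = {k. ev k = ev n}"
    have F: "finite F" by (rule finite_subset[OF _ fin[of "norm (ev n)"]]) (auto simp: F_def)
    show "finite (f ` {k. ev k = ev n})" using F by (simp add: F_def)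
    fix u assume "u \<in> root_space D A (ev n)"
    then have u: "u \<in> D" "A u = ev n *\<^sub>C u" using root by blast+
    have bu: "b u (f k) = 0" if "ev k \<noteq> ev n" for k
    proof -
      have "ev n * b u (f k) = b (A u) (f k)" by (simp add: u)
      also have "\<dots> = b u (A (f k))" by (rule A_sym[OF u(1) fD])
      also have "\<dots> = ev k * b u (f k)" by (simp add: Af ev_def)
      finally show ?thesis using that by simp
    qed
    have "u - (\<Sum>k\<in>F. b u (f k) *\<^sub>C f k) = 0"
    proof (rule b_eq_0_dense[OF span])
      fix j
      have "b (\<Sum>k\<in>F. b u (f k) *\<^sub>C f k) (f j) = (if j \<in> F then b u (f j) else 0)"
        using F by (simp add: b.sum_left bf if_distrib cong: if_cong)
      then show "b (u - (\<Sum>k\<in>F. b u (f k) *\<^sub>C f k)) (f j) = 0"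
        using bu[of j] by (auto simp: b.diff_left F_def)
    qed
    then have "u = (\<Sum>k\<in>F. b u (f k) *\<^sub>C f k)" by simp
    also have "\<dots> \<in> cvec.span (f ` F)"
      by (intro cvec.span_sum cvec.span_scale cvec.span_base) auto
    finally show "u \<in> cvec.span (f ` {k. ev k = ev n})" by (simp add: F_def)
  qed
  have gen: "generalized_eigenfunction D A (ev n) (f n)" for n
  proof -
    have "f n \<in> ker_pow D A (ev n) (Suc 0)" by (simp add: fD Af)
    then show ?thesis unfolding generalized_eigenfunction_def root_space_def using f0 by blast
  qed
  have eig: "eigenvalue D A (ev n)" for n
    unfolding eigenvalue_def using fD f0 Af by blast
  \<comment> \<open>Symmetry of A for \<open>b\<close>, rewritten in the original inner product,
    says that the adjoint of A sends M f to M (A f).\<close>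
  have adj: "\<forall>u\<in>D. cinner (A u) (M (f n)) = cinner u (cnj (ev n) *\<^sub>C M (f n))" for n
  proof
    fix u assume "u \<in> D"
    then have "b (A u) (f n) = b u (A (f n))" using fD by (rule A_sym)
    then show "cinner (A u) (M (f n)) = cinner u (cnj (ev n) *\<^sub>C M (f n))"
      by (simp add: b_def M_sym[symmetric] Af ev_def)
  qed
  \<comment> \<open>Two candidates for the value of the adjoint have a difference orthogonal to
    \<open>D\<close>, hence to its closure, so \<open>THE\<close> has a unique witness.\<close>
  have adj_op: "adj_op D A w = h" if h: "\<forall>u\<in>D. cinner (A u) w = cinner u h" for w h
    unfolding adj_op_def
  proof (rule the_equality)
    show "\<forall>u\<in>D. cinner (A u) w = cinner u h" by (rule h)
    fix h' assume "\<forall>u\<in>D. cinner (A u) w = cinner u h'"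
    with h have "D \<subseteq> {u. cinner u (h' - h) = 0}" by (auto simp: cinner.diff_right)
    moreover have "closed {u. cinner u (h' - h) = 0}"
      by (intro closed_Collect_eq continuous_intros cinner.continuous_on)
    ultimately have "closure D \<subseteq> {u. cinner u (h' - h) = 0}" by (rule closure_minimal)
    then have "cinner (h' - h) (h' - h) = 0" using dense by blast
    then show "h' = h" by (simp add: cinner_self)
  qed
  have gen': "generalized_eigenfunction (adj_dom D A) (adj_op D A) (cnj (ev n)) (M (f n))" for n
  proof -
    have "M (f n) \<in> adj_dom D A" using adj unfolding adj_dom_def by blast
    then have "M (f n) \<in> ker_pow (adj_dom D A) (adj_op D A) (cnj (ev n)) (Suc 0)"
      by (simp add: adj_op[OF adj])
    moreover have "M (f n) \<noteq> 0"
      using bf[of n n] by (auto simp: b_def cinner.zero_left)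
    ultimately show ?thesis unfolding generalized_eigenfunction_def root_space_def by blast
  qed
  have biorth: "cinner (f n) (M (f k)) = (if n = k then 1 else 0)" for n k
    using bf[of n k] by (simp add: b_def M_sym)
  have "closure (cvec.span (range (\<lambda>n. M (f n)))) = UNIV"
  proof -
    have "M u \<in> cvec.span (range (\<lambda>n. M (f n)))" if "u \<in> cvec.span (range f)" for u
      using that
    proof (induction rule: cvec.span_induct_alt)
      case base
      then show ?case by (simp add: M.zero cvec.span_zero)
    next
      case (step k x y)
      then obtain n where "x = f n" by blast
      then have "k *\<^sub>C M x \<in> cvec.span (range (\<lambda>n. M (f n)))"
        by (intro cvec.span_scale cvec.span_base) blast
      then have "k *\<^sub>C M x + M y \<in> cvec.span (range (\<lambda>n. M (f n)))"
        using step.IH step.hyps by (intro cvec.span_add) auto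
      then show ?case by (simp only: M.add M_scaleC)
    qed
    then have "M ` closure (cvec.span (range f)) \<subseteq> closure (cvec.span (range (\<lambda>n. M (f n))))"
      by (intro image_closure_subset M.continuous_on continuous_on_id)
         (auto intro: subsetD[OF closure_subset])
    then show ?thesis unfolding span M_surj by (simp add: top.extremum_unique)
  qed
  then show ?thesis
    by (intro exI[of _ ev] exI[of _ f] exI[of _ "\<lambda>n. M (f n)"] conjI allI
          spec isol eig mult lim gen gen' biorth span)
qed

end

section \<open>Calculus on the torus\<close>

lemma integral_torus:
  fixes f :: "real ^ 'n::finite \<Rightarrow> 'b::{banach, second_countable_topology}"
  shows "(LINT x|torus. f x) = (LINT x|lborel. indicator (cbox 0 (\<chi> i. 2 * pi)) x *\<^sub>R f x)"
  unfolding torus_def by (subst integral_restrict_space) auto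

lemma integrable_torus_iff:
  fixes f :: "real ^ 'n::finite \<Rightarrow> 'b::{banach, second_countable_topology}"
  shows "integrable torus f \<longleftrightarrow> integrable lborel (\<lambda>x. indicator (cbox 0 (\<chi> i. 2 * pi)) x *\<^sub>R f x)"
  unfolding torus_def by (subst integrable_restrict_space) auto

lemma measurable_torus_borel: "f \<in> borel_measurable borel \<Longrightarrow> f \<in> borel_measurable torus"
  unfolding torus_def by (rule measurable_restrict_space1) simp

lemma measurable_torus_continuous [measurable (raw)]:
  "continuous_on UNIV f \<Longrightarrow> f \<in> borel_measurable torus"
  by (rule measurable_torus_borel) (rule borel_measurable_continuous_onI)

lemma compact_cell: "compact (cbox 0 (\<chi> i. 2 * pi) :: (real ^ 'n::finite) set)"
  by (rule compact_cbox)

lemma integrable_torus_continuous: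
  fixes f :: "real ^ 'n::finite \<Rightarrow> 'b::{banach, second_countable_topology}"
  assumes "continuous_on UNIV f"
  shows "integrable torus f"
  unfolding integrable_torus_iff
  using compact_cell continuous_on_subset[OF assms subset_UNIV] by (rule borel_integrable_compact)

lemma continuous_Lp2:
  fixes f :: "real ^ 'n::finite \<Rightarrow> complex"
  assumes "continuous_on UNIV f"
  shows "Lp 2 f"
  unfolding Lp2_iff
  by (intro conjI measurable_torus_continuous integrable_torus_continuous continuous_intros assms)

lemma continuous_bounded_cell:
  fixes f :: "real ^ 'n::finite \<Rightarrow> 'b::real_normed_vector"
  assumes "continuous_on UNIV f"
  obtains B where "B \<ge> 0" "\<And>x. x \<in> cbox 0 (\<chi> i. 2 * pi) \<Longrightarrow> norm (f x) \<le> B"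
proof -
  have "compact (f ` cbox 0 (\<chi> i. 2 * pi))"
    using continuous_on_subset[OF assms subset_UNIV] compact_cell by (rule compact_continuous_image)
  then obtain B where B: "\<forall>y\<in>f ` cbox 0 (\<chi> i. 2 * pi). norm y \<le> B"
    using compact_imp_bounded bounded_iff by blast
  show thesis by (rule that[of "max 0 B"]) (use B in \<open>auto intro: le_max_iff_disj[THEN iffD2]\<close>)
qed

subsection \<open>Periodic functions\<close>

lemma periodicD: "periodic f \<Longrightarrow> f (x + axis i (2 * pi)) = f x"
  by (simp add: periodic_def)

lemma periodic_shift:
  fixes f :: "real ^ 'n::finite \<Rightarrow> 'b"
  assumes "periodic f"
  shows "f (x + (\<chi> i. 2 * pi * of_int (k i))) = f x"
proof -
  \<comment> \<open>The periods of f form an additive group, so it suffices that it contains the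
    coordinate vectors of length 2 pi.\<close>
  define P where "P a \<longleftrightarrow> (\<forall>x. f (x + a) = f x)" for a
  have P0: "P 0" by (simp add: P_def)
  have Padd: "P (a + b)" if "P a" "P b" for a b
    using that by (simp add: P_def add.assoc[symmetric])
  have Pneg: "P (- a)" if "P a" for a
    unfolding P_def
  proof
    fix x show "f (x + - a) = f x" using that[unfolded P_def, rule_format, of "x + - a"] by simp
  qed
  have Pax: "P (axis i (2 * pi * of_int m))" for i m
  proof (induction m rule: int_induct[of _ 0])
    case base
    have "axis i (2 * pi * of_int 0) = (0 :: real^'n)" by (simp add: vec_eq_iff axis_def)
    then show ?case by (simp only: P0)
  next
    case (step1 m)
    have "axis i (2 * pi * of_int (m + 1)) = axis i (2 * pi * of_int m) + (axis i (2 * pi) :: real^'n)"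
      by (simp add: vec_eq_iff axis_def algebra_simps)
    moreover have "P (axis i (2 * pi))" using assms by (simp add: P_def periodic_def)
    ultimately show ?case using Padd step1 by simp
  next
    case (step2 m)
    have "axis i (2 * pi * of_int (m - 1)) = axis i (2 * pi * of_int m) + - (axis i (2 * pi) :: real^'n)"
      by (simp add: vec_eq_iff axis_def algebra_simps)
    moreover have "P (- axis i (2 * pi))" using assms by (intro Pneg) (simp add: P_def periodic_def)
    ultimately show ?case using Padd step2.IH by metis
  qed
  have "P (\<Sum>i\<in>I. axis i (2 * pi * of_int (k i)))" for I
    by (induction I rule: infinite_finite_induct) (auto intro: P0 Padd Pax)
  moreover have "(\<chi> i. 2 * pi * of_int (k i)) = (\<Sum>i\<in>UNIV. axis i (2 * pi * of_int (k i)) :: real^'n)"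
    by (simp add: vec_eq_iff axis_def if_distrib cong: if_cong)
  ultimately show ?thesis by (simp add: P_def)
qed

lemma periodic_cell:
  fixes x :: "real ^ 'n::finite"
  obtains y where "y \<in> cbox 0 (\<chi> i. 2 * pi)" "\<And>f. periodic f \<Longrightarrow> f x = f y"
proof -
  define k where "k i = - \<lfloor>x $ i / (2 * pi)\<rfloor>" for i
  define y where "y = x + (\<chi> i. 2 * pi * of_int (k i))"
  have "y \<in> cbox 0 (\<chi> i. 2 * pi)"
    unfolding mem_box_cart
  proof
    fix i
    have "of_int \<lfloor>x $ i / (2 * pi)\<rfloor> \<le> x $ i / (2 * pi)" "x $ i / (2 * pi) < of_int \<lfloor>x $ i / (2 * pi)\<rfloor> + 1"
      by linarith+
    then have "2 * pi * of_int \<lfloor>x $ i / (2 * pi)\<rfloor> \<le> 2 * pi * (x $ i / (2 * pi))"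
      "2 * pi * (x $ i / (2 * pi)) \<le> 2 * pi * (of_int \<lfloor>x $ i / (2 * pi)\<rfloor> + 1)"
      by (intro mult_left_mono; simp)+
    then have "2 * pi * of_int \<lfloor>x $ i / (2 * pi)\<rfloor> \<le> x $ i" "x $ i \<le> 2 * pi * of_int \<lfloor>x $ i / (2 * pi)\<rfloor> + 2 * pi"
      by (simp_all add: distrib_left)
    then show "0 $ i \<le> y $ i \<and> y $ i \<le> (\<chi> i. 2 * pi) $ i"
      by (simp add: y_def k_def)
  qed
  moreover have "f x = f y" if "periodic f" for f :: "real ^ 'n \<Rightarrow> 'b"
    unfolding y_def using periodic_shift[OF that] by simp
  ultimately show thesis using that by blast
qed

text \<open>The cell shifted by t in direction i overhangs the plane y_i = 2 pi. Moving the overhang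
  back by one period tiles the original cell, up to boundary hyperplanes, which are null
  sets.\<close>

lemma cell_shift_AE:
  fixes i :: "'n::finite"
  assumes t: "0 \<le> t" "t \<le> 2 * pi"
  defines "C \<equiv> cbox 0 (\<chi> i. 2 * pi) :: (real ^ 'n) set"
  shows "AE y in lborel. indicator C y =
    indicator C (y - axis i t) * indicator {y. y $ i \<le> 2 * pi} y +
    (indicator C (y + axis i (2 * pi) - axis i t) * indicator {y. y $ i > 2 * pi} (y + axis i (2 * pi)) :: real)"
proof -
  have neq: "AE y in lborel. (y :: real ^ 'n) $ i \<noteq> c" for c
    using AE_lborel_inner_neq[of "axis i 1 :: real ^ 'n" c] by (simp add: inner_axis axis_in_Basis_iff)
  show ?thesis
    using neq[of 0] neq[of t] neq[of "2 * pi"]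
  proof eventually_elim
    case (elim y)
    define Q where "Q \<longleftrightarrow> (\<forall>j. j \<noteq> i \<longrightarrow> 0 \<le> y $ j \<and> y $ j \<le> 2 * pi)"
    have C: "z \<in> C \<longleftrightarrow> Q \<and> 0 \<le> z $ i \<and> z $ i \<le> 2 * pi" if "\<And>j. j \<noteq> i \<Longrightarrow> z $ j = y $ j" for z
      unfolding C_def mem_box_cart Q_def using that by (metis vec_lambda_beta zero_index)
    have "y \<in> C \<longleftrightarrow> Q \<and> 0 \<le> y $ i \<and> y $ i \<le> 2 * pi" by (rule C) simp
    moreover have "y - axis i t \<in> C \<longleftrightarrow> Q \<and> t \<le> y $ i \<and> y $ i \<le> 2 * pi + t"
      using C[of "y - axis i t"] by (auto simp: axis_def)
    moreover have "y + axis i (2 * pi) - axis i t \<in> C \<longleftrightarrow> Q \<and> t \<le> y $ i + 2 * pi \<and> y $ i \<le> t"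
      using C[of "y + axis i (2 * pi) - axis i t"] by (auto simp: axis_def)
    moreover have "(y + axis i (2 * pi)) $ i = y $ i + 2 * pi" by (simp add: axis_def)
    ultimately show ?case
      using elim t by (cases Q) (auto simp: indicator_def)
  qed
qed

lemma integral_torus_shift:
  fixes f :: "real ^ 'n::finite \<Rightarrow> 'b::{banach, second_countable_topology}"
  assumes cont: "continuous_on UNIV f" and per: "periodic f" and t: "0 \<le> t" "t \<le> 2 * pi"
  shows "(LINT x|torus. f (x + axis i t)) = (LINT x|torus. f x)"
proof -
  define C where "C = (cbox 0 (\<chi> i. 2 * pi) :: (real ^ 'n) set)"
  define S where "S = {y :: real ^ 'n. y $ i \<le> 2 * pi}"
  have shift: "(LINT x|lborel. g x) = (LINT x|lborel. g (a + x))" if "g \<in> borel_measurable borel"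
    for g :: "real ^ 'n \<Rightarrow> 'b" and a
    using that by (subst lborel_distr_plus[of a, symmetric], subst integral_distr) auto
  have shift_int: "integrable lborel (\<lambda>x. g (a + x))" if "integrable lborel g" for g :: "real ^ 'n \<Rightarrow> 'b" and a
    using that by (subst (asm) lborel_distr_plus[of a, symmetric], subst (asm) integrable_distr_eq) auto
  have fm [measurable]: "f \<in> borel_measurable borel"
    using cont by (rule borel_measurable_continuous_onI)
  have Cm [measurable]: "C \<in> sets borel" by (simp add: C_def)
  have Sm [measurable]: "S \<in> sets borel" by (simp add: S_def)
  have "(\<lambda>y. y - axis i t :: real ^ 'n) \<in> borel_measurable borel" by measurable
  then have C't [measurable]: "{y. y - axis i t \<in> C} \<in> sets borel"
    using Cm by (auto dest: measurable_sets_borel simp: vimage_def)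
  define g where "g y = indicator C (y - axis i t) *\<^sub>R f y" for y
  have g: "integrable lborel g"
  proof -
    have "continuous_on UNIV (\<lambda>x. f (axis i t + x))"
      by (intro continuous_on_compose2[OF cont] continuous_intros) auto
    then have "integrable lborel (\<lambda>x. indicator C x *\<^sub>R f (axis i t + x))"
      unfolding C_def by (intro borel_integrable_compact compact_cell) (rule continuous_on_subset, auto)
    from shift_int[OF this, of "- axis i t"] show ?thesis by (simp add: g_def[abs_def])
  qed
  have gS: "integrable lborel (\<lambda>y. indicator S y *\<^sub>R g y)" and gS': "integrable lborel (\<lambda>y. indicator (- S) y *\<^sub>R g y)"
    using g by (auto intro!: integrable_mult_indicator)
  have "(LINT x|torus. f (x + axis i t)) = (LINT x|lborel. g (axis i t + x))"
    unfolding integral_torus g_def C_def by (simp add: add.commute)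
  also have "\<dots> = (LINT x|lborel. g x)"
    by (rule shift[symmetric]) (use g in auto)
  also have "\<dots> = (LINT x|lborel. indicator S x *\<^sub>R g x + indicator (- S) x *\<^sub>R g x)"
    by (rule Bochner_Integration.integral_cong) (auto simp: indicator_def)
  also have "\<dots> = (LINT x|lborel. indicator S x *\<^sub>R g x) + (LINT x|lborel. indicator (- S) x *\<^sub>R g x)"
    using gS gS' by (rule Bochner_Integration.integral_add)
  \<comment> \<open>The part beyond 2 pi is translated back by a full period, where periodicity
    leaves the values of f unchanged.\<close>
  also have "(LINT x|lborel. indicator (- S) x *\<^sub>R g x) =
      (LINT x|lborel. indicator (- S) (axis i (2 * pi) + x) *\<^sub>R g (axis i (2 * pi) + x))"
    by (rule shift) (use gS' in auto)
  also have "(LINT x|lborel. indicator S x *\<^sub>R g x) + \<dots> =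
      (LINT x|lborel. indicator S x *\<^sub>R g x + indicator (- S) (axis i (2 * pi) + x) *\<^sub>R g (axis i (2 * pi) + x))"
    by (rule Bochner_Integration.integral_add[symmetric, OF gS shift_int[OF gS']])
  also have "\<dots> = (LINT x|lborel. indicator C x *\<^sub>R f x)"
  proof (rule integral_cong_AE)
    show "AE x in lborel. indicator S x *\<^sub>R g x + indicator (- S) (axis i (2 * pi) + x) *\<^sub>R g (axis i (2 * pi) + x)
        = indicator C x *\<^sub>R f x"
      using cell_shift_AE[OF t, of i]
    proof eventually_elim
      case (elim x)
      have "f (axis i (2 * pi) + x) = f x" using periodicD[OF per, of x i] by (simp add: add.commute)
      moreover have "- S = {y. y $ i > 2 * pi}" by (auto simp: S_def)
      ultimately show ?case
        unfolding elim[folded C_def S_def] g_def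
        by (simp add: scaleR_add_left mult.commute add.commute)
    qed
    show "(\<lambda>x. indicator S x *\<^sub>R g x + indicator (- S) (axis i (2 * pi) + x) *\<^sub>R g (axis i (2 * pi) + x)) \<in> borel_measurable lborel"
      using gS shift_int[OF gS'] by (intro borel_measurable_add) auto
  qed measurable
  finally show ?thesis by (simp add: integral_torus C_def)
qed

subsection \<open>Classical derivatives\<close>

lemma differentiableD: "f differentiable F \<Longrightarrow> (f has_derivative frechet_derivative f F) F"
  by (simp add: frechet_derivative_works)

lemma pd_eqI: "(f has_derivative f') (at x) \<Longrightarrow> pd i f x = f' (axis i 1)"
  unfolding pd_def using frechet_derivative_at[of f f' x] by simp

lemma has_derivative_pd:
  fixes f :: "real ^ 'n::finite \<Rightarrow> 'b::real_normed_vector"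
  assumes "f differentiable (at x)"
  shows "(f has_derivative (\<lambda>h. \<Sum>i\<in>UNIV. h $ i *\<^sub>R pd i f x)) (at x)"
proof -
  have D: "(f has_derivative frechet_derivative f (at x)) (at x)"
    using assms by (simp add: frechet_derivative_works)
  interpret D: bounded_linear "frechet_derivative f (at x)"
    using D by (rule has_derivative_bounded_linear)
  have "frechet_derivative f (at x) h = (\<Sum>i\<in>UNIV. h $ i *\<^sub>R pd i f x)" for h
  proof -
    have "h = (\<Sum>i\<in>UNIV. h $ i *\<^sub>R axis i 1)"
      by (simp add: vec_eq_iff axis_def if_distrib cong: if_cong)
    then have "frechet_derivative f (at x) h = frechet_derivative f (at x) (\<Sum>i\<in>UNIV. h $ i *\<^sub>R axis i 1)"
      by simp
    then show ?thesis by (simp add: D.sum D.scaleR pd_def)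
  qed
  then have "frechet_derivative f (at x) = (\<lambda>h. \<Sum>i\<in>UNIV. h $ i *\<^sub>R pd i f x)"
    by (rule ext)
  with D show ?thesis by simp
qed

lemma Ck_SucD: "Ck (Suc k) f \<Longrightarrow> f differentiable (at x)" "Ck (Suc k) f \<Longrightarrow> Ck k (pd i f)"
  by auto

lemma Ck_continuous: "Ck k f \<Longrightarrow> continuous_on UNIV f"
proof (cases k)
  case (Suc l)
  assume "Ck k f"
  then show ?thesis
    using Suc by (auto intro!: differentiable_imp_continuous_on simp: differentiable_on_def intro: differentiable_at_withinI)
qed simp

lemma Ck_le:
  fixes f :: "real ^ 'n::finite \<Rightarrow> 'b::real_normed_vector"
  shows "Ck k f \<Longrightarrow> l \<le> k \<Longrightarrow> Ck l f"
proof (induction l arbitrary: k f)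
  case 0
  then show ?case using Ck_continuous by auto
next
  case (Suc l)
  then obtain k' where "k = Suc k'" by (cases k) auto
  with Suc show ?case by auto
qed

lemma pd_add:
  assumes "f differentiable (at x)" "g differentiable (at x)"
  shows "pd i (\<lambda>x. f x + g x) x = pd i f x + pd i g x"
  using pd_eqI[OF has_derivative_add[OF assms[THEN frechet_derivative_works[THEN iffD1]]]]
  by (simp add: pd_def)

lemma pd_mult:
  fixes f g :: "real ^ 'n::finite \<Rightarrow> 'b::real_normed_algebra"
  assumes "f differentiable (at x)" "g differentiable (at x)"
  shows "pd i (\<lambda>x. f x * g x) x = f x * pd i g x + pd i f x * g x"
  using pd_eqI[OF has_derivative_mult[OF assms[THEN frechet_derivative_works[THEN iffD1]]]]
  by (simp add: pd_def)

lemma Ck_add: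
  fixes f g :: "real ^ 'n::finite \<Rightarrow> 'b::real_normed_vector"
  shows "Ck k f \<Longrightarrow> Ck k g \<Longrightarrow> Ck k (\<lambda>x. f x + g x)"
proof (induction k arbitrary: f g)
  case (Suc k)
  then have "pd i (\<lambda>x. f x + g x) = (\<lambda>x. pd i f x + pd i g x)" for i
    by (intro ext pd_add) auto
  then show ?case using Suc by auto
qed (auto intro: continuous_intros)

lemma Ck_mult:
  fixes f g :: "real ^ 'n::finite \<Rightarrow> 'b::real_normed_algebra"
  shows "Ck k f \<Longrightarrow> Ck k g \<Longrightarrow> Ck k (\<lambda>x. f x * g x)"
proof (induction k arbitrary: f g)
  case (Suc k)
  then have "pd i (\<lambda>x. f x * g x) = (\<lambda>x. f x * pd i g x + pd i f x * g x)" for i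
    by (intro ext pd_mult) auto
  moreover have "Ck k f" "Ck k g" using Suc.prems Ck_le[of "Suc k" _ k] by auto
  ultimately show ?case using Suc by (auto intro!: Ck_add)
qed (auto intro: continuous_intros)

lemma Ck_const: "Ck k (\<lambda>x. c)"
proof (induction k arbitrary: c)
  case (Suc k)
  have "pd i (\<lambda>x. c) = (\<lambda>x. 0)" for i :: 'a
    by (intro ext) (simp add: pd_eqI[OF has_derivative_const])
  then show ?case using Suc by simp
qed simp

lemma pd_linear:
  assumes "bounded_linear L" "f differentiable (at x)"
  shows "pd i (\<lambda>x. L (f x)) x = L (pd i f x)"
  using pd_eqI[OF bounded_linear.has_derivative[OF assms(1) differentiableD[OF assms(2)]]]
  by (simp add: pd_def)

lemma Ck_linear:
  fixes f :: "real ^ 'n::finite \<Rightarrow> 'b::real_normed_vector"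
  assumes L: "bounded_linear L"
  shows "Ck k f \<Longrightarrow> Ck k (\<lambda>x. L (f x))"
proof (induction k arbitrary: f)
  case 0
  then show ?case using bounded_linear.continuous_on[OF L] by simp
next
  case (Suc k)
  then have "pd i (\<lambda>x. L (f x)) = (\<lambda>x. L (pd i f x))" for i
    by (intro ext pd_linear L) auto
  moreover have "(\<lambda>x. L (f x)) differentiable (at x)" for x
    unfolding differentiable_def
    using bounded_linear.has_derivative[OF L differentiableD[OF Ck_SucD(1)[OF Suc.prems]]] by blast
  ultimately show ?case using Suc by auto
qed

lemma pd_exp:
  fixes f :: "real ^ 'n::finite \<Rightarrow> real"
  assumes "f differentiable (at x)"
  shows "pd i (\<lambda>x. exp (f x)) x = exp (f x) * pd i f x"
  using pd_eqI[OF has_derivative_exp[OF differentiableD[OF assms]]]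
  by (simp add: pd_def)

lemma Ck_exp:
  fixes f :: "real ^ 'n::finite \<Rightarrow> real"
  shows "Ck k f \<Longrightarrow> Ck k (\<lambda>x. exp (f x))"
proof (induction k arbitrary: f)
  case (Suc k)
  then have "pd i (\<lambda>x. exp (f x)) = (\<lambda>x. exp (f x) * pd i f x)" for i
    by (intro ext pd_exp) auto
  moreover have "(\<lambda>x. exp (f x)) differentiable (at x)" for x
    unfolding differentiable_def
    using has_derivative_exp[OF differentiableD[OF Ck_SucD(1)[OF Suc.prems]]] by blast
  moreover have "Ck k f" using Suc.prems Ck_le[of "Suc k" _ k] by auto
  ultimately show ?case using Suc by (auto intro!: Ck_mult)
qed (auto intro: continuous_intros)

lemma periodic_pd:
  fixes f :: "real ^ 'n::finite \<Rightarrow> 'b::real_normed_vector"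
  assumes "periodic f" "\<And>x. f differentiable (at x)"
  shows "periodic (pd i f)"
  unfolding periodic_def
proof (intro allI)
  fix x :: "real ^ 'n" and j
  let ?a = "axis j (2 * pi) :: real ^ 'n"
  have "((\<lambda>x. f (x + ?a)) has_derivative (\<lambda>h. frechet_derivative f (at (x + ?a)) h)) (at x)"
    by (rule has_derivative_compose[of "\<lambda>x. x + ?a" "\<lambda>h. h"])
       (auto intro!: derivative_eq_intros differentiableD assms(2))
  then have "(f has_derivative (\<lambda>h. frechet_derivative f (at (x + ?a)) h)) (at x)"
    using periodicD[OF assms(1)] by simp
  from pd_eqI[OF this] show "pd i f (x + ?a) = pd i f x"
    by (simp add: pd_def)
qed

subsection \<open>Convolutions with continuously differentiable kernels\<close>

text \<open>For fixed x the points x - y with y in the cell lie in one ball. Enlarged by 1 it also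
  contains the displaced points, and uniform continuity on this compact ball makes d independent of
  y.\<close>

lemma cell_uniformly_continuous:
  fixes g :: "real ^ 'n::finite \<Rightarrow> 'b::real_normed_vector"
  assumes g: "continuous_on UNIV g" and e: "e > 0"
  shows "\<exists>d>0. \<forall>y\<in>cbox 0 (\<chi> i. 2 * pi). \<forall>h. norm h < d \<longrightarrow> norm (g (x - y + h) - g (x - y)) < e"
proof -
  obtain B where B: "\<forall>y\<in>cbox 0 (\<chi> i. 2 * pi) :: (real^'n) set. norm y \<le> B"
    using compact_imp_bounded[OF compact_cell] bounded_iff by blast
  define K where "K = (cball 0 (norm x + B + 1) :: (real^'n) set)"
  have "uniformly_continuous_on K g"
    unfolding K_def by (intro compact_uniformly_continuous continuous_on_subset[OF g]) auto
  then obtain d where d: "d > 0" "\<And>z z'. z \<in> K \<Longrightarrow> z' \<in> K \<Longrightarrow> dist z' z < d \<Longrightarrow> dist (g z') (g z) < e"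
    unfolding uniformly_continuous_on_def using e by metis
  show ?thesis
  proof (intro exI[of _ "min d 1"] conjI ballI allI impI)
    fix y h :: "real^'n" assume y: "y \<in> cbox 0 (\<chi> i. 2 * pi)" and h: "norm h < min d 1"
    have "norm (x - y) \<le> norm x + B"
      using norm_triangle_ineq4[of x y] B y by fastforce
    moreover have "norm (x - y + h) \<le> norm (x - y) + norm h" by (rule norm_triangle_ineq)
    ultimately have "x - y \<in> K" "x - y + h \<in> K" using h by (auto simp: K_def)
    then show "norm (g (x - y + h) - g (x - y)) < e"
      using d(2)[of "x - y" "x - y + h"] h by (simp add: dist_norm)
  qed (use d in auto)
qed

lemma integrable_conv:
  fixes W f :: "real ^ 'n::finite \<Rightarrow> 'a::{real_normed_field, banach, second_countable_topology}"
  assumes W: "continuous_on UNIV W" and f: "integrable torus f"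
  shows "integrable torus (\<lambda>y. W (x - y) * f y)"
proof -
  have c: "continuous_on UNIV (\<lambda>y. W (x - y))"
    by (intro continuous_on_compose2[OF W] continuous_intros) auto
  obtain B where B: "B \<ge> 0" "\<And>y. y \<in> cbox 0 (\<chi> i. 2 * pi) \<Longrightarrow> norm (W (x - y)) \<le> B"
    using continuous_bounded_cell[OF c] by metis
  show ?thesis
  proof (rule Bochner_Integration.integrable_bound)
    show "integrable torus (\<lambda>y. B * norm (f y))" using f by simp
    show "(\<lambda>y. W (x - y) * f y) \<in> borel_measurable torus"
      using measurable_torus_continuous[OF c] f by (intro borel_measurable_times) auto
    show "AE y in torus. norm (W (x - y) * f y) \<le> norm (B * norm (f y))"
      using B by (intro AE_I2) (auto simp: space_torus norm_mult intro!: mult_right_mono)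
  qed
qed

lemma conv_continuous:
  fixes W f :: "real ^ 'n::finite \<Rightarrow> 'a::{real_normed_field, banach, second_countable_topology}"
  assumes W: "continuous_on UNIV W" and f: "integrable torus f"
  shows "continuous_on UNIV (\<lambda>x. LINT y|torus. W (x - y) * f y)"
  unfolding continuous_on_iff
proof (intro ballI allI impI)
  fix x :: "real ^ 'n" and e :: real assume e: "e > 0"
  define I where "I = (LINT y|torus. norm (f y))"
  have I: "I \<ge> 0" by (simp add: I_def integral_nonneg_AE)
  obtain d where d: "d > 0" "\<And>y h. y \<in> cbox 0 (\<chi> i. 2 * pi) \<Longrightarrow> norm h < d \<Longrightarrow>
      norm (W (x - y + h) - W (x - y)) < e / (I + 1)"
    using cell_uniformly_continuous[OF W, of "e / (I + 1)" x] e I by auto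
  show "\<exists>d>0. \<forall>x'\<in>UNIV. dist x' x < d \<longrightarrow>
      dist (LINT y|torus. W (x' - y) * f y) (LINT y|torus. W (x - y) * f y) < e"
  proof (intro exI[of _ d] conjI ballI impI)
    fix x' assume "dist x' x < d"
    then have h: "norm (x' - x) < d" by (simp add: dist_norm)
    have "(LINT y|torus. W (x' - y) * f y) - (LINT y|torus. W (x - y) * f y)
        = (LINT y|torus. (W (x' - y) - W (x - y)) * f y)"
      using integrable_conv[OF W f] by (simp add: left_diff_distrib)
    also have "norm \<dots> \<le> (LINT y|torus. e / (I + 1) * norm (f y))"
    proof (rule order_trans[OF integral_norm_bound integral_mono])
      show "integrable torus (\<lambda>y. norm ((W (x' - y) - W (x - y)) * f y))"
        using integrable_conv[OF W f] by (simp add: left_diff_distrib)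
      show "integrable torus (\<lambda>y. e / (I + 1) * norm (f y))" using f by simp
      fix y :: "real^'n" assume "y \<in> space torus"
      then have "norm (W (x' - y) - W (x - y)) \<le> e / (I + 1)"
        using d(2)[OF _ h, of y] by (simp add: space_torus algebra_simps less_imp_le)
      then show "norm ((W (x' - y) - W (x - y)) * f y) \<le> e / (I + 1) * norm (f y)"
        unfolding norm_mult by (intro mult_right_mono) auto
    qed
    also have "\<dots> = e * (I / (I + 1))" by (simp add: I_def)
    also have "\<dots> < e * 1" using e I by (intro mult_strict_left_mono) auto
    finally show "dist (LINT y|torus. W (x' - y) * f y) (LINT y|torus. W (x - y) * f y) < e"
      by (simp add: dist_norm)
  qed (rule d)
qed

lemma taylor_first_order:
  fixes W :: "real ^ 'n::finite \<Rightarrow> 'a::real_normed_vector"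
  assumes W: "Ck 1 W" and d: "d > 0" and e: "e \<ge> 0"
    and le: "\<And>i k. norm k < d \<Longrightarrow> norm (pd i W (z + k) - pd i W z) \<le> e" and h: "norm h < d"
  shows "norm (W (z + h) - W z - (\<Sum>i\<in>UNIV. h $ i *\<^sub>R pd i W z)) \<le> norm h * (real CARD('n) * e)"
proof -
  define D where "D x h = (\<Sum>i\<in>UNIV. h $ i *\<^sub>R pd i W x)" for x and h :: "real^'n"
  have "norm (W (z + h) - W z - D z ((z + h) - z)) \<le> norm ((z + h) - z) * (real CARD('n) * e)"
  proof (rule differentiable_bound_linearization[where S = "ball z d" and f' = D])
    show "z + t *\<^sub>R (z + h - z) \<in> ball z d" if "t \<in> {0..1}" for t
    proof -
      have "norm (t *\<^sub>R h) \<le> 1 * norm h"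
        unfolding norm_scaleR using that by (intro mult_right_mono) auto
      then have "norm (t *\<^sub>R h) < d" using h by linarith
      moreover have "z - (z + t *\<^sub>R (z + h - z)) = - (t *\<^sub>R h)" by simp
      ultimately show ?thesis by (simp only: mem_ball dist_norm norm_minus_cancel)
    qed
    show "(W has_derivative D x) (at x within ball z d)" for x
      unfolding D_def using W by - (rule has_derivative_at_withinI, rule has_derivative_pd, simp)
    show "onorm (D x - D z) \<le> real CARD('n) * e" if "x \<in> ball z d" for x
    proof (rule onorm_bound)
      fix k :: "real^'n"
      have "norm ((D x - D z) k) = norm (\<Sum>i\<in>UNIV. k $ i *\<^sub>R (pd i W x - pd i W z))"
        by (simp add: D_def sum_subtractf scaleR_diff_right)
      also have "\<dots> \<le> (\<Sum>i\<in>(UNIV :: 'n set). e * norm k)"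
      proof (rule sum_norm_le)
        fix i
        have "norm (pd i W x - pd i W z) \<le> e"
          using le[of "x - z" i] that by (simp add: dist_norm norm_minus_commute)
        then have "\<bar>k $ i\<bar> * norm (pd i W x - pd i W z) \<le> norm k * e"
          by (intro mult_mono component_le_norm_cart) auto
        then show "norm (k $ i *\<^sub>R (pd i W x - pd i W z)) \<le> e * norm k"
          by (simp add: mult.commute)
      qed
      also have "\<dots> = real CARD('n) * e * norm k" by simp
      finally show "norm ((D x - D z) k) \<le> real CARD('n) * e * norm k" .
    qed (use e in auto)
    show "z \<in> ball z d" using d by simp
  qed
  then show ?thesis by (simp add: D_def)
qed

text \<open>All regularity sits in the kernel: the Taylor remainder of \<open>W\<close> is uniform
  over the cell, so integrability of \<open>f\<close> is enough to pass it through the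
  integral.\<close>

lemma conv_has_derivative:
  fixes W f :: "real ^ 'n::finite \<Rightarrow> 'a::{real_normed_field, banach, second_countable_topology}"
  assumes W: "Ck 1 W" and f: "integrable torus f"
  shows "((\<lambda>x. LINT y|torus. W (x - y) * f y) has_derivative
    (\<lambda>h. \<Sum>i\<in>UNIV. h $ i *\<^sub>R (LINT y|torus. pd i W (x - y) * f y))) (at x)"
  unfolding has_derivative_at_alt
proof (intro conjI allI impI)
  show "bounded_linear (\<lambda>h. \<Sum>i\<in>UNIV. h $ i *\<^sub>R (LINT y|torus. pd i W (x - y) * f y))"
    by (intro bounded_linear_sum bounded_linear_scaleR_const bounded_linear_vec_nth)
  have Wc: "continuous_on UNIV W" by (rule Ck_continuous[OF W])
  have Wd: "continuous_on UNIV (pd i W)" for i using W by simp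
  note int = integrable_conv[OF Wc f] integrable_conv[OF Wd f]
  fix e :: real assume e: "e > 0"
  define I where "I = (LINT y|torus. norm (f y))"
  have I: "I \<ge> 0" by (simp add: I_def integral_nonneg_AE)
  \<comment> \<open>Chosen so that CARD('n) e' I is at most e, the factor CARD('n) coming from
    \<open>taylor_first_order\<close>; I + 1 avoids a division by zero.\<close>
  define e' where "e' = e / (real CARD('n) * (I + 1))"
  have e': "e' > 0" using e I by (simp add: e'_def)
  have "\<forall>i. \<exists>d>0. \<forall>y\<in>cbox 0 (\<chi> i. 2 * pi). \<forall>h. norm h < d \<longrightarrow> norm (pd i W (x - y + h) - pd i W (x - y)) < e'"
    using cell_uniformly_continuous[OF Wd e'] by blast
  then obtain \<delta> where \<delta>: "\<And>i. \<delta> i > 0" "\<And>i y h. y \<in> cbox 0 (\<chi> i. 2 * pi) \<Longrightarrow> norm h < \<delta> i \<Longrightarrow>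
      norm (pd i W (x - y + h) - pd i W (x - y)) < e'"
    by metis
  define d where "d = Min (range \<delta>)"
  have d: "d > 0" "\<And>i. d \<le> \<delta> i" using \<delta>(1) by (auto simp: d_def)
  show "\<exists>d>0. \<forall>y. norm (y - x) < d \<longrightarrow>
      norm ((LINT z|torus. W (y - z) * f z) - (LINT z|torus. W (x - z) * f z) -
        (\<Sum>i\<in>UNIV. (y - x) $ i *\<^sub>R (LINT z|torus. pd i W (x - z) * f z))) \<le> e * norm (y - x)"
  proof (intro exI[of _ d] conjI allI impI)
    fix x' assume h: "norm (x' - x) < d"
    define h where "h = x' - x"
    define r where "r y = W (x - y + h) - W (x - y) - (\<Sum>i\<in>UNIV. h $ i *\<^sub>R pd i W (x - y))" for y
    have W': "W (x - y + h) = W (x' - y)" for y by (simp add: h_def algebra_simps)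
    have r_eq: "r y * f y = W (x' - y) * f y - W (x - y) * f y - (\<Sum>i\<in>UNIV. h $ i *\<^sub>R (pd i W (x - y) * f y))" for y
      by (simp add: r_def W' left_diff_distrib sum_distrib_right)
    have int_r: "integrable torus (\<lambda>y. r y * f y)"
      unfolding r_eq by (intro Bochner_Integration.integrable_diff Bochner_Integration.integrable_sum integrable_scaleR_right int)
    have "(LINT y|torus. W (x' - y) * f y) - (LINT y|torus. W (x - y) * f y) -
        (\<Sum>i\<in>UNIV. h $ i *\<^sub>R (LINT y|torus. pd i W (x - y) * f y)) = (LINT y|torus. r y * f y)"
      unfolding r_eq using int by (simp add: Bochner_Integration.integral_sum)
    also have "norm \<dots> \<le> (LINT y|torus. norm h * (real CARD('n) * e') * norm (f y))"
    proof (rule order_trans[OF integral_norm_bound integral_mono])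
      show "integrable torus (\<lambda>y. norm (r y * f y))" using int_r by simp
      show "integrable torus (\<lambda>y. norm h * (real CARD('n) * e') * norm (f y))" using f by simp
      fix y :: "real^'n" assume "y \<in> space torus"
      then have y: "y \<in> cbox 0 (\<chi> i. 2 * pi)" by (simp add: space_torus)
      have "norm (r y) \<le> norm h * (real CARD('n) * e')"
        unfolding r_def
      proof (rule taylor_first_order[OF W d(1)])
        fix i and k :: "real^'n" assume "norm k < d"
        then show "norm (pd i W (x - y + k) - pd i W (x - y)) \<le> e'"
          using \<delta>(2)[OF y, of k i] d(2)[of i] by simp
      qed (use e' h in \<open>auto simp: h_def\<close>)
      then show "norm (r y * f y) \<le> norm h * (real CARD('n) * e') * norm (f y)"
        unfolding norm_mult by (intro mult_right_mono) auto
    qed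
    also have "\<dots> = norm h * (e * (I / (I + 1)))"
      using I by (simp add: I_def[symmetric] e'_def)
    also have "\<dots> \<le> norm h * (e * 1)"
      using e I by (intro mult_left_mono) (auto simp: divide_le_eq)
    finally show "norm ((LINT z|torus. W (x' - z) * f z) - (LINT z|torus. W (x - z) * f z) -
        (\<Sum>i\<in>UNIV. (x' - x) $ i *\<^sub>R (LINT z|torus. pd i W (x - z) * f z))) \<le> e * norm (x' - x)"
      by (simp add: h_def mult.commute)
  qed (rule d)
qed

lemma pd_conv:
  fixes W f :: "real ^ 'n::finite \<Rightarrow> 'a::{real_normed_field, banach, second_countable_topology}"
  assumes "Ck 1 W" "integrable torus f"
  shows "pd i (\<lambda>x. LINT y|torus. W (x - y) * f y) = (\<lambda>x. LINT y|torus. pd i W (x - y) * f y)"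
proof
  fix x
  have "(\<Sum>j\<in>UNIV. (axis i 1 :: real^'n) $ j *\<^sub>R (LINT y|torus. pd j W (x - y) * f y)) = (LINT y|torus. pd i W (x - y) * f y)"
    by (simp add: axis_def if_distrib[of "\<lambda>c. c *\<^sub>R _"] cong: if_cong)
  then show "pd i (\<lambda>x. LINT y|torus. W (x - y) * f y) x = (LINT y|torus. pd i W (x - y) * f y)"
    using pd_eqI[OF conv_has_derivative[OF assms]] by metis
qed

lemma Ck_conv:
  fixes W f :: "real ^ 'n::finite \<Rightarrow> 'a::{real_normed_field, banach, second_countable_topology}"
  assumes f: "integrable torus f"
  shows "Ck k W \<Longrightarrow> Ck k (\<lambda>x. LINT y|torus. W (x - y) * f y)"
proof (induction k arbitrary: W)
  case 0
  then show ?case using conv_continuous[OF _ f] by simp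
next
  case (Suc k)
  have W1: "Ck 1 W" using Ck_le[OF Suc.prems, of 1] by simp
  have "Ck k (pd i W)" for i using Suc.prems by simp
  then have "Ck k (\<lambda>x. LINT y|torus. pd i W (x - y) * f y)" for i by (rule Suc.IH)
  moreover have "(\<lambda>x. LINT y|torus. W (x - y) * f y) differentiable (at x)" for x
    using conv_has_derivative[OF W1 f] unfolding differentiable_def by blast
  ultimately show ?case by (simp add: pd_conv[OF W1 f])
qed

lemma periodic_conv:
  assumes "periodic W"
  shows "periodic (\<lambda>x. LINT y|torus. W (x - y) * f y)"
proof -
  have "W (x + axis i (2 * pi) - y) = W (x - y)" for x i y
    using periodicD[OF assms, of "x - y" i] by (simp add: algebra_simps)
  then show ?thesis by (simp add: periodic_def)
qed

subsection \<open>Integration by parts\<close>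

text \<open>The argument is translation invariance: the integral of N (x - y) over y does not change
  when x moves in direction i, so its derivative there, the integral of a partial derivative,
  vanishes.\<close>

lemma integral_pd_eq_0:
  fixes F :: "real ^ 'n::finite \<Rightarrow> 'a::{real_normed_field, banach, second_countable_topology}"
  assumes F: "Ck 1 F" and per: "periodic F"
  shows "(LINT x|torus. pd i F x) = 0"
proof -
  \<comment> \<open>Reflection, because \<open>conv_has_derivative\<close> differentiates kernels
    evaluated at x - y.\<close>
  define N where "N x = F (- x)" for x
  have dN: "(N has_derivative (\<lambda>h. frechet_derivative F (at (- x)) (- h))) (at x)" for x
    unfolding N_def
    by (rule has_derivative_compose[of uminus uminus _ _ F])
       (use F in \<open>auto intro!: derivative_eq_intros differentiableD\<close>)
  have pdN: "pd j N x = - pd j F (- x)" for j x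
  proof -
    have "bounded_linear (frechet_derivative F (at (- x)))"
      using F by (intro has_derivative_bounded_linear[OF differentiableD]) simp
    then show ?thesis
      using pd_eqI[OF dN, of j x] linear_neg[OF bounded_linear.linear] by (simp add: pd_def)
  qed
  have N: "Ck 1 N"
  proof -
    have "N differentiable (at x)" for x using dN unfolding differentiable_def by blast
    moreover have "continuous_on UNIV (pd j N)" for j
    proof -
      have "continuous_on UNIV (\<lambda>x. - pd j F (- x))"
        using F by (intro continuous_on_minus continuous_on_compose2[of UNIV "pd j F" UNIV uminus]) (auto intro: continuous_intros)
      then show ?thesis by (simp add: pdN[abs_def])
    qed
    ultimately show ?thesis by simp
  qed
  have Nper: "periodic N"
    unfolding periodic_def
  proof (intro allI)
    fix x j show "N (x + axis j (2 * pi)) = N x"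
      using periodicD[OF per, of "- (x + axis j (2 * pi))" j] by (simp add: N_def)
  qed
  define G where "G x = (LINT y|torus. N (x - y) * 1)" for x
  have one: "integrable torus (\<lambda>y::real^'n. 1 :: 'a)" by (rule integrable_torus_continuous) simp
  have const: "G (axis i t) = G 0" if "0 \<le> t" "t \<le> 2 * pi" for t
  proof -
    have "(LINT y|torus. N (axis i t - (y + axis i t)) * 1) = (LINT y|torus. N (axis i t - y) * 1)"
    proof (rule integral_torus_shift[OF _ _ that])
      show "continuous_on UNIV (\<lambda>x. N (axis i t - x) * 1)"
        by (intro continuous_intros continuous_on_compose2[OF Ck_continuous[OF N]]) auto
      show "periodic (\<lambda>x. N (axis i t - x) * 1)"
        unfolding periodic_def
      proof (intro allI)
        fix x j show "N (axis i t - (x + axis j (2 * pi))) * 1 = N (axis i t - x) * 1"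
          using periodicD[OF Nper, of "axis i t - (x + axis j (2 * pi))" j] by (simp add: algebra_simps)
      qed
    qed
    then show ?thesis by (simp add: G_def algebra_simps)
  qed
  have ax: "(\<lambda>t. t *\<^sub>R (axis i 1 :: real^'n)) = axis i"
    by (rule ext) (simp add: vec_eq_iff axis_def)
  have "((\<lambda>t. t *\<^sub>R a) has_derivative (\<lambda>t. t *\<^sub>R a)) F" for a :: "real^'n" and F
    by (auto intro!: derivative_eq_intros)
  from this[of "axis i 1"] have ax_deriv: "(axis i has_derivative (axis i :: real \<Rightarrow> real^'n)) F" for F
    unfolding ax .
  have G': "(G has_derivative (\<lambda>h. \<Sum>j\<in>UNIV. h $ j *\<^sub>R (LINT y|torus. pd j N (x - y) * 1))) (at x)" for x
    unfolding G_def by (rule conv_has_derivative[OF N one])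
  have d1: "((\<lambda>t. G (axis i t)) has_derivative (\<lambda>s. \<Sum>j\<in>UNIV. (axis i s :: real^'n) $ j *\<^sub>R (LINT y|torus. pd j N (axis i pi - y) * 1))) (at pi)"
    by (rule has_derivative_compose[OF ax_deriv G'])
  \<comment> \<open>Invariance is established for shifts between 0 and 2 pi, so the derivative is
    taken at the interior point pi.\<close>
  have d2: "((\<lambda>t. G (axis i t)) has_derivative (\<lambda>s. 0)) (at pi)"
  proof (rule has_derivative_transform_within_open[of "\<lambda>t. G 0" _ _ _ "{0<..<2 * pi}"])
    fix t assume "t \<in> {0<..<2 * pi}"
    then show "G 0 = G (axis i t)" using const[of t] by simp
  qed auto
  from fun_cong[OF has_derivative_unique[OF d1 d2], of 1]
  have "(\<Sum>j\<in>UNIV. (axis i 1 :: real^'n) $ j *\<^sub>R (LINT y|torus. pd j N (axis i pi - y) * 1)) = 0" .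
  then have "(LINT y|torus. pd i N (axis i pi - y)) = 0"
    by (simp add: axis_def if_distrib[of "\<lambda>c. c *\<^sub>R _"] cong: if_cong)
  then have "(LINT y|torus. pd i F (y - axis i pi)) = 0"
    by (simp add: pdN)
  \<comment> \<open>A further shift by pi removes the displacement caused by differentiating at
    pi.\<close>
  moreover have "(LINT y|torus. pd i F (y - axis i pi)) = (LINT y|torus. pd i F ((y + axis i pi) - axis i pi))"
  proof (rule integral_torus_shift[symmetric])
    show "continuous_on UNIV (\<lambda>x. pd i F (x - axis i pi))"
      using F by (intro continuous_on_compose2[of UNIV "pd i F" UNIV "\<lambda>x. x - axis i pi"]) (auto intro: continuous_intros)
    have "periodic (pd i F)" using F per by (intro periodic_pd) auto
    then show "periodic (\<lambda>x. pd i F (x - axis i pi))"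
      unfolding periodic_def by (metis add_diff_eq diff_add_eq)
  qed auto
  ultimately show ?thesis by simp
qed

lemma periodic_mult: "periodic f \<Longrightarrow> periodic g \<Longrightarrow> periodic (\<lambda>x. f x * g x)"
  by (simp add: periodic_def)

lemma integration_by_parts:
  fixes f g :: "real ^ 'n::finite \<Rightarrow> 'a::{real_normed_field, banach, second_countable_topology}"
  assumes "Ck 1 f" "Ck 1 g" "periodic f" "periodic g"
  shows "(LINT x|torus. pd i f x * g x) = - (LINT x|torus. f x * pd i g x)"
proof -
  have c: "continuous_on UNIV f" "continuous_on UNIV g" "continuous_on UNIV (pd i f)" "continuous_on UNIV (pd i g)"
    using assms Ck_continuous[of 1 f] Ck_continuous[of 1 g] by auto
  have "0 = (LINT x|torus. pd i (\<lambda>x. f x * g x) x)"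
    by (intro integral_pd_eq_0[symmetric] Ck_mult periodic_mult assms)
  also have "\<dots> = (LINT x|torus. f x * pd i g x + pd i f x * g x)"
    using assms by (intro Bochner_Integration.integral_cong refl pd_mult) auto
  also have "\<dots> = (LINT x|torus. f x * pd i g x) + (LINT x|torus. pd i f x * g x)"
    by (intro Bochner_Integration.integral_add integrable_torus_continuous continuous_intros c)
  finally show ?thesis by (simp add: eq_neg_iff_add_eq_0 add.commute)
qed

section \<open>Fourier series\<close>

definition phase :: "int ^ 'n::finite \<Rightarrow> real ^ 'n \<Rightarrow> real" where
  "phase k x = (\<Sum>i\<in>UNIV. of_int (k $ i) * x $ i)"

definition fmode :: "int ^ 'n::finite \<Rightarrow> real ^ 'n \<Rightarrow> complex" where
  "fmode k x = cis (phase k x)"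

lemma phase_add: "phase (k + l) x = phase k x + phase l x"
  by (simp add: phase_def distrib_right sum.distrib)

lemma phase_uminus: "phase (- k) x = - phase k x"
  by (simp add: phase_def sum_negf)

lemma fmode_add: "fmode (k + l) x = fmode k x * fmode l x"
  by (simp add: fmode_def phase_add cis_mult)

lemma fmode_uminus: "fmode (- k) x = cnj (fmode k x)"
  by (simp add: fmode_def phase_uminus cis_cnj)

lemma fmode_zero [simp]: "fmode 0 x = 1"
  by (simp add: fmode_def phase_def)

lemma norm_fmode [simp]: "norm (fmode k x) = 1"
  by (simp add: fmode_def)

lemma fmode_axis: "fmode (axis i m) x = cis (of_int m * x $ i)"
proof -
  have "phase (axis i m) x = (\<Sum>j\<in>UNIV. if j = i then of_int m * x $ i else 0)"
    unfolding phase_def by (intro sum.cong) (auto simp: axis_def)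
  then show ?thesis by (simp add: fmode_def)
qed

lemma bounded_linear_phase: "bounded_linear (phase k)"
  unfolding phase_def[abs_def]
  by (intro bounded_linear_sum bounded_linear_compose[OF bounded_linear_mult_right bounded_linear_vec_nth])

lemma fmode_has_derivative:
  "(fmode k has_derivative (\<lambda>h. \<i> * of_real (phase k h) * fmode k x)) (at x)"
proof -
  have "((\<lambda>x. exp (\<i> * of_real (phase k x))) has_derivative
     (\<lambda>h. exp (\<i> * of_real (phase k x)) * (\<i> * of_real (phase k h)))) (at x)"
  proof (rule has_derivative_compose[of "\<lambda>x. \<i> * complex_of_real (phase k x)" _ _ _ exp "\<lambda>y. exp (\<i> * of_real (phase k x)) * y"])
    show "((\<lambda>x. \<i> * complex_of_real (phase k x)) has_derivative (\<lambda>h. \<i> * of_real (phase k h))) (at x)"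
      by (intro bounded_linear_imp_has_derivative bounded_linear_compose[OF bounded_linear_mult_right]
            bounded_linear_compose[OF bounded_linear_of_real] bounded_linear_phase)
    show "(exp has_derivative (*) (exp (\<i> * complex_of_real (phase k x)))) (at (\<i> * complex_of_real (phase k x)))"
      using DERIV_exp unfolding has_field_derivative_def by blast
  qed
  moreover have "(\<lambda>x. exp (\<i> * of_real (phase k x))) = fmode k"
    by (simp add: fun_eq_iff fmode_def cis_conv_exp)
  ultimately show ?thesis by (simp add: fmode_def cis_conv_exp mult.commute)
qed

lemma pd_fmode: "pd i (fmode k) x = \<i> * of_int (k $ i) * fmode k x"
proof -
  have "phase k (axis i 1) = (\<Sum>j\<in>UNIV. if j = i then of_int (k $ i) else 0)"
    unfolding phase_def by (intro sum.cong) (auto simp: axis_def)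
  then show ?thesis using pd_eqI[OF fmode_has_derivative, of i k x] by simp
qed

lemma fmode_differentiable: "fmode k differentiable (at x)"
  using fmode_has_derivative unfolding differentiable_def by blast

lemma Ck_fmode_mult: "Ck m (\<lambda>x. c * fmode k x)"
proof (induction m arbitrary: c)
  case 0
  have "continuous_on UNIV (fmode k)"
    using fmode_differentiable by (intro differentiable_imp_continuous_on) (auto simp: differentiable_on_def intro: differentiable_at_withinI)
  then show ?case by (auto intro!: continuous_intros)
next
  case (Suc m)
  have "pd i (\<lambda>x. c * fmode k x) = (\<lambda>x. (c * (\<i> * of_int (k $ i))) * fmode k x)" for i
  proof
    fix x
    have "pd i (\<lambda>x. c * fmode k x) x = c * pd i (fmode k) x"
      by (rule pd_linear[OF bounded_linear_mult_right fmode_differentiable])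
    then show "pd i (\<lambda>x. c * fmode k x) x = (c * (\<i> * of_int (k $ i))) * fmode k x"
      by (simp add: pd_fmode)
  qed
  moreover have "(\<lambda>x. c * fmode k x) differentiable (at x)" for x
    using bounded_linear.has_derivative[OF bounded_linear_mult_right fmode_has_derivative]
    unfolding differentiable_def by blast
  ultimately show ?case using Suc by simp
qed

lemma Ck_fmode: "Ck m (fmode k)"
  using Ck_fmode_mult[of m 1 k] by simp

lemma continuous_fmode: "continuous_on UNIV (fmode k)"
  by (rule Ck_continuous[OF Ck_fmode])

lemma periodic_fmode: "periodic (fmode k)"
  unfolding periodic_def
proof (intro allI)
  fix x :: "real ^ 'a" and i
  have "phase k (x + axis i (2 * pi)) = phase k x + (\<Sum>j\<in>UNIV. if j = i then of_int (k $ i) * (2 * pi) else 0)"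
    unfolding phase_def sum.distrib[symmetric]
    by (intro sum.cong) (auto simp: axis_def algebra_simps)
  then have "fmode k (x + axis i (2 * pi)) = cis (phase k x) * cis (2 * pi * of_int (k $ i))"
    by (simp add: fmode_def cis_mult mult.commute)
  moreover have "cis (2 * pi * of_int (k $ i)) = 1" by (rule cis_multiple_2pi) simp
  ultimately show "fmode k (x + axis i (2 * pi)) = fmode k x" by (simp add: fmode_def)
qed

lemma Lp2_fmode: "Lp 2 (\<lambda>x. c * fmode k x)"
  by (intro Lp2_cmult continuous_Lp2 continuous_fmode)

definition vol :: "'n::finite itself \<Rightarrow> real" where
  "vol _ = measure (torus :: (real ^ 'n) measure) (space torus)"

lemma vol_pos: "vol TYPE('n::finite) > 0"
proof -
  have "measure (torus :: (real ^ 'n) measure) (space torus) = measure lborel (cbox 0 (\<chi> i. 2 * pi) :: (real^'n) set)"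
    unfolding space_torus by (subst torus_def, subst measure_restrict_space) auto
  also have "\<dots> > 0"
    by (subst content_pos_lt_eq) (auto simp: Basis_vec_def inner_axis)
  finally show ?thesis by (simp add: vol_def)
qed

lemma integral_fmode: "(LINT x|torus. fmode k x) = (if k = 0 then of_real (vol TYPE('n::finite)) else 0)"
  for k :: "int ^ 'n"
proof (cases "k = 0")
  case True
  then show ?thesis by (simp add: vol_def scaleR_conv_of_real)
next
  case False
  then obtain i where i: "k $ i \<noteq> 0" by (auto simp: vec_eq_iff)
  have "0 = (LINT x|torus. pd i (fmode k) x)"
    by (rule integral_pd_eq_0[symmetric, OF Ck_fmode periodic_fmode])
  also have "\<dots> = \<i> * of_int (k $ i) * (LINT x|torus. fmode k x)"
    by (simp add: pd_fmode)
  finally show ?thesis using i False by simp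
qed

subsection \<open>Completeness of the trigonometric system\<close>

text \<open>If \<open>f\<close> is orthogonal to every \<open>fmode\<close>, the multipliers that preserve the property of being
  orthogonal to \<open>f\<close> together with all its \<open>fmode\<close>-multiples form an algebra closed under bounded
  pointwise limits; it therefore contains the indicators of boxes.\<close>

definition annihilates :: "(real ^ 'n::finite \<Rightarrow> complex) \<Rightarrow> (real ^ 'n \<Rightarrow> complex) \<Rightarrow> bool" where
  "annihilates f h \<longleftrightarrow> h \<in> borel_measurable torus \<and> (\<exists>B. \<forall>x\<in>space torus. norm (h x) \<le> B) \<and>
     (\<forall>k. (LINT x|torus. f x * h x * fmode k x) = 0)"

lemma integrable_mult_bounded:
  fixes f h :: "real ^ 'n::finite \<Rightarrow> complex"
  assumes "integrable torus f" "h \<in> borel_measurable torus" "\<And>x. x \<in> space torus \<Longrightarrow> norm (h x) \<le> B"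
  shows "integrable torus (\<lambda>x. f x * h x)"
proof (rule Bochner_Integration.integrable_bound)
  show "integrable torus (\<lambda>x. B * norm (f x))" using assms(1) by simp
  show "(\<lambda>x. f x * h x) \<in> borel_measurable torus"
    using assms by (intro borel_measurable_times) auto
  show "AE x in torus. norm (f x * h x) \<le> norm (B * norm (f x))"
  proof (rule AE_I2)
    fix x :: "real^'n" assume x: "x \<in> space torus"
    have "norm (f x * h x) \<le> norm (f x) * B"
      unfolding norm_mult by (intro mult_left_mono assms x) auto
    then show "norm (f x * h x) \<le> norm (B * norm (f x))"
      using order_trans[OF norm_ge_zero assms(3)[OF x]] by (simp add: mult.commute)
  qed
qed

lemma annihilates_integrable:
  assumes f: "integrable torus f" and h: "annihilates f h"
  shows "integrable torus (\<lambda>x. f x * h x * fmode k x)"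
proof -
  obtain B where "\<And>x. x \<in> space torus \<Longrightarrow> norm (h x) \<le> B" using h by (auto simp: annihilates_def)
  then have "integrable torus (\<lambda>x. f x * h x)"
    using h by (intro integrable_mult_bounded[OF f]) (auto simp: annihilates_def)
  then show ?thesis
    by (rule integrable_mult_bounded[where B = 1]) (auto intro: measurable_torus_continuous continuous_fmode)
qed

definition multiplier :: "(real ^ 'n::finite \<Rightarrow> complex) \<Rightarrow> (real ^ 'n \<Rightarrow> complex) \<Rightarrow> bool" where
  "multiplier f g \<longleftrightarrow> (\<forall>h. annihilates f h \<longrightarrow> annihilates f (\<lambda>x. g x * h x))"

lemma multiplier_mult: "multiplier f g \<Longrightarrow> multiplier f g' \<Longrightarrow> multiplier f (\<lambda>x. g x * g' x)"
  unfolding multiplier_def by (simp add: mult.assoc)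

lemma multiplier_fmode: "multiplier f (fmode k)"
  unfolding multiplier_def annihilates_def
proof (intro allI impI conjI)
  fix h l
  assume h: "h \<in> borel_measurable torus \<and> (\<exists>B. \<forall>x\<in>space torus. norm (h x) \<le> B) \<and>
     (\<forall>k. (LINT x|torus. f x * h x * fmode k x) = 0)"
  show "(\<lambda>x. fmode k x * h x) \<in> borel_measurable torus"
    using h borel_measurable_times[OF measurable_torus_continuous[OF continuous_fmode]] by blast
  show "\<exists>B. \<forall>x\<in>space torus. norm (fmode k x * h x) \<le> B"
    using h by (simp add: norm_mult)
  have "(\<lambda>x. f x * (fmode k x * h x) * fmode l x) = (\<lambda>x. f x * h x * fmode (k + l) x)"
    by (simp add: fmode_add mult_ac)
  then show "(LINT x|torus. f x * (fmode k x * h x) * fmode l x) = 0"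
    using h by simp
qed

lemma multiplier_const: "multiplier f (\<lambda>x. c)"
  unfolding multiplier_def annihilates_def
proof (intro allI impI conjI)
  fix h l
  assume h: "h \<in> borel_measurable torus \<and> (\<exists>B. \<forall>x\<in>space torus. norm (h x) \<le> B) \<and>
     (\<forall>k. (LINT x|torus. f x * h x * fmode k x) = 0)"
  show "(\<lambda>x. c * h x) \<in> borel_measurable torus" using h by auto
  obtain B where "\<forall>x\<in>space torus. norm (h x) \<le> B" using h by blast
  then show "\<exists>B. \<forall>x\<in>space torus. norm (c * h x) \<le> B"
    by (intro exI[of _ "norm c * B"]) (auto simp: norm_mult intro!: mult_left_mono)
  have "(\<lambda>x. f x * (c * h x) * fmode l x) = (\<lambda>x. c * (f x * h x * fmode l x))"
    by (simp add: mult_ac)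
  then show "(LINT x|torus. f x * (c * h x) * fmode l x) = 0"
    using h by simp
qed

lemma multiplier_add:
  assumes f: "integrable torus f" and g: "multiplier f g" "multiplier f g'"
  shows "multiplier f (\<lambda>x. g x + g' x)"
  unfolding multiplier_def
proof (intro allI impI)
  fix h assume "annihilates f h"
  then have a: "annihilates f (\<lambda>x. g x * h x)" "annihilates f (\<lambda>x. g' x * h x)"
    using g by (auto simp: multiplier_def)
  then obtain B B' where B: "\<And>x. x \<in> space torus \<Longrightarrow> norm (g x * h x) \<le> B"
    "\<And>x. x \<in> space torus \<Longrightarrow> norm (g' x * h x) \<le> B'"
    unfolding annihilates_def by blast
  have "norm (g x * h x + g' x * h x) \<le> B + B'" if "x \<in> space torus" for x
    by (rule norm_triangle_le[OF add_mono[OF B[OF that]]])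
  moreover have "(LINT x|torus. f x * (g x * h x + g' x * h x) * fmode k x) = 0" for k
    using annihilates_integrable[OF f a(1)] annihilates_integrable[OF f a(2)] a
    by (simp add: distrib_left distrib_right annihilates_def)
  ultimately show "annihilates f (\<lambda>x. (g x + g' x) * h x)"
    using a unfolding annihilates_def distrib_right by (auto intro!: borel_measurable_add)
qed

lemma multiplier_sum:
  assumes f: "integrable torus f"
  shows "(\<And>i. i \<in> I \<Longrightarrow> multiplier f (g i)) \<Longrightarrow> multiplier f (\<lambda>x. \<Sum>i\<in>I. g i x)"
  by (induction I rule: infinite_finite_induct) (auto intro: multiplier_const multiplier_add[OF f])

lemma multiplier_power: "multiplier f g \<Longrightarrow> multiplier f (\<lambda>x. g x ^ n)"
  by (induction n) (auto intro: multiplier_const multiplier_mult)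

lemma multiplier_cos:
  assumes f: "integrable torus f"
  shows "multiplier f (\<lambda>x. of_real (cos (x $ i - a)))"
proof -
  have "of_real (cos (x $ i - a)) = (cis (- a) / 2) * fmode (axis i 1) x + (cis a / 2) * fmode (axis i (- 1)) x" for x :: "real ^ 'a"
    by (simp add: fmode_axis complex_eq_iff cos_diff field_simps)
  then have "(\<lambda>x :: real ^ 'a. complex_of_real (cos (x $ i - a))) =
      (\<lambda>x. (cis (- a) / 2) * fmode (axis i 1) x + (cis a / 2) * fmode (axis i (- 1)) x)"
    by (rule ext)
  then show ?thesis
    by (simp only:) (intro multiplier_add[OF f] multiplier_mult multiplier_const multiplier_fmode)
qed

text \<open>Dominated convergence: since \<open>h\<close> is bounded by C, the function B C |f|
  dominates. Convergence at every point of the cell also makes the limiting product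
  measurable.\<close>

lemma multiplier_limit:
  assumes f: "integrable torus f" and g: "\<And>n :: nat. multiplier f (g n)"
    and B: "\<And>n x. x \<in> space torus \<Longrightarrow> norm (g n x) \<le> B"
    and lim: "\<And>x. x \<in> space torus \<Longrightarrow> (\<lambda>n. g n x) \<longlonglongrightarrow> g' x"
  shows "multiplier f g'"
  unfolding multiplier_def
proof (intro allI impI)
  fix h assume h: "annihilates f h"
  then obtain C where C: "\<And>x. x \<in> space torus \<Longrightarrow> norm (h x) \<le> C" by (auto simp: annihilates_def)
  have a: "annihilates f (\<lambda>x. g n x * h x)" for n using g h by (auto simp: multiplier_def)
  have B': "norm (g' x) \<le> B" if "x \<in> space torus" for x
    using lim[OF that] B[OF that] by (intro LIMSEQ_le_const2[OF tendsto_norm[OF lim[OF that]]]) auto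
  have fm: "f \<in> borel_measurable torus" using f by auto
  have hm: "h \<in> borel_measurable torus" using h by (simp add: annihilates_def)
  have m: "(\<lambda>x. g' x * h x) \<in> borel_measurable torus"
  proof (rule borel_measurable_LIMSEQ_metric[of "\<lambda>n x. g n x * h x"])
    show "(\<lambda>x. g n x * h x) \<in> borel_measurable torus" for n using a by (simp add: annihilates_def)
    show "(\<lambda>n. g n x * h x) \<longlonglongrightarrow> g' x * h x" if "x \<in> space torus" for x
      by (intro tendsto_intros lim that)
  qed
  have km: "fmode k \<in> borel_measurable torus" for k :: "int ^ 'a" by (intro measurable_torus_continuous continuous_fmode)
  have "(LINT x|torus. f x * (g' x * h x) * fmode k x) = 0" for k
  proof -
    have "(\<lambda>n. LINT x|torus. f x * (g n x * h x) * fmode k x) \<longlonglongrightarrow> (LINT x|torus. f x * (g' x * h x) * fmode k x)"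
    proof (rule integral_dominated_convergence)
      show "integrable torus (\<lambda>x. B * C * norm (f x))" using f by simp
      show "(\<lambda>x. f x * (g' x * h x) * fmode k x) \<in> borel_measurable torus"
        by (rule borel_measurable_times[OF borel_measurable_times[OF fm m] km])
      show "(\<lambda>x. f x * (g n x * h x) * fmode k x) \<in> borel_measurable torus" for n
      proof -
        have "(\<lambda>x. g n x * h x) \<in> borel_measurable torus" using a by (simp add: annihilates_def)
        then show ?thesis by (rule borel_measurable_times[OF borel_measurable_times[OF fm] km])
      qed
      show "AE x in torus. (\<lambda>n. f x * (g n x * h x) * fmode k x) \<longlonglongrightarrow> f x * (g' x * h x) * fmode k x"
        by (intro AE_I2 tendsto_intros lim)
      show "AE x in torus. norm (f x * (g n x * h x) * fmode k x) \<le> B * C * norm (f x)" for n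
      proof (rule AE_I2)
        fix x :: "real ^ 'a" assume x: "x \<in> space torus"
        have "norm (g n x) * norm (h x) \<le> B * C"
          using order_trans[OF norm_ge_zero B[OF x]] by (intro mult_mono B C x) auto
        then have "norm (f x) * (norm (g n x) * norm (h x)) \<le> norm (f x) * (B * C)"
          by (intro mult_left_mono) auto
        then show "norm (f x * (g n x * h x) * fmode k x) \<le> B * C * norm (f x)"
          by (simp add: norm_mult mult_ac)
      qed
    qed
    moreover have "(LINT x|torus. f x * (g n x * h x) * fmode k x) = 0" for n
      using a by (simp add: annihilates_def)
    ultimately show ?thesis by (simp add: LIMSEQ_const_iff)
  qed
  moreover have "norm (g' x * h x) \<le> B * C" if "x \<in> space torus" for x
    unfolding norm_mult using order_trans[OF norm_ge_zero B'[OF that]] by (intro mult_mono B' C that) auto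
  ultimately show "annihilates f (\<lambda>x. g' x * h x)"
    using m by (auto simp: annihilates_def)
qed

text \<open>Cosines are combinations of two modes, so polynomials in a cosine are multipliers.
  Weierstrass approximation on [-1, 1] extends this to continuous functions of the cosine.\<close>

lemma multiplier_continuous_cos:
  assumes f: "integrable torus f" and \<phi>: "continuous_on {-1..1} \<phi>"
  shows "multiplier f (\<lambda>x. of_real (\<phi> (cos (x $ i - a))))"
proof -
  have "\<exists>p. real_polynomial_function p \<and> (\<forall>s\<in>{-1..1}. \<bar>\<phi> s - p s\<bar> < inverse (real (Suc n)))" for n
    using Stone_Weierstrass_real_polynomial_function[of "{-1..1}" \<phi> "inverse (real (Suc n))"] \<phi>
    by (metis compact_Icc inverse_positive_iff_positive of_nat_0_less_iff zero_less_Suc)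
  then obtain p where p: "\<And>n. real_polynomial_function (p n)"
    "\<And>n s. s \<in> {-1..1} \<Longrightarrow> \<bar>\<phi> s - p n s\<bar> < inverse (real (Suc n))"
    by metis
  have mult: "multiplier f (\<lambda>x. of_real (p n (cos (x $ i - a))))" for n
  proof -
    obtain c N where "p n = (\<lambda>s. \<Sum>j\<le>N. c j * s ^ j)"
      using p(1)[of n] by (auto simp: real_polynomial_function_iff_sum)
    then show ?thesis
      by (auto intro!: multiplier_sum[OF f] multiplier_mult multiplier_const multiplier_power multiplier_cos[OF f])
  qed
  have "compact (\<phi> ` {-1..1})" by (intro compact_continuous_image \<phi>) simp
  then obtain C where C: "\<And>s. s \<in> {-1..1} \<Longrightarrow> \<bar>\<phi> s\<bar> \<le> C"
    using compact_imp_bounded bounded_iff by (metis imageI real_norm_def)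
  have cs: "cos t \<in> {-1..1}" for t :: real by simp
  show ?thesis
  proof (rule multiplier_limit[OF f mult])
    fix n and x :: "real ^ 'a"
    have "inverse (real (Suc n)) \<le> 1" by (simp add: field_simps)
    then show "norm (complex_of_real (p n (cos (x $ i - a)))) \<le> C + 1"
      using p(2)[OF cs, of "x $ i - a" n] C[OF cs, of "x $ i - a"] unfolding norm_of_real by linarith
    show "(\<lambda>n. complex_of_real (p n (cos (x $ i - a)))) \<longlonglongrightarrow> of_real (\<phi> (cos (x $ i - a)))"
    proof (rule tendsto_of_real)
      have "(\<lambda>n. p n (cos (x $ i - a)) - \<phi> (cos (x $ i - a))) \<longlonglongrightarrow> 0"
      proof (rule Lim_null_comparison[OF _ LIMSEQ_inverse_real_of_nat])
        show "\<forall>\<^sub>F n in sequentially. norm (p n (cos (x $ i - a)) - \<phi> (cos (x $ i - a))) \<le> inverse (real (Suc n))"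
          using p(2)[OF cs, of "x $ i - a"] by (intro always_eventually allI) (metis abs_minus_commute less_imp_le real_norm_def)
      qed
      then show "(\<lambda>n. p n (cos (x $ i - a))) \<longlonglongrightarrow> \<phi> (cos (x $ i - a))"
        by (simp add: LIM_zero_iff)
    qed
  qed
qed

text \<open>The ramps \<open>\<phi> n\<close> vanish up to r and equal 1 for large n at each point
  above r, so they converge pointwise to the indicator of an open arc.\<close>

lemma multiplier_arc:
  assumes f: "integrable torus f"
  shows "multiplier f (\<lambda>x. indicator {s. s > r} (cos (x $ i - a)))"
proof (rule multiplier_limit[OF f])
  define \<phi> where "\<phi> n s = min 1 (max 0 (real n * (s - r)))" for n s
  show "multiplier f (\<lambda>x. of_real (\<phi> n (cos (x $ i - a))))" for n
    by (rule multiplier_continuous_cos[OF f]) (auto simp: \<phi>_def intro!: continuous_intros)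
  fix x :: "real ^ 'a"
  show "norm (complex_of_real (\<phi> n (cos (x $ i - a)))) \<le> 1" for n by (simp add: \<phi>_def)
  let ?s = "cos (x $ i - a)"
  show "(\<lambda>n. complex_of_real (\<phi> n ?s)) \<longlonglongrightarrow> indicator {s. s > r} ?s"
  proof (cases "?s > r")
    case True
    obtain N where N: "real N * (?s - r) \<ge> 1"
      using reals_Archimedean3[of "?s - r"] True by (metis diff_gt_0_iff_gt less_imp_le)
    have "\<phi> n ?s = 1" if "n \<ge> N" for n
    proof -
      have "real N * (?s - r) \<le> real n * (?s - r)" using True that by (intro mult_right_mono) auto
      then show ?thesis using N by (simp add: \<phi>_def)
    qed
    then have "\<forall>\<^sub>F n in sequentially. complex_of_real (\<phi> n ?s) = 1"
      by (auto simp: eventually_sequentially)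
    then show ?thesis using True by (simp add: tendsto_eventually)
  next
    case False
    then have "real n * (?s - r) \<le> 0" for n by (intro mult_nonneg_nonpos) auto
    then have "\<phi> n ?s = 0" for n by (simp add: \<phi>_def)
    then show ?thesis using False by simp
  qed
qed

text \<open>Cosine decreases with the distance d from the midpoint as long as d \<le> pi. The
  distance may exceed pi, but it never exceeds 2 pi minus the half-length w, and there cos d = cos
  (2 pi - d) stays at most cos w.\<close>

lemma arc_iff:
  fixes x a b :: real
  assumes "0 \<le> a" "a < b" "b \<le> 2 * pi" "0 \<le> x" "x \<le> 2 * pi"
  shows "cos (x - (a + b) / 2) > cos ((b - a) / 2) \<longleftrightarrow> a < x \<and> x < b"
proof -
  define d where "d = \<bar>x - (a + b) / 2\<bar>"
  define w where "w = (b - a) / 2"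
  have w: "0 < w" "w \<le> pi" using assms by (auto simp: w_def)
  have d0: "d \<ge> 0" by (simp add: d_def)
  have d: "d \<le> 2 * pi - w" using assms by (auto simp: d_def w_def abs_if field_simps)
  have "cos (x - (a + b) / 2) = cos d" by (simp add: d_def)
  also have "cos d > cos w \<longleftrightarrow> d < w"
  proof (cases "d \<le> pi")
    case True
    show ?thesis
    proof (cases "d < w")
      case True
      then show ?thesis using cos_monotone_0_pi[OF d0 True w(2)] by simp
    next
      case False
      then show ?thesis using cos_monotone_0_pi_le[of w d] w \<open>d \<le> pi\<close> by simp
    qed
  next
    case False
    have "cos d = cos (2 * pi - d)" by (simp add: cos_diff)
    also have "\<dots> \<le> cos w" using d w False by (intro cos_monotone_0_pi_le) auto
    finally show ?thesis using False w by simp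
  qed
  finally have "cos (x - (a + b) / 2) > cos w \<longleftrightarrow> d < w" .
  then show ?thesis unfolding w_def d_def by (auto simp: abs_if field_simps split: if_splits)
qed

lemma AE_torus_component: "AE x in (torus :: (real ^ 'n::finite) measure). x $ i \<noteq> c"
proof -
  have "AE x in lborel. (x :: real ^ 'n) $ i \<noteq> c"
    using AE_lborel_inner_neq[of "axis i 1 :: real ^ 'n" c] by (simp add: inner_axis axis_in_Basis_iff)
  then show ?thesis
    unfolding torus_def by (subst AE_restrict_space_iff) auto
qed

lemma AE_torus_interior:
  "AE x in (torus :: (real ^ 'n::finite) measure). \<forall>i. 0 < x $ i \<and> x $ i < 2 * pi"
proof -
  have "AE x in torus. \<forall>i\<in>UNIV. (x :: real ^ 'n) $ i \<noteq> 0 \<and> x $ i \<noteq> 2 * pi"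
    by (rule AE_finite_allI) (auto intro: AE_conjI AE_torus_component)
  then show ?thesis
    using AE_space
  proof eventually_elim
    case (elim x)
    then show ?case by (auto simp: space_torus mem_box_cart order_less_le)
  qed
qed

lemma integral_box_eq_0:
  fixes f :: "real ^ 'n::finite \<Rightarrow> complex"
  assumes f: "integrable torus f" and zero: "\<And>k. (LINT x|torus. f x * fmode k x) = 0"
  shows "(LINT x|torus. f x * indicator (box a b) x) = 0"
proof -
  \<comment> \<open>The box is clipped to the cell, where intervals are arcs; for interior points of
    the cell membership does not change.\<close>
  define a' b' where "a' i = max (a $ i) 0" and "b' i = min (b $ i) (2 * pi)" for i
  have box: "AE x in torus. x \<in> box a b \<longleftrightarrow> (\<forall>i. a' i < x $ i \<and> x $ i < b' i)"
    using AE_torus_interior by eventually_elim (auto simp: mem_box_cart a'_def b'_def)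
  show ?thesis
  proof (cases "\<forall>i. a' i < b' i")
    case False
    then have "AE x in torus. f x * indicator (box a b) x = 0"
      using box by (auto elim!: eventually_mono simp: indicator_def intro: less_trans)
    then show ?thesis by (rule integral_eq_zero_AE)
  next
    case True
    define g where "g I x = (\<Prod>i\<in>I. indicator {s. s > cos ((b' i - a' i) / 2)} (cos (x $ i - (a' i + b' i) / 2)) :: complex)"
      for I and x :: "real ^ 'n"
    have mult: "multiplier f (g I)" for I
      unfolding g_def[abs_def]
      by (induction I rule: infinite_finite_induct) (auto intro!: multiplier_const multiplier_mult multiplier_arc[OF f])
    have "annihilates f (\<lambda>x. 1)"
      using zero by (auto simp: annihilates_def)
    with mult[of UNIV] have "annihilates f (\<lambda>x. g UNIV x * 1)"
      unfolding multiplier_def by blast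
    then have "\<forall>k. (LINT x|torus. f x * (g UNIV x * 1) * fmode k x) = 0" and gm: "g UNIV \<in> borel_measurable torus"
      by (simp_all add: annihilates_def)
    then have "(LINT x|torus. f x * (g UNIV x * 1) * fmode 0 x) = 0" by blast
    also have "(LINT x|torus. f x * (g UNIV x * 1) * fmode 0 x) = (LINT x|torus. f x * indicator (box a b) x)"
    proof (rule integral_cong_AE)
      show "(\<lambda>x. f x * (g UNIV x * 1) * fmode 0 x) \<in> borel_measurable torus"
        using f gm by auto
      show "(\<lambda>x. f x * indicator (box a b) x) \<in> borel_measurable torus"
        by (rule borel_measurable_times[OF borel_measurable_integrable[OF f] measurable_torus_borel]) simp
      show "AE x in torus. f x * (g UNIV x * 1) * fmode 0 x = f x * indicator (box a b) x"
        using box AE_space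
      proof eventually_elim
        case (elim x)
        have *: "cos (x $ i - (a' i + b' i) / 2) > cos ((b' i - a' i) / 2) \<longleftrightarrow> a' i < x $ i \<and> x $ i < b' i" for i
          using True elim(2) by (intro arc_iff) (auto simp: a'_def b'_def space_torus mem_box_cart)
        have "g UNIV x = indicator (box a b) x"
          unfolding g_def elim(1) indicator_def by (auto simp: * prod_zero_iff)
        then show ?case by simp
      qed
    qed
    finally show ?thesis .
  qed
qed

text \<open>Boxes are an intersection-stable generator of the Borel sets, and the sets over which
  \<open>f\<close> integrates to 0 are closed under complements and disjoint unions. So f integrates
  to 0 over every Borel set, and its real and imaginary parts vanish almost everywhere.\<close>

lemma AE_zero_of_fourier_zero:
  fixes f :: "real ^ 'n::finite \<Rightarrow> complex"
  assumes f: "integrable torus f" and zero: "\<And>k. (LINT x|torus. f x * fmode k x) = 0"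
  shows "AE x in torus. f x = 0"
proof -
  have int: "integrable torus (\<lambda>x. f x * indicator A x)" if "A \<in> sets borel" for A
    by (rule integrable_mult_bounded[OF f, where B = 1]) (use that in \<open>auto intro!: measurable_torus_borel simp: indicator_def\<close>)
  have borel0: "(LINT x|torus. f x * indicator A x) = 0" if "A \<in> sets borel" for A
  proof -
    let ?E = "range (\<lambda>(a, b). box a b :: (real ^ 'n) set)"
    have sb: "sets borel = sigma_sets UNIV ?E" by (simp add: borel_eq_box)
    have "Int_stable ?E" by (auto simp: Int_stable_def box_Int_box)
    moreover have "?E \<subseteq> Pow UNIV" by simp
    moreover have "A \<in> sigma_sets UNIV ?E" using that sb by simp
    ultimately show ?thesis
    proof (induction rule: sigma_sets_induct_disjoint)
      case (basic A)
      then show ?case using integral_box_eq_0[OF f zero] by auto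
    next
      case empty
      then show ?case by simp
    next
      case (compl A)
      have "(LINT x|torus. f x * indicator (UNIV - A) x) = (LINT x|torus. f x - f x * indicator A x)"
        by (rule Bochner_Integration.integral_cong) (auto simp: indicator_def)
      also have "\<dots> = (LINT x|torus. f x) - (LINT x|torus. f x * indicator A x)"
        using f int compl sb by (intro Bochner_Integration.integral_diff) auto
      \<comment> \<open>Frequency zero supplies the integral of f over the whole torus.\<close>
      also have "\<dots> = 0" using zero[of 0] compl by simp
      finally show ?case .
    next
      case (union A)
      have Ab: "A n \<in> sets borel" for n using union sb by auto
      have "(\<lambda>n. LINT x|torus. f x * indicator (\<Union>i<n. A i) x) \<longlonglongrightarrow> (LINT x|torus. f x * indicator (\<Union>i. A i) x)"
      proof (rule integral_dominated_convergence)
        show "integrable torus (\<lambda>x. norm (f x))" using f by simp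
        show "(\<lambda>x. f x * indicator (\<Union>i. A i) x) \<in> borel_measurable torus" using Ab by (intro borel_measurable_integrable int) auto
        show "(\<lambda>x. f x * indicator (\<Union>i<n. A i) x) \<in> borel_measurable torus" for n using Ab by (intro borel_measurable_integrable int) auto
        show "AE x in torus. (\<lambda>n. f x * indicator (\<Union>i<n. A i) x) \<longlonglongrightarrow> f x * indicator (\<Union>i. A i) x"
          by (intro AE_I2 tendsto_intros LIMSEQ_indicator_UN)
        show "AE x in torus. norm (f x * indicator (\<Union>i<n. A i) x) \<le> norm (f x)" for n
          by (intro AE_I2) (auto simp: indicator_def)
      qed
      moreover have "(LINT x|torus. f x * indicator (\<Union>i<n. A i) x) = 0" for n
      proof (induction n)
        case (Suc n)
        have "indicator (\<Union>i<Suc n. A i) x = (indicator (\<Union>i<n. A i) x + indicator (A n) x :: complex)" for x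
        proof -
          have "A i \<inter> A n = {}" if "i < n" for i
            using union(1) that by (auto simp: disjoint_family_on_def)
          then have "x \<in> A n \<Longrightarrow> \<forall>i<n. x \<notin> A i" by blast
          then show ?thesis by (cases "x \<in> A n") (auto simp: indicator_def less_Suc_eq)
        qed
        then have "(LINT x|torus. f x * indicator (\<Union>i<Suc n. A i) x) =
            (LINT x|torus. f x * indicator (\<Union>i<n. A i) x + f x * indicator (A n) x)"
          by (simp add: distrib_left)
        also have "\<dots> = (LINT x|torus. f x * indicator (\<Union>i<n. A i) x) + (LINT x|torus. f x * indicator (A n) x)"
          using Ab by (intro Bochner_Integration.integral_add int) auto
        finally show ?case using Suc union by simp
      qed simp
      ultimately show ?case by (simp add: LIMSEQ_const_iff)
    qed
  qed
  have part0: "AE x in torus. L (f x) = 0" if L: "bounded_linear L" for L :: "complex \<Rightarrow> real"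
  proof -
    have Li: "integrable torus (\<lambda>x. L (f x))" by (rule integrable_bounded_linear[OF L f])
    show ?thesis
    proof (rule density_unique_real[OF Li])
      show "integrable torus (\<lambda>x. 0 :: real)" by simp
      fix A :: "(real ^ 'n) set" assume A: "A \<in> sets torus"
      then have Ab: "A \<in> sets borel"
        by (auto simp: torus_def sets_restrict_space)
      have "(LINT x:A|torus. L (f x)) = (LINT x|torus. L (f x * indicator A x))"
        unfolding set_lebesgue_integral_def
        by (rule Bochner_Integration.integral_cong) (auto simp: indicator_def bounded_linear.linear[OF L] linear_0)
      also have "\<dots> = L (LINT x|torus. f x * indicator A x)"
        by (rule integral_bounded_linear[OF L int[OF Ab]])
      also have "\<dots> = 0" by (simp add: borel0[OF Ab] bounded_linear.linear[OF L] linear_0)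
      finally show "(LINT x:A|torus. L (f x)) = (LINT x:A|torus. 0)"
        by (simp add: set_lebesgue_integral_def)
    qed
  qed
  have "AE x in torus. Re (f x) = 0" "AE x in torus. Im (f x) = 0"
    by (rule part0[OF bounded_linear_Re], rule part0[OF bounded_linear_Im])
  then show ?thesis by eventually_elim (simp add: complex_eq_iff)
qed

subsection \<open>The orthonormal basis\<close>

text \<open>An arbitrary enumeration of the frequency lattice. Its order never matters; indices in
  \<open>nat\<close> give access to ordinary series.\<close>

definition freq :: "nat \<Rightarrow> int ^ 'n::finite" where
  "freq = from_nat_into UNIV"

lemma bij_freq: "bij (freq :: nat \<Rightarrow> int ^ 'n::finite)"
proof -
  have "infinite (UNIV :: (int ^ 'n) set)"
  proof
    assume "finite (UNIV :: (int ^ 'n) set)"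
    then have "finite (range (\<lambda>m. \<chi> i. m) :: (int ^ 'n) set)" by (rule finite_subset[rotated]) simp
    moreover have "inj (\<lambda>m. (\<chi> i. m) :: int ^ 'n)" by (auto simp: inj_def vec_eq_iff)
    ultimately have "finite (UNIV :: int set)" by (rule finite_imageD)
    then show False by simp
  qed
  then show ?thesis unfolding freq_def by (intro bij_betw_from_nat_into) auto
qed

definition basis :: "nat \<Rightarrow> 'n::finite L2" where
  "basis n = mk_L2 (\<lambda>x. of_real (1 / sqrt (vol TYPE('n))) * fmode (freq n) x)"

lemma cinner_basis: "cinner (basis m :: 'n::finite L2) (basis n) = (if m = n then 1 else 0)"
proof -
  let ?c = "complex_of_real (1 / sqrt (vol TYPE('n)))"
  have "cinner (basis m :: 'n L2) (basis n) =
      (LINT x|torus. ?c * fmode (freq m) (x :: real^'n) * cnj (?c * fmode (freq n) x))"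
    unfolding basis_def by (rule cinner_mk_L2[OF Lp2_fmode Lp2_fmode])
  also have "\<dots> = (LINT x|torus. ?c * ?c * fmode (freq m + - freq n) (x :: real^'n))"
    by (rule Bochner_Integration.integral_cong) (simp_all only: fmode_add fmode_uminus, simp)
  also have "\<dots> = ?c * ?c * (LINT x|torus. fmode (freq m + - freq n) (x :: real^'n))"
    by simp
  also have "\<dots> = ?c * ?c * (if m = n then of_real (vol TYPE('n)) else 0)"
    using bij_is_inj[OF bij_freq, THEN injD, of m n] by (auto simp: integral_fmode)
  also have "\<dots> = (if m = n then 1 else 0)"
    using vol_pos[where 'n = 'n] by (simp add: of_real_mult[symmetric] of_real_divide[symmetric] del: of_real_mult of_real_divide)
  finally show ?thesis .
qed

definition coef :: "'n::finite L2 \<Rightarrow> nat \<Rightarrow> complex" where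
  "coef u n = cinner u (basis n)"

lemma coef_add: "coef (u + v) n = coef u n + coef v n"
  by (simp add: coef_def cinner_add_left)

lemma coef_scaleC [simp]: "coef (c *\<^sub>C u) n = c * coef u n"
  by (simp add: coef_def)

lemma coef_scaleR [simp]: "coef (c *\<^sub>R u) n = of_real c * coef u n"
  by (simp add: scaleR_scaleC)

lemma coef_diff: "coef (u - v) n = coef u n - coef v n"
  by (simp add: coef_def cinner.diff_left)

lemma coef_sum: "coef (\<Sum>i\<in>I. u i) n = (\<Sum>i\<in>I. coef (u i) n)"
  by (simp add: coef_def cinner.sum_left)

lemma coef_mk_L2:
  fixes f :: "real ^ 'n::finite \<Rightarrow> complex"
  assumes "Lp 2 f"
  shows "coef (mk_L2 f) n = of_real (1 / sqrt (vol TYPE('n))) * (LINT x|torus. f x * fmode (- freq n) x)"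
  unfolding coef_def basis_def cinner_mk_L2[OF assms Lp2_fmode]
  by (simp add: fmode_uminus mult_ac)

lemma coef_eq_0_imp:
  assumes "\<And>n. coef u n = 0"
  shows "u = (0 :: 'n::finite L2)"
proof -
  have zero: "(LINT x|torus. rep_L2 u x * fmode k x) = 0" for k
  proof -
    \<comment> \<open>The sign is reversed because \<open>coef\<close> pairs with the conjugate of
      the mode.\<close>
    obtain n where n: "freq n = - k" using bij_is_surj[OF bij_freq] by (metis surjD)
    show ?thesis
      using assms[of n] coef_mk_L2[OF Lp2_rep, of u n] vol_pos[where 'n = 'n] by (simp add: n)
  qed
  have "AE x in torus. rep_L2 u x = 0"
    by (rule AE_zero_of_fourier_zero[OF Lp2_integrable[OF Lp2_rep] zero])
  then have "mk_L2 (rep_L2 u) = mk_L2 (\<lambda>x. 0)"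
    by (subst mk_L2_eq_iff) (auto simp: Lp2_rep Lp2_zero)
  then show ?thesis by (simp add: zero_L2_def)
qed

lemma coef_inject: "(\<And>n. coef u n = coef v n) \<Longrightarrow> u = v"
  using coef_eq_0_imp[of "u - v"] by (simp add: coef_diff)

lemma coef_partial_sum: "coef (\<Sum>k<N. c k *\<^sub>C basis k) n = (if n < N then c n else 0)"
  by (simp add: coef_sum) (simp add: coef_def cinner_basis if_distrib cong: if_cong)

lemma norm_basis_sum:
  "finite I \<Longrightarrow> (norm (\<Sum>k\<in>I. c k *\<^sub>C (basis k :: 'n::finite L2)))\<^sup>2 = (\<Sum>k\<in>I. (norm (c k))\<^sup>2)"
proof -
  assume I: "finite I"
  have "of_real ((norm (\<Sum>k\<in>I. c k *\<^sub>C (basis k :: 'n L2)))\<^sup>2) = (\<Sum>k\<in>I. c k * cnj (c k))"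
    unfolding cinner_self[symmetric] cinner.sum_left cinner.sum_right
    using I by (simp add: cinner_basis if_distrib mult.commute cong: if_cong)
  also have "\<dots> = of_real (\<Sum>k\<in>I. (norm (c k))\<^sup>2)"
    by (simp only: of_real_sum complex_norm_square)
  finally show ?thesis by (simp only: of_real_eq_iff)
qed

lemma bessel: "(\<Sum>k<N. (norm (coef u k))\<^sup>2) \<le> (norm (u :: 'n::finite L2))\<^sup>2"
proof -
  define p where "p = (\<Sum>k<N. coef u k *\<^sub>C (basis k :: 'n L2))"
  have "cinner u p = (\<Sum>k<N. cnj (coef u k) * coef u k)"
    by (simp add: p_def cinner.sum_right coef_def)
  also have "\<dots> = of_real (\<Sum>k<N. (norm (coef u k))\<^sup>2)"
    by (simp only: of_real_sum complex_norm_square mult.commute)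
  finally have "cinner u p = of_real ((norm p)\<^sup>2)"
    by (simp only: p_def norm_basis_sum finite_lessThan)
  then have "inner u p = (norm p)\<^sup>2" by (simp add: inner_L2_def)
  then have "(norm (u - p))\<^sup>2 = (norm u)\<^sup>2 - (norm p)\<^sup>2"
    by (simp add: power2_norm_eq_inner inner_diff inner_commute)
  then have "(norm p)\<^sup>2 \<le> (norm u)\<^sup>2" using zero_le_power2[of "norm (u - p)"] by linarith
  then show ?thesis by (simp add: p_def norm_basis_sum)
qed

lemma summable_coef: "summable (\<lambda>n. (norm (coef u n))\<^sup>2)"
  by (rule bounded_imp_summable[of _ "(norm u)\<^sup>2"]) (auto intro: bessel[of _ "Suc _", simplified lessThan_Suc_atMost])

lemma riesz_fischer:
  assumes c: "summable (\<lambda>n. (norm (c n))\<^sup>2)"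
  shows "\<exists>u :: 'n::finite L2. (\<forall>n. coef u n = c n) \<and> (\<lambda>N. \<Sum>k<N. c k *\<^sub>C basis k) \<longlonglongrightarrow> u"
proof -
  define p where "p N = (\<Sum>k<N. c k *\<^sub>C basis k :: 'n L2)" for N
  have diff: "(norm (p n - p m))\<^sup>2 = norm (\<Sum>k=m..<n. (norm (c k))\<^sup>2)" if "m \<le> n" for m n
  proof -
    have "p n = p m + (\<Sum>k=m..<n. c k *\<^sub>C basis k)"
      unfolding p_def lessThan_atLeast0 using that by (intro sum.atLeastLessThan_concat[symmetric]) auto
    then show ?thesis by (simp add: norm_basis_sum sum_nonneg)
  qed
  have "Cauchy p"
  proof (rule metric_CauchyI)
    fix e :: real assume e: "e > 0"
    then have "e\<^sup>2 > 0" by simp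
    then have "\<exists>N. \<forall>m\<ge>N. \<forall>n. norm (\<Sum>k=m..<n. (norm (c k))\<^sup>2) < e\<^sup>2"
      using c[unfolded summable_Cauchy, rule_format] by blast
    then obtain N where N: "\<And>m n. m \<ge> N \<Longrightarrow> norm (\<Sum>k=m..<n. (norm (c k))\<^sup>2) < e\<^sup>2"
      by blast
    have lt: "dist (p n) (p m) < e" if "m \<ge> N" "m \<le> n" for m n
    proof -
      have "(dist (p n) (p m))\<^sup>2 < e\<^sup>2" using N[OF that(1), of n] diff[OF that(2)] by (simp add: dist_norm)
      then show ?thesis by (rule power2_less_imp_less) (use e in simp)
    qed
    show "\<exists>M. \<forall>m\<ge>M. \<forall>n\<ge>M. dist (p m) (p n) < e"
    proof (intro exI[of _ N] allI impI)
      fix m n assume "m \<ge> N" "n \<ge> N"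
      then show "dist (p m) (p n) < e"
        using lt[of m n] lt[of n m] by (cases "m \<le> n") (auto simp: dist_commute)
    qed
  qed
  then obtain u where u: "p \<longlonglongrightarrow> u" by (auto simp: Cauchy_convergent_iff convergent_def)
  have "coef u n = c n" for n
  proof -
    have "(\<lambda>N. coef (p N) n) \<longlonglongrightarrow> coef u n"
      unfolding coef_def by (intro cinner.tendsto u tendsto_const)
    moreover have "\<forall>\<^sub>F N in sequentially. coef (p N) n = c n"
      using eventually_gt_at_top[of n] by eventually_elim (simp add: p_def coef_partial_sum)
    ultimately show ?thesis
      by (metis tendsto_eventually LIMSEQ_unique)
  qed
  with u show ?thesis unfolding p_def[abs_def] by blast
qed

lemma fourier_expansion: "(\<lambda>N. \<Sum>k<N. coef u k *\<^sub>C basis k) \<longlonglongrightarrow> u"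
  using riesz_fischer[OF summable_coef[of u]] coef_inject by metis

lemma parseval: "(\<lambda>n. coef u n * cnj (coef v n)) sums cinner u v"
proof -
  have "(\<lambda>N. cinner (\<Sum>k<N. coef u k *\<^sub>C basis k) v) \<longlonglongrightarrow> cinner u v"
    by (intro cinner.tendsto fourier_expansion tendsto_const)
  moreover have "cinner (basis k) v = cnj (coef v k)" for k
    by (simp add: coef_def) (rule cinner_commute)
  ultimately show ?thesis by (simp add: sums_def cinner.sum_left)
qed

lemma parseval_norm: "(\<lambda>n. (norm (coef u n))\<^sup>2) sums (norm u)\<^sup>2"
proof -
  have "(\<lambda>n. Re (coef u n * cnj (coef u n))) sums Re (cinner u u)"
    by (rule sums_Re[OF parseval])
  moreover have "Re (coef u n * cnj (coef u n)) = (norm (coef u n))\<^sup>2" for n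
    by (simp only: complex_norm_square[symmetric] Re_complex_of_real)
  ultimately show ?thesis by (simp only: cinner_self Re_complex_of_real)
qed

lemma infinite_dimensional:
  fixes B :: "'n::finite L2 set"
  assumes "finite B"
  shows "cvec.span B \<noteq> UNIV"
proof
  assume UNIV: "cvec.span B = UNIV"
  have inj: "inj (basis :: nat \<Rightarrow> 'n L2)"
  proof (rule injI)
    fix m n assume "(basis m :: 'n L2) = basis n"
    then have "cinner (basis m :: 'n L2) (basis n) = 1" by (simp add: cinner_basis)
    then show "m = n" by (simp add: cinner_basis split: if_splits)
  qed
  define N where "N = Suc (card B)"
  have "cvec.independent (basis ` {..<N} :: 'n L2 set)"
  proof (rule cvec.independent_if_scalars_zero)
    fix f :: "'n L2 \<Rightarrow> complex" and x :: "'n L2"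
    assume z: "(\<Sum>x\<in>basis ` {..<N}. f x *\<^sub>C x) = 0" and "x \<in> basis ` {..<N}"
    then obtain k where k: "k < N" "x = basis k" by auto
    have "(\<Sum>j<N. f (basis j) *\<^sub>C (basis j :: 'n L2)) = 0"
    proof -
      have "(\<Sum>x\<in>basis ` {..<N}. f x *\<^sub>C x) = (\<Sum>j<N. f (basis j) *\<^sub>C (basis j :: 'n L2))"
        by (rule sum.reindex_cong[OF inj_on_subset[OF inj subset_UNIV]]) auto
      with z show ?thesis by simp
    qed
    then have "coef (\<Sum>j<N. f (basis j) *\<^sub>C basis j :: 'n L2) k = 0"
      by (simp add: coef_def cinner.zero_left)
    then show "f x = 0" using k by (simp add: coef_partial_sum)
  qed simp
  then have "card (basis ` {..<N} :: 'n L2 set) \<le> card B"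
    using cvec.independent_span_bound[OF assms] UNIV by blast
  moreover have "card (basis ` {..<N} :: 'n L2 set) = N"
    by (subst card_image[OF inj_on_subset[OF inj subset_UNIV]]) simp
  ultimately show False by (simp add: N_def)
qed

section \<open>Sobolev spaces in terms of Fourier coefficients\<close>

lemma coef_zero: "coef 0 n = 0"
  by (simp add: coef_def cinner.zero_left)

lemma integrable_continuous_mult:
  fixes f g :: "real ^ 'n::finite \<Rightarrow> complex"
  assumes "Lp 2 f" "continuous_on UNIV g"
  shows "integrable torus (\<lambda>x. g x * f x)"
  using Lp2_integrable_mult[OF assms(1), of "\<lambda>x. cnj (g x)"] assms(2)
  by (auto intro!: continuous_Lp2 continuous_intros simp: mult.commute)

lemma coef_mk_L2_pd:
  fixes F :: "real ^ 'n::finite \<Rightarrow> complex"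
  assumes "Ck 1 F" "periodic F"
  shows "coef (mk_L2 (pd i F)) n = \<i> * of_int (freq n $ i) * coef (mk_L2 F) n"
proof -
  have c: "continuous_on UNIV F" "continuous_on UNIV (pd i F)"
    using assms Ck_continuous[of 1 F] by auto
  have "(LINT x|torus. pd i F x * fmode (- freq n) x) = - (LINT x|torus. F x * pd i (fmode (- freq n)) x)"
    by (rule integration_by_parts[OF assms(1) Ck_fmode assms(2) periodic_fmode])
  also have "\<dots> = - (LINT x|torus. (- \<i> * of_int (freq n $ i)) * (F x * fmode (- freq n) x))"
    by (simp add: pd_fmode mult_ac)
  also have "\<dots> = \<i> * of_int (freq n $ i) * (LINT x|torus. F x * fmode (- freq n) x)"
    by (subst integral_mult_right_zero) simp
  finally show ?thesis
    by (simp add: coef_mk_L2 continuous_Lp2 c)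
qed

lemma test_function_part:
  fixes L :: "complex \<Rightarrow> real"
  assumes "bounded_linear L"
  shows "test_function (\<lambda>x. L (fmode k x))"
  unfolding test_function_def using Ck_linear[OF assms Ck_fmode] periodic_fmode[of k] by (auto simp: periodic_def)

text \<open>Weak differentiation is a Fourier multiplier. Forwards, test functions are real, so the
  real and imaginary parts of a mode are tested separately and recombined. Backwards, Parseval
  transfers the relation between coefficients to any test function, whose classical derivative obeys
  the same rule.\<close>

lemma has_weak_pd_iff:
  fixes f g :: "real ^ 'n::finite \<Rightarrow> complex"
  assumes f: "Lp 2 f" and g: "Lp 2 g"
  shows "has_weak_pd i f g \<longleftrightarrow> (\<forall>n. coef (mk_L2 g) n = \<i> * of_int (freq n $ i) * coef (mk_L2 f) n)"
proof
  assume w: "has_weak_pd i f g"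
  show "\<forall>n. coef (mk_L2 g) n = \<i> * of_int (freq n $ i) * coef (mk_L2 f) n"
  proof
    fix n
    define k where "k = - (freq n :: int ^ 'n)"
    have part: "(LINT x|torus. of_real (L (pd i (fmode k) x)) * f x) = - (LINT x|torus. of_real (L (fmode k x)) * g x)"
      if L: "bounded_linear L" for L
    proof -
      have "(LINT x|torus. pd i (\<lambda>x. L (fmode k x)) x *\<^sub>R f x) = - (LINT x|torus. L (fmode k x) *\<^sub>R g x)"
        using w test_function_part[OF L] unfolding has_weak_pd_def by blast
      moreover have "pd i (\<lambda>x. L (fmode k x)) x = L (pd i (fmode k) x)" for x
        by (rule pd_linear[OF L fmode_differentiable])
      ultimately show ?thesis by (simp add: scaleR_conv_of_real)
    qed
    have split: "(LINT x|torus. F x * h x) =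
        (LINT x|torus. of_real (Re (F x)) * h x) + \<i> * (LINT x|torus. of_real (Im (F x)) * h x)"
      if F: "continuous_on UNIV F" and h: "Lp 2 h" for F h :: "real ^ 'n \<Rightarrow> complex"
    proof -
      have "(LINT x|torus. F x * h x) = (LINT x|torus. of_real (Re (F x)) * h x + \<i> * (of_real (Im (F x)) * h x))"
        by (rule Bochner_Integration.integral_cong[OF refl]) (simp add: complex_eq_iff algebra_simps)
      also have "\<dots> = (LINT x|torus. of_real (Re (F x)) * h x) + (LINT x|torus. \<i> * (of_real (Im (F x)) * h x))"
        using F by (intro Bochner_Integration.integral_add integrable_mult_right integrable_continuous_mult[OF h] continuous_intros)
      finally show ?thesis by simp
    qed
    have cf: "continuous_on UNIV (fmode k)" "continuous_on UNIV (pd i (fmode k))"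
      using Ck_fmode[of 1 k] Ck_continuous[of 1 "fmode k"] by auto
    have "(LINT x|torus. pd i (fmode k) x * f x) = - (LINT x|torus. fmode k x * g x)"
      unfolding split[OF cf(2) f] split[OF cf(1) g] part[OF bounded_linear_Re] part[OF bounded_linear_Im] by simp
    then have "(LINT x|torus. fmode k x * g x) = - (LINT x|torus. (\<i> * of_int (k $ i)) * (fmode k x * f x))"
      by (simp add: pd_fmode mult_ac)
    also have "\<dots> = \<i> * of_int (freq n $ i) * (LINT x|torus. fmode k x * f x)"
      by (subst integral_mult_right_zero) (simp add: k_def)
    finally show "coef (mk_L2 g) n = \<i> * of_int (freq n $ i) * coef (mk_L2 f) n"
      by (simp add: coef_mk_L2 f g k_def[symmetric] mult.commute[of _ "fmode k _"])
  qed
next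
  assume c: "\<forall>n. coef (mk_L2 g) n = \<i> * of_int (freq n $ i) * coef (mk_L2 f) n"
  show "has_weak_pd i f g"
    unfolding has_weak_pd_def
  proof (intro conjI allI impI)
    show "integrable torus f" "integrable torus g" using f g by (auto intro: Lp2_integrable)
    fix \<psi> :: "real ^ 'n \<Rightarrow> real" assume t: "test_function \<psi>"
    define F where "F x = complex_of_real (\<psi> x)" for x
    have \<psi>: "Ck 1 \<psi>" "periodic \<psi>" using t by (auto simp: test_function_def)
    have F: "Ck 1 F" "periodic F"
      unfolding F_def[abs_def] using Ck_linear[OF bounded_linear_of_real \<psi>(1)] \<psi>(2) by (auto simp: periodic_def)
    have pdF: "pd i F x = of_real (pd i \<psi> x)" for x
      unfolding F_def[abs_def] using \<psi>(1) by (intro pd_linear[OF bounded_linear_of_real]) simp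
    have L: "Lp 2 F" "Lp 2 (pd i F)"
      using F Ck_continuous[OF F(1)] by (auto intro!: continuous_Lp2)
    have "(LINT x|torus. pd i \<psi> x *\<^sub>R f x) = cinner (mk_L2 f) (mk_L2 (pd i F))"
      by (simp add: cinner_mk_L2 f L pdF scaleR_conv_of_real mult.commute)
    moreover have "(LINT x|torus. \<psi> x *\<^sub>R g x) = cinner (mk_L2 g) (mk_L2 F)"
      by (simp add: cinner_mk_L2 g L scaleR_conv_of_real mult.commute F_def)
    moreover have "cinner (mk_L2 f) (mk_L2 (pd i F)) = - cinner (mk_L2 g) (mk_L2 F)"
    proof (rule sums_unique2[OF parseval])
      have "(\<lambda>n. coef (mk_L2 f) n * cnj (coef (mk_L2 (pd i F)) n)) = (\<lambda>n. - (coef (mk_L2 g) n * cnj (coef (mk_L2 F) n)))"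
        by (simp add: coef_mk_L2_pd[OF F] c mult_ac)
      then show "(\<lambda>n. coef (mk_L2 f) n * cnj (coef (mk_L2 (pd i F)) n)) sums - cinner (mk_L2 g) (mk_L2 F)"
        using sums_minus[OF parseval[of "mk_L2 g" "mk_L2 F"]] by (simp only:)
    qed
    ultimately show "(LINT x|torus. pd i \<psi> x *\<^sub>R f x) = - (LINT x|torus. \<psi> x *\<^sub>R g x)"
      by (simp only:)
  qed
qed

lemma weak_pd_eqI:
  assumes "\<And>n. coef w n = \<i> * of_int (freq n $ i) * coef u n"
  shows "weak_pd i u = w"
  unfolding weak_pd_def
proof (rule the_equality)
  show "has_weak_pd i (rep_L2 u) (rep_L2 w)"
    using assms by (simp add: has_weak_pd_iff Lp2_rep)
  fix w' assume "has_weak_pd i (rep_L2 u) (rep_L2 w')"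
  then show "w' = w"
    using assms by (intro coef_inject) (simp add: has_weak_pd_iff Lp2_rep)
qed

text \<open>The symbol \<open>|k|\<^sup>2\<close> of minus the Laplacian; the type argument fixes
  the dimension, which the index alone does not determine.\<close>

definition freq_sq :: "'n::finite itself \<Rightarrow> nat \<Rightarrow> real" where
  "freq_sq _ n = (\<Sum>i\<in>UNIV. (of_int ((freq n :: int ^ 'n) $ i))\<^sup>2)"

lemma freq_sq_nonneg: "0 \<le> freq_sq T n"
  by (simp add: freq_sq_def sum_nonneg)

lemma H2_coef_weak_lap:
  fixes u :: "'n::finite L2"
  assumes u: "u \<in> H2"
  shows "coef (weak_lap u) n = - of_real (freq_sq TYPE('n) n) * coef u n"
proof -
  have *: "coef (weak_pd i (weak_pd i u)) n = - (of_int (freq n $ i))\<^sup>2 * coef u n" for i n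
  proof -
    obtain g h where g: "has_weak_pd i (rep_L2 u) g" "Lp 2 g" and h: "has_weak_pd i g h" "Lp 2 h"
      using u unfolding H2_def numeral_2_eq_2 sobolev.simps mem_Collect_eq by blast
    have "weak_pd i u = mk_L2 g"
      using g by (intro weak_pd_eqI) (simp add: has_weak_pd_iff Lp2_rep)
    moreover have "weak_pd i (mk_L2 g) = mk_L2 h"
      using g h by (intro weak_pd_eqI) (simp add: has_weak_pd_iff)
    ultimately show ?thesis
      using g h by (simp add: has_weak_pd_iff Lp2_rep power2_eq_square mult_ac)
  qed
  show ?thesis
    by (simp add: weak_lap_def coef_sum * freq_sq_def sum_distrib_right sum_negf)
qed

text \<open>Riesz-Fischer under a two-term bound, as it arises when first derivatives are controlled
  by u together with its Laplacian; taking g = 0 covers a single bounding function.\<close>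

lemma ex_coef_bounded:
  fixes f g :: "'n::finite L2"
  assumes "\<And>n. norm (c n) \<le> norm (coef f n) + norm (coef g n)"
  shows "\<exists>u :: 'n L2. \<forall>n. coef u n = c n"
proof -
  have "summable (\<lambda>n. (norm (c n))\<^sup>2)"
  proof (rule summable_comparison_test)
    show "summable (\<lambda>n. 2 * (norm (coef f n))\<^sup>2 + 2 * (norm (coef g n))\<^sup>2)"
      by (intro summable_add summable_mult summable_coef)
    have "norm ((norm (c n))\<^sup>2) \<le> 2 * (norm (coef f n))\<^sup>2 + 2 * (norm (coef g n))\<^sup>2" for n
    proof -
      have "(norm (c n))\<^sup>2 \<le> (norm (coef f n) + norm (coef g n))\<^sup>2"
        by (intro power_mono assms) auto
      also have "\<dots> \<le> 2 * (norm (coef f n))\<^sup>2 + 2 * (norm (coef g n))\<^sup>2"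
        using sum_squares_bound[of "norm (coef f n)" "norm (coef g n)"] by (simp add: power2_sum)
      finally show ?thesis by simp
    qed
    then show "\<exists>N. \<forall>n\<ge>N. norm ((norm (c n))\<^sup>2) \<le> 2 * (norm (coef f n))\<^sup>2 + 2 * (norm (coef g n))\<^sup>2" by blast
  qed
  then show ?thesis using riesz_fischer by blast
qed

lemma freq_component_le: "(of_int ((freq n :: int ^ 'n::finite) $ i))\<^sup>2 \<le> freq_sq TYPE('n) n"
  unfolding freq_sq_def by (rule member_le_sum) auto

text \<open>Elliptic regularity on the torus: |k_i k_j| is at most \<open>|k|\<^sup>2\<close>, so
  one L2 candidate for the Laplacian bounds all second derivatives, mixed ones included, and |k_i|
  \<le> 1 + \<open>|k|\<^sup>2\<close> handles the first ones.\<close>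

lemma H2I:
  fixes u w :: "'n::finite L2"
  assumes w: "\<And>n. coef w n = - of_real (freq_sq TYPE('n) n) * coef u n"
  shows "u \<in> H2"
proof -
  let ?k = "\<lambda>n i. real_of_int ((freq n :: int ^ 'n) $ i)"
  have nw: "norm (coef w n) = freq_sq TYPE('n) n * norm (coef u n)" for n
    by (simp add: w norm_mult freq_sq_nonneg)
  have prod_le: "\<bar>?k n i\<bar> * \<bar>?k n j\<bar> \<le> freq_sq TYPE('n) n" for n and i j :: 'n
  proof -
    have "2 * (\<bar>?k n i\<bar> * \<bar>?k n j\<bar>) \<le> (?k n i)\<^sup>2 + (?k n j)\<^sup>2"
      using sum_squares_bound[of "\<bar>?k n i\<bar>" "\<bar>?k n j\<bar>"] by simp
    then show ?thesis
      using freq_component_le[of n i] freq_component_le[of n j] by linarith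
  qed
  have "\<exists>g :: 'n L2. \<forall>n. coef g n = \<i> * of_int (freq n $ i) * coef u n" for i :: 'n
  proof (rule ex_coef_bounded)
    fix n
    have "\<bar>?k n i\<bar> \<le> 1 + freq_sq TYPE('n) n"
    proof (cases "\<bar>?k n i\<bar> \<le> 1")
      case False
      then have "\<bar>?k n i\<bar> * 1 \<le> \<bar>?k n i\<bar> * \<bar>?k n i\<bar>" by (intro mult_left_mono) auto
      then show ?thesis using prod_le[of n i i] by simp
    next
      case True
      then show ?thesis using freq_sq_nonneg[of "TYPE('n)" n] by linarith
    qed
    then have "\<bar>?k n i\<bar> * norm (coef u n) \<le> (1 + freq_sq TYPE('n) n) * norm (coef u n)"
      by (intro mult_right_mono) auto
    then show "norm (\<i> * of_int (freq n $ i) * coef u n) \<le> norm (coef u n) + norm (coef w n)"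
      by (simp add: norm_mult nw algebra_simps)
  qed
  then obtain g :: "'n \<Rightarrow> 'n L2" where g: "\<And>i n. coef (g i) n = \<i> * of_int (freq n $ i) * coef u n"
    by metis
  have ex: "\<exists>h :: 'n L2. \<forall>n. coef h n = \<i> * of_int (freq n $ j) * coef (g i) n" for i j :: 'n
  proof (rule ex_coef_bounded[where g = 0])
    fix n
    have "\<bar>?k n j\<bar> * \<bar>?k n i\<bar> * norm (coef u n) \<le> freq_sq TYPE('n) n * norm (coef u n)"
      by (intro mult_right_mono prod_le) auto
    then show "norm (\<i> * of_int (freq n $ j) * coef (g i) n) \<le> norm (coef w n) + norm (coef (0 :: 'n L2) n)"
      by (simp add: norm_mult nw g coef_zero mult_ac)
  qed
  define h :: "'n \<Rightarrow> 'n \<Rightarrow> 'n L2"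
    where "h i j = (SOME h. \<forall>n. coef h n = \<i> * of_int (freq n $ j) * coef (g i) n)" for i j
  have h: "coef (h i j) n = \<i> * of_int (freq n $ j) * coef (g i) n" for i j n
    unfolding h_def using someI_ex[OF ex[of j i]] by blast
  have "has_weak_pd i (rep_L2 u) (rep_L2 (g i))" "has_weak_pd j (rep_L2 (g i)) (rep_L2 (h i j))" for i j
    by (simp_all add: has_weak_pd_iff Lp2_rep g h)
  then show ?thesis
    unfolding H2_def numeral_2_eq_2 sobolev.simps using Lp2_rep by blast
qed

lemma weak_lap_eqI:
  fixes u w :: "'n::finite L2"
  assumes "\<And>n. coef w n = - of_real (freq_sq TYPE('n) n) * coef u n"
  shows "weak_lap u = w"
  by (rule coef_inject) (simp only: H2_coef_weak_lap[OF H2I[OF assms]] assms)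

text \<open>Integration by parts shows that classical derivatives multiply coefficients exactly as
  weak ones do. This lets the weak Laplacian be computed classically on the range of
  \<open>C_op\<close>.\<close>

lemma H2_classical:
  fixes F :: "real ^ 'n::finite \<Rightarrow> complex"
  assumes F: "Ck 2 F" and per: "periodic F"
  shows "mk_L2 F \<in> H2" "weak_lap (mk_L2 F) = mk_L2 (\<lambda>x. \<Sum>i\<in>UNIV. pd i (pd i F) x)"
proof -
  have F1: "Ck 1 F" "Ck 1 (pd i F)" "continuous_on UNIV (pd i (pd i F))" for i
    using F Ck_le[OF F, of 1] by (auto simp: numeral_2_eq_2)
  have per': "periodic (pd i F)" for i using F1(1) by (intro periodic_pd[OF per]) simp
  have "coef (mk_L2 (\<lambda>x. \<Sum>i\<in>I. pd i (pd i F) x)) n = (\<Sum>i\<in>I. coef (mk_L2 (pd i (pd i F))) n)" if "finite I" for I n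
    using that
  proof (induction I rule: finite_induct)
    case empty
    have "mk_L2 (\<lambda>x :: real ^ 'n. 0) = 0" by (simp add: zero_L2_def)
    then show ?case by (simp add: coef_def cinner.zero_left)
  next
    case (insert i I)
    have "mk_L2 (\<lambda>x. pd i (pd i F) x + (\<Sum>i\<in>I. pd i (pd i F) x)) = mk_L2 (pd i (pd i F)) + mk_L2 (\<lambda>x. \<Sum>i\<in>I. pd i (pd i F) x)"
      by (intro mk_L2_add[symmetric] continuous_Lp2 continuous_intros F1)
    then show ?case using insert by (simp add: coef_add)
  qed
  then have "coef (mk_L2 (\<lambda>x. \<Sum>i\<in>UNIV. pd i (pd i F) x)) n = - of_real (freq_sq TYPE('n) n) * coef (mk_L2 F) n" for n
    by (simp add: coef_mk_L2_pd[OF F1(2) per'] coef_mk_L2_pd[OF F1(1) per] freq_sq_def sum_distrib_left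
        sum_negf[symmetric] power2_eq_square mult_ac)
  then show "mk_L2 F \<in> H2" "weak_lap (mk_L2 F) = mk_L2 (\<lambda>x. \<Sum>i\<in>UNIV. pd i (pd i F) x)"
    by (rule H2I, rule weak_lap_eqI)
qed

lemma weak_lap_sym:
  assumes "u \<in> H2" "v \<in> H2"
  shows "cinner (weak_lap u) v = cinner u (weak_lap v)"
proof -
  have "(\<lambda>n. coef (weak_lap u) n * cnj (coef v n)) = (\<lambda>n. coef u n * cnj (coef (weak_lap v) n))"
    by (simp add: H2_coef_weak_lap assms mult_ac)
  from parseval[of "weak_lap u" v, unfolded this] parseval[of u "weak_lap v"] show ?thesis
    by (rule sums_unique2)
qed

lemma weak_lap_nonpos:
  assumes "u \<in> H2"
  shows "Re (cinner (weak_lap u) u) \<le> 0"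
proof -
  have sums: "(\<lambda>n. Re (coef (weak_lap u) n * cnj (coef u n))) sums Re (cinner (weak_lap u) u)"
    by (rule sums_Re[OF parseval])
  have "Re (coef (weak_lap u) n * cnj (coef u n)) \<le> 0" for n
  proof -
    have "coef (weak_lap u) n * cnj (coef u n) = - of_real (freq_sq TYPE('a) n) * (coef u n * cnj (coef u n))"
      by (simp add: H2_coef_weak_lap assms)
    also have "\<dots> = of_real (- (freq_sq TYPE('a) n * (norm (coef u n))\<^sup>2))"
      by (simp only: complex_norm_square[symmetric]) simp
    finally show ?thesis by (simp only: Re_complex_of_real) (simp add: freq_sq_nonneg)
  qed
  from sums_le[OF this sums sums_zero] show ?thesis .
qed

lemma H2_add: "u \<in> H2 \<Longrightarrow> v \<in> H2 \<Longrightarrow> u + v \<in> H2"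
  by (rule H2I[of "weak_lap u + weak_lap v"]) (simp add: coef_add H2_coef_weak_lap algebra_simps)

lemma weak_lap_add: "u \<in> H2 \<Longrightarrow> v \<in> H2 \<Longrightarrow> weak_lap (u + v) = weak_lap u + weak_lap v"
  by (rule weak_lap_eqI) (simp add: coef_add H2_coef_weak_lap algebra_simps)

lemma closure_H2: "closure (H2 :: 'n::finite L2 set) = UNIV"
proof -
  have H2: "(\<Sum>k<N. coef u k *\<^sub>C (basis k :: 'n L2)) \<in> H2" for u :: "'n L2" and N
    by (rule H2I[of "\<Sum>k<N. (- of_real (freq_sq TYPE('n) k) * coef u k) *\<^sub>C basis k"])
       (simp only: coef_partial_sum, simp)
  have "u \<in> closure H2" for u :: "'n L2"
    unfolding closure_sequential
    by (intro exI[of _ "\<lambda>N. \<Sum>k<N. coef u k *\<^sub>C basis k"] conjI allI H2 fourier_expansion)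
  then show ?thesis by auto
qed

subsection \<open>Fourier multipliers and the resolvent of the Laplacian\<close>

lemma norm_le_of_coef_le:
  assumes B: "B \<ge> 0" and le: "\<And>n. norm (coef u n) \<le> B * norm (coef v n)"
  shows "norm u \<le> B * norm v"
proof (rule power2_le_imp_le)
  have "(norm u)\<^sup>2 \<le> B\<^sup>2 * (norm v)\<^sup>2"
  proof (rule sums_le[OF _ parseval_norm sums_mult[OF parseval_norm]])
    fix n
    have "(norm (coef u n))\<^sup>2 \<le> (B * norm (coef v n))\<^sup>2" by (intro power_mono le) auto
    then show "(norm (coef u n))\<^sup>2 \<le> B\<^sup>2 * (norm (coef v n))\<^sup>2" by (simp add: power_mult_distrib)
  qed
  then show "(norm u)\<^sup>2 \<le> (B * norm v)\<^sup>2" by (simp add: power_mult_distrib)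
qed (use B in simp)

text \<open>Multipliers tending to 0 make T a norm limit of its finite rank truncations, whose error
  is bounded by the size of |a n| on the tail; this gives compactness.\<close>

lemma fourier_multiplier:
  fixes a :: "nat \<Rightarrow> complex"
  assumes a: "\<And>n. norm (a n) \<le> B"
  shows "\<exists>T :: 'n::finite L2 \<Rightarrow> 'n L2. (\<forall>u n. coef (T u) n = a n * coef u n) \<and> bounded_linear T \<and>
    (\<forall>c u. T (c *\<^sub>C u) = c *\<^sub>C T u) \<and> (\<forall>u. norm (T u) \<le> B * norm u) \<and>
    (a \<longlonglongrightarrow> 0 \<longrightarrow> compact_operator T)"
proof -
  have B: "B \<ge> 0" using order_trans[OF norm_ge_zero a] .
  have "\<exists>v :: 'n L2. \<forall>n. coef v n = a n * coef u n" for u :: "'n L2"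
  proof (rule ex_coef_bounded[of _ "B *\<^sub>R u" u])
    fix n
    have "norm (a n) * norm (coef u n) \<le> B * norm (coef u n)" by (intro mult_right_mono a) auto
    then show "norm (a n * coef u n) \<le> norm (coef (B *\<^sub>R u) n) + norm (coef u n)"
      using B by (simp add: norm_mult add_increasing2)
  qed
  then obtain T :: "'n L2 \<Rightarrow> 'n L2" where T: "\<And>u n. coef (T u) n = a n * coef u n" by metis
  have le: "norm (T u) \<le> B * norm u" for u
    by (rule norm_le_of_coef_le[OF B]) (simp add: T norm_mult mult_right_mono a)
  have lin: "bounded_linear T"
  proof (rule bounded_linear_intro)
    show "T (u + v) = T u + T v" for u v by (rule coef_inject) (simp add: T coef_add distrib_left)
    show "T (r *\<^sub>R u) = r *\<^sub>R T u" for r u by (rule coef_inject) (simp add: T)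
    show "norm (T u) \<le> norm u * B" for u using le[of u] by (simp add: mult.commute)
  qed
  have cmpt: "compact_operator T" if lim: "a \<longlonglongrightarrow> 0"
  proof (rule compact_operator_approx[OF lin])
    fix e :: real assume e: "e > 0"
    obtain N where N: "\<And>n. n \<ge> N \<Longrightarrow> norm (a n) < e"
      using LIMSEQ_D[OF lim e] by auto
    define S where "S u = (\<Sum>k<N. cinner u (basis k) *\<^sub>C (a k *\<^sub>C basis k :: 'n L2))" for u :: "'n L2"
    have "compact_operator S"
      unfolding S_def by (intro compact_operator_sum compact_operator_rank1) simp
    moreover have "norm (T u - S u) \<le> e * norm u" for u
    proof (rule norm_le_of_coef_le)
      fix n
      have "S u = (\<Sum>k<N. (coef u k * a k) *\<^sub>C basis k)" by (simp add: S_def coef_def)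
      then have "coef (T u - S u) n = (if n < N then 0 else a n * coef u n)"
        by (simp add: coef_diff T coef_partial_sum)
      then show "norm (coef (T u - S u) n) \<le> e * norm (coef u n)"
        using N[of n] e by (cases "n < N") (simp_all add: norm_mult mult_right_mono less_imp_le)
    qed (use e in simp)
    ultimately show "\<exists>S. compact_operator S \<and> (\<forall>u. norm (T u - S u) \<le> e * norm u)" by blast
  qed
  have sc: "T (c *\<^sub>C u) = c *\<^sub>C T u" for c u by (rule coef_inject) (simp add: T)
  show ?thesis by (intro exI[of _ T] conjI allI impI T lin sc le cmpt)
qed

text \<open>A ball contains finitely many lattice points, since |k_i| is at most
  \<open>k_i\<^sup>2\<close> for integers. This forces the symbol to infinity whatever the
  enumeration.\<close>

lemma finite_freq_sq_le: "finite {n. freq_sq TYPE('n::finite) n \<le> C}"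
proof -
  define S where "S = {m :: int. \<bar>m\<bar> \<le> \<lceil>max 1 C\<rceil>}"
  have S: "finite S"
    by (rule finite_subset[of _ "{- \<lceil>max 1 C\<rceil>..\<lceil>max 1 C\<rceil>}"]) (auto simp: S_def)
  have "freq ` {n. freq_sq TYPE('n) n \<le> C} \<subseteq> (\<lambda>f. \<chi> i. f i) ` (PiE UNIV (\<lambda>i :: 'n. S))"
  proof safe
    fix n assume n: "freq_sq TYPE('n) n \<le> C"
    have "(freq n :: int ^ 'n) $ i \<in> S" for i
    proof -
      let ?k = "(freq n :: int ^ 'n) $ i"
      have "\<bar>?k\<bar> \<le> ?k\<^sup>2"
      proof (cases "?k = 0")
        case False
        then have "\<bar>?k\<bar> * 1 \<le> \<bar>?k\<bar> * \<bar>?k\<bar>" by (intro mult_left_mono) auto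
        then show ?thesis by (simp add: power2_eq_square)
      qed simp
      then have "real_of_int \<bar>?k\<bar> \<le> real_of_int (?k\<^sup>2)" by (simp only: of_int_le_iff)
      also have "\<dots> \<le> freq_sq TYPE('n) n" using freq_component_le[of n i] by simp
      also have "\<dots> \<le> max 1 C" using n by simp
      also have "\<dots> \<le> of_int \<lceil>max 1 C\<rceil>" by (rule le_of_int_ceiling)
      finally have "real_of_int \<bar>?k\<bar> \<le> of_int \<lceil>max 1 C\<rceil>" .
      then show ?thesis unfolding S_def by (simp only: of_int_le_iff mem_Collect_eq)
    qed
    then show "(freq n :: int ^ 'n) \<in> (\<lambda>f. \<chi> i. f i) ` (PiE UNIV (\<lambda>i :: 'n. S))"
      by (intro image_eqI[of _ _ "\<lambda>i. freq n $ i"]) auto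
  qed
  moreover have "finite (PiE UNIV (\<lambda>i :: 'n. S))" by (intro finite_PiE S) auto
  ultimately have "finite ((freq :: nat \<Rightarrow> int ^ 'n) ` {n. freq_sq TYPE('n) n \<le> C})"
    by (meson finite_imageI finite_subset)
  then show ?thesis
    by (rule finite_imageD) (rule inj_on_subset[OF bij_is_inj[OF bij_freq] subset_UNIV])
qed

lemma freq_sq_at_top: "filterlim (freq_sq TYPE('n::finite)) at_top sequentially"
  unfolding filterlim_at_top
proof
  fix C
  have "\<forall>\<^sub>F n in cofinite. \<not> freq_sq TYPE('n) n \<le> C"
    using finite_freq_sq_le[where 'n = 'n, of C] by (simp add: eventually_cofinite)
  then show "\<forall>\<^sub>F n in sequentially. C \<le> freq_sq TYPE('n) n"
    unfolding cofinite_eq_sequentially by eventually_elim simp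
qed

text \<open>The multiplier 1 / (\<sigma> \<open>|k|\<^sup>2\<close> + a) is at most 1 / a, which
  makes perturbations small for large a, and it tends to 0, which gives compactness in the role of
  Rellich's theorem.\<close>

lemma laplace_resolvent:
  assumes \<sigma>: "\<sigma> > 0" and a: "a > 0"
  obtains T :: "'n::finite L2 \<Rightarrow> 'n L2"
  where "compact_operator T" "\<And>c u. T (c *\<^sub>C u) = c *\<^sub>C T u" "\<And>u. norm (T u) \<le> (1 / a) * norm u"
    "\<And>u. T u \<in> H2" "\<And>u. - (\<sigma> *\<^sub>R weak_lap (T u)) + a *\<^sub>R T u = u"
    "\<And>u. u \<in> H2 \<Longrightarrow> T (- (\<sigma> *\<^sub>R weak_lap u) + a *\<^sub>R u) = u"
proof -
  let ?q = "freq_sq TYPE('n)"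
  define m where "m n = \<sigma> * ?q n + a" for n
  have m: "m n \<ge> a" "m n > 0" for n
    using \<sigma> a freq_sq_nonneg[of "TYPE('n)" n] by (simp_all add: m_def add_nonneg_pos)
  have bnd: "norm (complex_of_real (1 / m n)) \<le> 1 / a" for n
    using m[of n] a by (simp add: norm_divide frac_le)
  have "\<exists>T :: 'n L2 \<Rightarrow> 'n L2. (\<forall>u n. coef (T u) n = of_real (1 / m n) * coef u n) \<and> bounded_linear T \<and>
    (\<forall>c u. T (c *\<^sub>C u) = c *\<^sub>C T u) \<and> (\<forall>u. norm (T u) \<le> (1 / a) * norm u) \<and>
    ((\<lambda>n. complex_of_real (1 / m n)) \<longlonglongrightarrow> 0 \<longrightarrow> compact_operator T)"
    by (rule fourier_multiplier[OF bnd])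
  then obtain T :: "'n L2 \<Rightarrow> 'n L2"
    where T: "\<And>u n. coef (T u) n = of_real (1 / m n) * coef u n" "bounded_linear T" "\<And>c u. T (c *\<^sub>C u) = c *\<^sub>C T u"
    "\<And>u. norm (T u) \<le> (1 / a) * norm u" "(\<lambda>n. complex_of_real (1 / m n)) \<longlonglongrightarrow> 0 \<Longrightarrow> compact_operator T"
    by blast
  have "filterlim (\<lambda>n. \<sigma> * ?q n) at_top sequentially"
    by (rule filterlim_tendsto_pos_mult_at_top[OF tendsto_const \<sigma> freq_sq_at_top])
  then have "filterlim m at_top sequentially"
    by (rule filterlim_at_top_mono) (use a in \<open>simp add: m_def less_imp_le\<close>)
  then have "(\<lambda>n. inverse (m n)) \<longlonglongrightarrow> 0"
    by (rule tendsto_inverse_0_at_top)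
  then have "(\<lambda>n. complex_of_real (1 / m n)) \<longlonglongrightarrow> of_real 0"
    by (intro tendsto_of_real) (simp add: inverse_eq_divide)
  then have c: "compact_operator T" using T(5) by simp
  have w: "coef ((1 / \<sigma>) *\<^sub>R (a *\<^sub>R T u - u)) n = - of_real (?q n) * coef (T u) n" for u n
  proof -
    have "coef u n = of_real (m n) * coef (T u) n" using m(2)[of n] by (simp add: T(1))
    then show ?thesis using \<sigma> by (simp add: coef_diff m_def field_simps)
  qed
  have H2: "T u \<in> H2" for u by (rule H2I[OF w])
  have inv1: "- (\<sigma> *\<^sub>R weak_lap (T u)) + a *\<^sub>R T u = u" for u
    unfolding weak_lap_eqI[OF w] using \<sigma> by simp
  have inv2: "T (- (\<sigma> *\<^sub>R weak_lap u) + a *\<^sub>R u) = u" if "u \<in> H2" for u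
  proof (rule coef_inject)
    fix n
    have "coef (- (\<sigma> *\<^sub>R weak_lap u) + a *\<^sub>R u) n = of_real (m n) * coef u n"
      using coef_diff[of "a *\<^sub>R u" "\<sigma> *\<^sub>R weak_lap u" n] by (simp add: H2_coef_weak_lap[OF that] m_def algebra_simps)
    then show "coef (T (- (\<sigma> *\<^sub>R weak_lap u) + a *\<^sub>R u)) n = coef u n"
      using m(2)[of n] by (simp add: T(1))
  qed
  show thesis by (rule that[OF c T(3,4) H2 inv1 inv2])
qed

section \<open>Multiplication and convolution operators\<close>

lemma cell_bound_all:
  fixes f :: "real ^ 'n::finite \<Rightarrow> 'b::real_normed_vector"
  assumes "continuous_on UNIV f" "periodic f"
  obtains B where "B \<ge> 0" "\<And>x. norm (f x) \<le> B"
proof -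
  obtain B where B: "B \<ge> 0" "\<And>x. x \<in> cbox 0 (\<chi> i. 2 * pi) \<Longrightarrow> norm (f x) \<le> B"
    using continuous_bounded_cell[OF assms(1)] by metis
  have "norm (f x) \<le> B" for x
  proof -
    obtain y where y: "y \<in> cbox 0 (\<chi> i. 2 * pi)" "\<And>g :: real ^ 'n \<Rightarrow> 'b. periodic g \<Longrightarrow> g x = g y"
      using periodic_cell[of x] by metis
    show ?thesis using B(2)[OF y(1)] y(2)[OF assms(2)] by simp
  qed
  with B(1) show thesis by (rule that)
qed

lemma norm_mk_L2_le:
  fixes f g :: "real ^ 'n::finite \<Rightarrow> complex"
  assumes f: "Lp 2 f" and g: "Lp 2 g" and B: "B \<ge> 0" and le: "\<And>x. x \<in> space torus \<Longrightarrow> norm (f x) \<le> B * norm (g x)"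
  shows "norm (mk_L2 f) \<le> B * norm (mk_L2 g)"
proof (rule power2_le_imp_le)
  have "(norm (mk_L2 f))\<^sup>2 \<le> (LINT x|torus. B\<^sup>2 * (norm (g x))\<^sup>2)"
    unfolding norm_mk_L2[OF f]
  proof (rule integral_mono)
    show "integrable torus (\<lambda>x. (norm (f x))\<^sup>2)" "integrable torus (\<lambda>x. B\<^sup>2 * (norm (g x))\<^sup>2)"
      using f g by (auto simp: Lp2_iff)
    fix x :: "real ^ 'n" assume "x \<in> space torus"
    then have "(norm (f x))\<^sup>2 \<le> (B * norm (g x))\<^sup>2" by (intro power_mono le) auto
    then show "(norm (f x))\<^sup>2 \<le> B\<^sup>2 * (norm (g x))\<^sup>2" by (simp add: power_mult_distrib)
  qed
  then show "(norm (mk_L2 f))\<^sup>2 \<le> (B * norm (mk_L2 g))\<^sup>2"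
    by (simp add: power_mult_distrib norm_mk_L2[OF g])
qed (use B in simp)

lemma Lp2_continuous_mult:
  fixes f g :: "real ^ 'n::finite \<Rightarrow> complex"
  assumes f: "Lp 2 f" and g: "continuous_on UNIV g"
  shows "Lp 2 (\<lambda>x. g x * f x)"
proof -
  obtain B where B: "B \<ge> 0" "\<And>x. x \<in> cbox 0 (\<chi> i. 2 * pi) \<Longrightarrow> norm (g x) \<le> B"
    using continuous_bounded_cell[OF g] by metis
  have m: "(\<lambda>x. g x * f x) \<in> borel_measurable torus"
    using borel_measurable_times[OF measurable_torus_continuous[OF g]] f unfolding Lp2_iff by blast
  show ?thesis
    unfolding Lp2_iff
  proof (rule conjI[OF m], rule Bochner_Integration.integrable_bound)
    show "integrable torus (\<lambda>x. B\<^sup>2 * (norm (f x))\<^sup>2)" using f by (simp add: Lp2_iff)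
    show "(\<lambda>x. (norm (g x * f x))\<^sup>2) \<in> borel_measurable torus" using m by simp
    show "AE x in torus. norm ((norm (g x * f x))\<^sup>2) \<le> norm (B\<^sup>2 * (norm (f x))\<^sup>2)"
    proof (rule AE_I2)
      fix x :: "real ^ 'n" assume "x \<in> space torus"
      then have "(norm (g x))\<^sup>2 \<le> B\<^sup>2" by (intro power_mono B) (auto simp: space_torus)
      then have "(norm (g x))\<^sup>2 * (norm (f x))\<^sup>2 \<le> B\<^sup>2 * (norm (f x))\<^sup>2" by (intro mult_right_mono) auto
      then show "norm ((norm (g x * f x))\<^sup>2) \<le> norm (B\<^sup>2 * (norm (f x))\<^sup>2)"
        by (simp add: norm_mult power_mult_distrib)
    qed
  qed
qed

definition mul_op :: "(real ^ 'n::finite \<Rightarrow> real) \<Rightarrow> 'n L2 \<Rightarrow> 'n L2" where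
  "mul_op g u = mk_L2 (\<lambda>x. of_real (g x) * rep_L2 u x)"

context
  fixes g :: "real ^ 'n::finite \<Rightarrow> real"
  assumes g: "continuous_on UNIV g"
begin

lemma Lp2_mul: "Lp 2 f \<Longrightarrow> Lp 2 (\<lambda>x. complex_of_real (g x) * f x)"
  by (erule Lp2_continuous_mult) (intro continuous_intros g)

lemma mul_op_mk_L2:
  assumes f: "Lp 2 f"
  shows "mul_op g (mk_L2 f) = mk_L2 (\<lambda>x. of_real (g x) * f x)"
  unfolding mul_op_def
proof (subst mk_L2_eq_iff[OF Lp2_mul[OF Lp2_rep] Lp2_mul[OF f]])
  show "AE x in torus. complex_of_real (g x) * rep_L2 (mk_L2 f) x = of_real (g x) * f x"
    using AE_rep_mk_L2[OF f] by eventually_elim simp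
qed

lemma mul_op_add: "mul_op g (u + v) = mul_op g u + mul_op g v"
proof -
  have "mul_op g (mk_L2 (\<lambda>x. rep_L2 u x + rep_L2 v x)) = mul_op g (mk_L2 (rep_L2 u)) + mul_op g (mk_L2 (rep_L2 v))"
    by (simp only: mul_op_mk_L2 Lp2_add Lp2_rep mk_L2_add Lp2_mul distrib_left)
  then show ?thesis by (simp only: mk_L2_add[symmetric] Lp2_rep mk_L2_rep)
qed

lemma mul_op_scaleC: "mul_op g (c *\<^sub>C u) = c *\<^sub>C mul_op g u"
proof -
  have "mul_op g (mk_L2 (\<lambda>x. c * rep_L2 u x)) = c *\<^sub>C mul_op g (mk_L2 (rep_L2 u))"
    by (simp only: mul_op_mk_L2 Lp2_cmult Lp2_rep mk_L2_scaleC Lp2_mul mult.left_commute)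
  then show ?thesis by (simp only: mk_L2_scaleC[symmetric] Lp2_rep mk_L2_rep)
qed

lemma norm_mul_op_le:
  assumes B: "B \<ge> 0" "\<And>x. x \<in> space torus \<Longrightarrow> \<bar>g x\<bar> \<le> B"
  shows "norm (mul_op g u) \<le> B * norm u"
proof -
  have "norm (mul_op g u) \<le> B * norm (mk_L2 (rep_L2 u))"
    unfolding mul_op_def
    by (rule norm_mk_L2_le[OF Lp2_mul[OF Lp2_rep] Lp2_rep B(1)]) (auto simp: norm_mult intro!: mult_right_mono B)
  then show ?thesis by simp
qed

lemma bounded_linear_mul_op: "bounded_linear (mul_op g)"
proof -
  obtain B where B: "B \<ge> 0" "\<And>x. x \<in> cbox 0 (\<chi> i. 2 * pi) \<Longrightarrow> norm (g x) \<le> B"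
    using continuous_bounded_cell[OF g] by metis
  show ?thesis
  proof (rule bounded_linear_intro)
    show "norm (mul_op g u) \<le> norm u * B" for u
      using norm_mul_op_le[OF B(1), of u] B(2) by (simp add: space_torus mult.commute)
  qed (simp_all only: mul_op_add mul_op_scaleC scaleR_scaleC)
qed

lemma mul_op_sym: "cinner (mul_op g u) w = cinner u (mul_op g w)"
proof -
  have "cinner (mul_op g (mk_L2 (rep_L2 u))) (mk_L2 (rep_L2 w)) = cinner (mk_L2 (rep_L2 u)) (mul_op g (mk_L2 (rep_L2 w)))"
    by (simp only: mul_op_mk_L2 Lp2_rep cinner_mk_L2 Lp2_mul) (simp add: mult_ac)
  then show ?thesis by simp
qed

end

interpretation torus_pair: pair_sigma_finite "torus :: (real ^ 'n::finite) measure" "torus :: (real ^ 'n) measure" ..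

lemma integral_norm_L2_le: "(LINT x|torus. norm (rep_L2 u x)) \<le> sqrt (vol TYPE('n)) * norm (u :: 'n::finite L2)"
proof -
  have "ennreal (LINT x|torus. norm (rep_L2 u x)) = (\<integral>\<^sup>+x. ennreal (norm (rep_L2 u x)) \<partial>torus)"
    using Lp2_integrable[OF Lp2_rep, of u] by (subst nn_integral_eq_integral) auto
  also have "\<dots> \<le> ennreal (sqrt (vol TYPE('n)) * norm u)"
    unfolding vol_def by (rule nn_integral_norm_le)
  finally show ?thesis
    using vol_pos[where 'n = 'n] by (subst (asm) ennreal_le_iff) auto
qed

lemma integral_norm_mult_le:
  fixes f g :: "real ^ 'n::finite \<Rightarrow> complex"
  assumes f: "Lp 2 f" and g: "Lp 2 g"
  shows "(LINT x|torus. norm (f x) * norm (g x)) \<le> norm (mk_L2 f) * norm (mk_L2 g)"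
proof -
  have n: "Lp 2 (\<lambda>x. complex_of_real (norm (h x)))" if "Lp 2 h" for h :: "real ^ 'n \<Rightarrow> complex"
    using that by (auto simp: Lp2_iff)
  have eq: "norm (mk_L2 (\<lambda>x. complex_of_real (norm (h x)))) = norm (mk_L2 h)" if "Lp 2 h" for h :: "real ^ 'n \<Rightarrow> complex"
    by (rule power2_eq_imp_eq) (simp_all add: norm_mk_L2 n that)
  have "cinner (mk_L2 (\<lambda>x. complex_of_real (norm (f x)))) (mk_L2 (\<lambda>x. complex_of_real (norm (g x))))
      = (LINT x|torus. complex_of_real (norm (f x) * norm (g x)))"
    by (simp add: cinner_mk_L2 n f g)
  also have "\<dots> = of_real (LINT x|torus. norm (f x) * norm (g x))"
    by (rule integral_complex_of_real)
  finally have "(LINT x|torus. norm (f x) * norm (g x)) \<le>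
      norm (cinner (mk_L2 (\<lambda>x. complex_of_real (norm (f x)))) (mk_L2 (\<lambda>x. complex_of_real (norm (g x)))))"
    by simp
  also have "\<dots> \<le> norm (mk_L2 f) * norm (mk_L2 g)"
    unfolding eq[OF f, symmetric] eq[OF g, symmetric] by (rule norm_cinner_le)
  finally show ?thesis .
qed

definition conv_op :: "(real ^ 'n::finite \<Rightarrow> real) \<Rightarrow> 'n L2 \<Rightarrow> 'n L2" where
  "conv_op G u = mk_L2 (\<lambda>x. LINT y|torus. of_real (G (x - y)) * rep_L2 u y)"

context
  fixes G :: "real ^ 'n::finite \<Rightarrow> real"
  assumes G: "continuous_on UNIV G" and G_per: "periodic G"
begin

lemma continuous_conv_op:
  "integrable torus f \<Longrightarrow> continuous_on UNIV (\<lambda>x. LINT y|torus. complex_of_real (G (x - y)) * f y)"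
  by (rule conv_continuous[of "\<lambda>x. complex_of_real (G x)"]) (intro continuous_intros G)

lemma integrable_conv_op: "integrable torus f \<Longrightarrow> integrable torus (\<lambda>y. complex_of_real (G (x - y)) * f y)"
  by (rule integrable_conv[of "\<lambda>x. complex_of_real (G x)"]) (intro continuous_intros G)

lemma Lp2_conv: "Lp 2 f \<Longrightarrow> Lp 2 (\<lambda>x. LINT y|torus. complex_of_real (G (x - y)) * f y)"
  by (rule continuous_Lp2[OF continuous_conv_op[OF Lp2_integrable]])

lemma conv_op_mk_L2:
  assumes f: "Lp 2 f"
  shows "conv_op G (mk_L2 f) = mk_L2 (\<lambda>x. LINT y|torus. of_real (G (x - y)) * f y)"
proof -
  have "(LINT y|torus. complex_of_real (G (x - y)) * rep_L2 (mk_L2 f) y) = (LINT y|torus. of_real (G (x - y)) * f y)" for x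
  proof (rule integral_cong_AE)
    show "(\<lambda>y. complex_of_real (G (x - y)) * rep_L2 (mk_L2 f) y) \<in> borel_measurable torus"
      "(\<lambda>y. complex_of_real (G (x - y)) * f y) \<in> borel_measurable torus"
      by (intro borel_measurable_integrable integrable_conv_op Lp2_integrable Lp2_rep f)+
    show "AE y in torus. complex_of_real (G (x - y)) * rep_L2 (mk_L2 f) y = of_real (G (x - y)) * f y"
      using AE_rep_mk_L2[OF f] by eventually_elim simp
  qed
  then show ?thesis by (simp add: conv_op_def)
qed

lemma conv_op_add: "conv_op G (u + v) = conv_op G u + conv_op G v"
proof -
  have "(LINT y|torus. complex_of_real (G (x - y)) * (rep_L2 u y + rep_L2 v y)) =
     (LINT y|torus. of_real (G (x - y)) * rep_L2 u y) + (LINT y|torus. of_real (G (x - y)) * rep_L2 v y)" for x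
    unfolding distrib_left by (intro Bochner_Integration.integral_add integrable_conv_op Lp2_integrable Lp2_rep)
  then have "conv_op G (mk_L2 (\<lambda>x. rep_L2 u x + rep_L2 v x)) = conv_op G (mk_L2 (rep_L2 u)) + conv_op G (mk_L2 (rep_L2 v))"
    by (simp only: conv_op_mk_L2 Lp2_add Lp2_rep mk_L2_add Lp2_conv)
  then show ?thesis by (simp only: mk_L2_add[symmetric] Lp2_rep mk_L2_rep)
qed

lemma conv_op_scaleC: "conv_op G (c *\<^sub>C u) = c *\<^sub>C conv_op G u"
proof -
  have "(LINT y|torus. complex_of_real (G (x - y)) * (c * rep_L2 u y)) =
     c * (LINT y|torus. of_real (G (x - y)) * rep_L2 u y)" for x
    unfolding mult.left_commute[of _ c] by (rule integral_mult_right_zero)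
  then have "conv_op G (mk_L2 (\<lambda>x. c * rep_L2 u x)) = c *\<^sub>C conv_op G (mk_L2 (rep_L2 u))"
    by (simp only: conv_op_mk_L2 Lp2_cmult Lp2_rep mk_L2_scaleC Lp2_conv)
  then show ?thesis by (simp only: mk_L2_scaleC[symmetric] Lp2_rep mk_L2_rep)
qed

lemma norm_conv_le:
  assumes B: "\<And>x. \<bar>G x\<bar> \<le> B" and f: "integrable torus f"
  shows "norm (LINT y|torus. complex_of_real (G (x - y)) * f y) \<le> B * (LINT y|torus. norm (f y))"
proof -
  have "norm (LINT y|torus. complex_of_real (G (x - y)) * f y) \<le> (LINT y|torus. B * norm (f y))"
  proof (rule order_trans[OF integral_norm_bound integral_mono])
    show "integrable torus (\<lambda>y. norm (complex_of_real (G (x - y)) * f y))" using integrable_conv_op[OF f] by simp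
    show "integrable torus (\<lambda>y. B * norm (f y))" using f by simp
    show "norm (complex_of_real (G (x - y)) * f y) \<le> B * norm (f y)" for y
      by (simp add: norm_mult mult_right_mono B)
  qed
  then show ?thesis by simp
qed

lemma bounded_linear_conv_op: "bounded_linear (conv_op G)"
proof -
  obtain B where B: "B \<ge> 0" "\<And>x. norm (G x) \<le> B"
    using cell_bound_all[OF G G_per] by metis
  let ?V = "sqrt (vol TYPE('n))"
  have one: "Lp 2 (\<lambda>x :: real ^ 'n. 1 :: complex)" by (simp add: Lp2_iff)
  show ?thesis
  proof (rule bounded_linear_intro)
    show "norm (conv_op G u) \<le> norm u * (B * ?V * norm (mk_L2 (\<lambda>x :: real ^ 'n. 1 :: complex)))" for u
    proof -
      have "norm (conv_op G u) \<le> (B * (?V * norm u)) * norm (mk_L2 (\<lambda>x :: real ^ 'n. 1 :: complex))"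
        unfolding conv_op_def
      proof (rule norm_mk_L2_le[OF Lp2_conv[OF Lp2_rep] one])
        show "0 \<le> B * (?V * norm u)" using B(1) vol_pos[where 'n = 'n] by simp
        fix x :: "real ^ 'n"
        have "norm (LINT y|torus. complex_of_real (G (x - y)) * rep_L2 u y) \<le> B * (LINT y|torus. norm (rep_L2 u y))"
          using B(2) by (intro norm_conv_le Lp2_integrable Lp2_rep) simp
        also have "\<dots> \<le> B * (?V * norm u)" by (intro mult_left_mono integral_norm_L2_le B)
        finally show "norm (LINT y|torus. complex_of_real (G (x - y)) * rep_L2 u y) \<le> B * (?V * norm u) * norm (1 :: complex)" by simp
      qed
      then show ?thesis by (simp add: mult_ac)
    qed
  qed (simp_all only: conv_op_add conv_op_scaleC scaleR_scaleC)
qed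

lemma pair_measurable:
  fixes f g :: "real ^ 'n \<Rightarrow> complex"
  assumes "f \<in> borel_measurable torus" "g \<in> borel_measurable torus"
  shows "(\<lambda>p. complex_of_real (G (fst p - snd p)) * f (snd p) * g (fst p)) \<in> borel_measurable (torus \<Otimes>\<^sub>M torus)"
proof -
  have id: "(\<lambda>x. x) \<in> borel_measurable (torus :: (real ^ 'n) measure)"
    by (rule measurable_torus_borel) simp
  have fst: "fst \<in> torus \<Otimes>\<^sub>M torus \<rightarrow>\<^sub>M (torus :: (real ^ 'n) measure)"
    and snd: "snd \<in> torus \<Otimes>\<^sub>M torus \<rightarrow>\<^sub>M (torus :: (real ^ 'n) measure)"
    by (rule measurable_fst measurable_snd)+
  have "(\<lambda>p. fst p - snd p) \<in> borel_measurable (torus \<Otimes>\<^sub>M (torus :: (real ^ 'n) measure))"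
    by (intro borel_measurable_diff measurable_compose[OF fst id] measurable_compose[OF snd id])
  then have "(\<lambda>p. complex_of_real (G (fst p - snd p))) \<in> borel_measurable (torus \<Otimes>\<^sub>M torus)"
    by (rule measurable_compose[of _ _ borel "\<lambda>x. complex_of_real (G x)"])
       (intro borel_measurable_continuous_onI continuous_intros G)
  then show ?thesis
    by (intro borel_measurable_times measurable_compose[OF snd assms(1)] measurable_compose[OF fst assms(2)])
qed

text \<open>The hypothesis of Fubini's theorem, from the bound sup |G| times the product of the L1
  norms; periodicity makes \<open>G\<close> bounded at all differences x - y.\<close>

lemma pair_integrable:
  fixes f g :: "real ^ 'n \<Rightarrow> complex"
  assumes f: "integrable torus f" and g: "integrable torus g"
  shows "integrable (torus \<Otimes>\<^sub>M torus) (\<lambda>p. complex_of_real (G (fst p - snd p)) * f (snd p) * g (fst p))"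
proof (rule torus_pair.Fubini_integrable)
  show meas: "(\<lambda>p. complex_of_real (G (fst p - snd p)) * f (snd p) * g (fst p)) \<in> borel_measurable (torus \<Otimes>\<^sub>M torus)"
    using f g by (intro pair_measurable) auto
  show "AE x in torus. integrable torus (\<lambda>y. complex_of_real (G (fst (x, y) - snd (x, y))) * f (snd (x, y)) * g (fst (x, y)))"
    using integrable_conv_op[OF f] by (intro AE_I2) simp
  obtain B where B: "B \<ge> 0" "\<And>x. norm (G x) \<le> B"
    using cell_bound_all[OF G G_per] by metis
  have inner: "(LINT y|torus. norm (complex_of_real (G (x - y)) * f y * g x)) = (LINT y|torus. norm (complex_of_real (G (x - y)) * f y)) * norm (g x)" for x
    by (simp add: norm_mult)
  have le: "(LINT y|torus. norm (complex_of_real (G (x - y)) * f y)) \<le> B * (LINT y|torus. norm (f y))" for x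
  proof -
    have "(LINT y|torus. norm (complex_of_real (G (x - y)) * f y)) \<le> (LINT y|torus. B * norm (f y))"
    proof (rule integral_mono)
      show "norm (complex_of_real (G (x - y)) * f y) \<le> B * norm (f y)" for y
        using B(2) by (simp add: norm_mult mult_right_mono)
    qed (use integrable_conv_op[OF f] f in auto)
    then show ?thesis by simp
  qed
  define R where "R = B * (LINT y|torus. norm (f y))"
  show "integrable torus (\<lambda>x. LINT y|torus. norm (complex_of_real (G (fst (x, y) - snd (x, y))) * f (snd (x, y)) * g (fst (x, y))))"
  proof (rule Bochner_Integration.integrable_bound)
    show "integrable torus (\<lambda>x. R * norm (g x))" using g by simp
    show "(\<lambda>x. LINT y|torus. norm (complex_of_real (G (fst (x, y) - snd (x, y))) * f (snd (x, y)) * g (fst (x, y)))) \<in> borel_measurable torus"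
    proof -
      have "case_prod (\<lambda>x y. norm (complex_of_real (G (fst (x, y) - snd (x, y))) * f (snd (x, y)) * g (fst (x, y)))) \<in> borel_measurable (torus \<Otimes>\<^sub>M torus)"
        using measurable_compose[OF meas borel_measurable_norm] by (simp add: case_prod_beta')
      then show ?thesis by (rule torus.borel_measurable_lebesgue_integral)
    qed
    show "AE x in torus. norm (LINT y|torus. norm (complex_of_real (G (fst (x, y) - snd (x, y))) * f (snd (x, y)) * g (fst (x, y)))) \<le> norm (R * norm (g x))"
    proof (rule AE_I2)
      fix x :: "real ^ 'n"
      have nn: "0 \<le> (LINT y|torus. norm (complex_of_real (G (x - y)) * f y))" by (rule integral_nonneg_AE) simp
      have nn': "0 \<le> R" using order_trans[OF nn le] by (simp add: R_def)
      have "(LINT y|torus. norm (complex_of_real (G (x - y)) * f y)) * norm (g x) \<le> R * norm (g x)"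
        using le[of x] unfolding R_def by (intro mult_right_mono) auto
      then show "norm (LINT y|torus. norm (complex_of_real (G (fst (x, y) - snd (x, y))) * f (snd (x, y)) * g (fst (x, y)))) \<le> norm (R * norm (g x))"
        using nn nn' by (simp only: inner fst_conv snd_conv real_norm_def abs_mult abs_norm_cancel abs_of_nonneg)
    qed
  qed
qed

lemma cinner_conv_op:
  fixes f g :: "real ^ 'n \<Rightarrow> complex"
  assumes f: "Lp 2 f" and g: "Lp 2 g"
  shows "cinner (conv_op G (mk_L2 f)) (mk_L2 g) =
    (LINT p|(torus \<Otimes>\<^sub>M torus). complex_of_real (G (fst p - snd p)) * f (snd p) * cnj (g (fst p)))"
proof -
  have g': "integrable torus (\<lambda>x. cnj (g x))" using Lp2_integrable[OF g] by simp
  have "cinner (conv_op G (mk_L2 f)) (mk_L2 g) = (LINT x|torus. (LINT y|torus. of_real (G (x - y)) * f y) * cnj (g x))"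
    by (simp add: conv_op_mk_L2 f g cinner_mk_L2 Lp2_conv)
  also have "\<dots> = (LINT x|torus. LINT y|torus. of_real (G (x - y)) * f y * cnj (g x))"
    by simp
  also have "\<dots> = (LINT p|(torus \<Otimes>\<^sub>M torus). complex_of_real (G (fst p - snd p)) * f (snd p) * cnj (g (fst p)))"
    using torus_pair.integral_fst'[OF pair_integrable[OF Lp2_integrable[OF f] g']] by simp
  finally show ?thesis .
qed

text \<open>Fubini exchanges the two variables, and evenness turns G (x - y) into G (y - x).\<close>

lemma conv_op_sym:
  assumes even: "\<And>x. G (- x) = G x"
  shows "cinner (conv_op G u) w = cinner u (conv_op G w)"
proof -
  let ?f = "rep_L2 u" and ?g = "rep_L2 w"
  have f: "integrable torus ?f" and g: "integrable torus (\<lambda>x. cnj (?g x))"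
    using Lp2_integrable[OF Lp2_rep, of u] Lp2_integrable[OF Lp2_rep, of w] by simp_all
  have i: "integrable (torus \<Otimes>\<^sub>M torus) (case_prod (\<lambda>x y. complex_of_real (G (x - y)) * ?f y * cnj (?g x)))"
    using pair_integrable[OF f g] by (simp add: case_prod_beta')
  have "cinner (conv_op G (mk_L2 ?f)) (mk_L2 ?g) = (LINT x|torus. (LINT y|torus. of_real (G (x - y)) * ?f y) * cnj (?g x))"
    by (simp only: conv_op_mk_L2 Lp2_rep cinner_mk_L2 Lp2_conv)
  also have "\<dots> = (LINT x|torus. LINT y|torus. of_real (G (x - y)) * ?f y * cnj (?g x))" by simp
  also have "\<dots> = (LINT y|torus. LINT x|torus. of_real (G (x - y)) * ?f y * cnj (?g x))"
    by (rule torus_pair.Fubini_integral[OF i, symmetric])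
  also have "\<dots> = (LINT y|torus. ?f y * cnj (LINT x|torus. of_real (G (y - x)) * ?g x))"
  proof (rule Bochner_Integration.integral_cong[OF refl])
    fix y
    have "(LINT x|torus. of_real (G (x - y)) * ?f y * cnj (?g x)) = (LINT x|torus. ?f y * cnj (of_real (G (y - x)) * ?g x))"
      using even[of "y - _"] by (intro Bochner_Integration.integral_cong[OF refl]) (simp add: mult_ac)
    then show "(LINT x|torus. of_real (G (x - y)) * ?f y * cnj (?g x)) = ?f y * cnj (LINT x|torus. of_real (G (y - x)) * ?g x)"
      by (simp only: integral_mult_right_zero Bochner_Integration.integral_cnj)
  qed
  also have "\<dots> = cinner (mk_L2 ?f) (conv_op G (mk_L2 ?g))"
    by (simp only: conv_op_mk_L2 Lp2_rep cinner_mk_L2 Lp2_conv)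
  finally show ?thesis by simp
qed

text \<open>The bound uses the L1 norm. Applied to s u, with s of L2 norm one, it gives B times the
  squared L2 norm of u without any volume factor, which is why a bound on |W| below \<sigma>
  suffices for coercivity.\<close>

lemma norm_cinner_conv_op_le:
  fixes f :: "real ^ 'n \<Rightarrow> complex"
  assumes B: "\<And>x. \<bar>G x\<bar> \<le> B" and f: "Lp 2 f"
  shows "norm (cinner (conv_op G (mk_L2 f)) (mk_L2 f)) \<le> B * (LINT x|torus. norm (f x))\<^sup>2"
proof -
  define I where "I = (LINT x|torus. norm (f x))"
  have fi: "integrable torus f" by (rule Lp2_integrable[OF f])
  have "cinner (conv_op G (mk_L2 f)) (mk_L2 f) = (LINT x|torus. (LINT y|torus. of_real (G (x - y)) * f y) * cnj (f x))"
    by (simp only: conv_op_mk_L2 f cinner_mk_L2 Lp2_conv)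
  also have "norm \<dots> \<le> (LINT x|torus. B * I * norm (f x))"
  proof (rule order_trans[OF integral_norm_bound integral_mono])
    show "integrable torus (\<lambda>x. norm ((LINT y|torus. of_real (G (x - y)) * f y) * cnj (f x)))"
      by (intro integrable_norm Lp2_integrable_mult Lp2_conv f)
    show "integrable torus (\<lambda>x. B * I * norm (f x))" using fi by simp
    show "norm ((LINT y|torus. of_real (G (x - y)) * f y) * cnj (f x)) \<le> B * I * norm (f x)" for x
      unfolding norm_mult complex_mod_cnj I_def by (intro mult_right_mono norm_conv_le B fi) auto
  qed
  also have "\<dots> = B * I\<^sup>2" by (simp add: I_def[symmetric] power2_eq_square)
  finally show ?thesis by (simp add: I_def)
qed

text \<open>\<open>H_stable\<close> speaks of real densities. In the real part of the Hermitian form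
  the cross terms between real and imaginary parts cancel pointwise, which leaves two real
  instances.\<close>

lemma conv_op_H_stable:
  assumes "H_stable G"
  shows "0 \<le> Re (cinner (conv_op G u) u)"
proof -
  let ?f = "rep_L2 u"
  define a b where "a x = Re (?f x)" and "b x = Im (?f x)" for x
  have fm: "?f \<in> borel_measurable torus" and fi: "integrable torus (\<lambda>x. (norm (?f x))\<^sup>2)"
    using Lp2_rep[of u] by (auto simp: Lp2_iff)
  have Lp: "Lp 2 \<nu>" if m: "\<nu> \<in> borel_measurable torus" and le: "\<And>x. \<bar>\<nu> x\<bar> \<le> norm (?f x)" for \<nu> :: "real ^ 'n \<Rightarrow> real"
    unfolding Lp_def
  proof (intro conjI m Bochner_Integration.integrable_bound[OF fi])
    show "(\<lambda>x. norm (\<nu> x) powr 2) \<in> borel_measurable torus" using m by auto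
    have "(\<nu> x)\<^sup>2 \<le> (norm (?f x))\<^sup>2" for x using le[of x] by (metis abs_le_square_iff abs_norm_cancel)
    then show "AE x in torus. norm (norm (\<nu> x) powr 2) \<le> norm ((norm (?f x))\<^sup>2)" by simp
  qed
  have am: "a \<in> borel_measurable torus" "b \<in> borel_measurable torus"
    unfolding a_def[abs_def] b_def[abs_def] using fm by measurable
  have La: "Lp 2 a" "Lp 2 b"
    by (intro Lp am; simp add: a_def b_def abs_Re_le_cmod abs_Im_le_cmod)+
  have int: "integrable torus (\<lambda>x. complex_of_real (a x))" "integrable torus (\<lambda>x. complex_of_real (b x))"
    using Lp2_integrable[OF Lp2_rep, of u] unfolding a_def b_def by auto
  have i: "integrable (torus \<Otimes>\<^sub>M torus) (\<lambda>p. G (fst p - snd p) * \<nu> (fst p) * \<nu> (snd p))"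
    if "integrable torus (\<lambda>x. complex_of_real (\<nu> x))" for \<nu>
    using integrable_Re[OF pair_integrable[OF that that]] by (simp add: mult_ac)
  have f: "integrable torus ?f" and f': "integrable torus (\<lambda>x. cnj (?f x))"
    using Lp2_integrable[OF Lp2_rep, of u] by simp_all
  have "Re (cinner (conv_op G u) u) = (LINT p|(torus \<Otimes>\<^sub>M torus). Re (complex_of_real (G (fst p - snd p)) * ?f (snd p) * cnj (?f (fst p))))"
    using cinner_conv_op[OF Lp2_rep Lp2_rep, of u u] integral_Re[OF pair_integrable[OF f f']] by simp
  also have "\<dots> = (LINT p|(torus \<Otimes>\<^sub>M torus). G (fst p - snd p) * a (fst p) * a (snd p) + G (fst p - snd p) * b (fst p) * b (snd p))"
    by (rule Bochner_Integration.integral_cong[OF refl]) (simp add: a_def b_def algebra_simps)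
  also have "\<dots> = (LINT p|(torus \<Otimes>\<^sub>M torus). G (fst p - snd p) * a (fst p) * a (snd p)) + (LINT p|(torus \<Otimes>\<^sub>M torus). G (fst p - snd p) * b (fst p) * b (snd p))"
    by (intro Bochner_Integration.integral_add i int)
  also have "\<dots> \<ge> 0"
    by (rule add_nonneg_nonneg[OF assms[unfolded H_stable_def, rule_format, OF La(1)]
          assms[unfolded H_stable_def, rule_format, OF La(2)]])
  finally show ?thesis .
qed

end

section \<open>Consequences of the hypotheses on the interaction potential\<close>

text \<open>Continuity turns the essential bound into a bound everywhere: the closed set where |W|
  \<le> B contains almost all of the open cell, hence all of it, then its closure, and by
  periodicity the whole space. A number strictly between the essential supremum and \<sigma> keeps B
  < \<sigma>.\<close>

lemma esssup_bound:
  fixes W :: "real ^ 'n::finite \<Rightarrow> real"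
  assumes W: "continuous_on UNIV W" "periodic W" and sup: "esssup torus (\<lambda>x. ereal \<bar>W x\<bar>) < ereal \<sigma>" and \<sigma>: "\<sigma> > 0"
  obtains B where "0 \<le> B" "B < \<sigma>" "\<And>x. \<bar>W x\<bar> \<le> B"
proof -
  obtain c where c: "esssup torus (\<lambda>x. ereal \<bar>W x\<bar>) < ereal c" "ereal c < ereal \<sigma>"
    using ereal_dense2[OF sup] by blast
  define B where "B = max 0 c"
  have "AE x in torus. ereal \<bar>W x\<bar> \<le> esssup torus (\<lambda>x. ereal \<bar>W x\<bar>)"
    by (rule esssup_AE)
  then have "AE x in torus. \<bar>W x\<bar> \<le> B"
  proof eventually_elim
    case (elim x)
    then have "ereal \<bar>W x\<bar> < ereal c" using c(1) by (rule le_less_trans)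
    then show ?case by (simp add: B_def)
  qed
  then have "AE x in lborel. x \<in> cbox 0 (\<chi> i. 2 * pi) \<longrightarrow> \<bar>W x\<bar> \<le> B"
    unfolding torus_def by (subst (asm) AE_restrict_space_iff) auto
  then have "AE x in lebesgue. x \<in> cbox 0 (\<chi> i. 2 * pi) \<longrightarrow> \<bar>W x\<bar> \<le> B"
    by (rule AE_completion)
  then have ae: "AE x \<in> box 0 (\<chi> i. 2 * pi) in lebesgue. x \<in> {x. \<bar>W x\<bar> \<le> B}"
    by eventually_elim (use box_subset_cbox in auto)
  have cl: "closed {x. \<bar>W x\<bar> \<le> B}"
    by (intro closed_Collect_le continuous_intros W)
  have "box 0 (\<chi> i. 2 * pi) \<subseteq> {x. \<bar>W x\<bar> \<le> B}"
    using mem_closed_if_AE_lebesgue_open[OF open_box cl ae] by blast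
  then have "closure (box 0 (\<chi> i. 2 * pi)) \<subseteq> {x. \<bar>W x\<bar> \<le> B}"
    using cl by (rule closure_minimal)
  moreover have "closure (box 0 (\<chi> i. 2 * pi) :: (real ^ 'n) set) = cbox 0 (\<chi> i. 2 * pi)"
    by (rule closure_box) (auto simp: box_ne_empty Basis_vec_def inner_axis)
  ultimately have cell: "\<bar>W x\<bar> \<le> B" if "x \<in> cbox 0 (\<chi> i. 2 * pi)" for x using that by blast
  have "\<bar>W x\<bar> \<le> B" for x
  proof -
    obtain y where y: "y \<in> cbox 0 (\<chi> i. 2 * pi)" "\<And>g :: real ^ 'n \<Rightarrow> real. periodic g \<Longrightarrow> g x = g y"
      using periodic_cell[of x] by metis
    show ?thesis using cell[OF y(1)] y(2)[OF W(2)] by simp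
  qed
  moreover have "0 \<le> B" "B < \<sigma>" using c(2) \<sigma> by (auto simp: B_def)
  ultimately show thesis using that by blast
qed

text \<open>Evenness in each coordinate is applied once per coordinate, with the signs flipped on a
  growing set \<open>I\<close>.\<close>

lemma even_neg:
  fixes W :: "real ^ 'n::finite \<Rightarrow> real"
  assumes "even_in_each_coordinate W"
  shows "W (- x) = W x"
proof -
  have "W (\<chi> j. if j \<in> I then - x $ j else x $ j) = W x" if "finite I" for I
    using that
  proof (induction I rule: finite_induct)
    case empty
    then show ?case by simp
  next
    case (insert i I)
    let ?y = "(\<chi> j. if j \<in> I then - x $ j else x $ j) :: real ^ 'n"
    have "(\<chi> j. if j \<in> insert i I then - x $ j else x $ j) = (\<chi> j. if j = i then - ?y $ j else ?y $ j)"
      using insert(2) by (auto simp: vec_eq_iff)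
    then have "W (\<chi> j. if j \<in> insert i I then - x $ j else x $ j) = W ?y"
      by (simp only: assms[unfolded even_in_each_coordinate_def])
    then show ?case using insert by simp
  qed
  from this[of UNIV] show ?thesis by (simp add: uminus_vec_def)
qed

section \<open>The linearised McKean-Vlasov operator\<close>

lemma mk_L2_sum:
  fixes f :: "'i \<Rightarrow> real ^ 'n::finite \<Rightarrow> complex"
  assumes "finite I" "\<And>i. Lp 2 (f i)"
  shows "Lp 2 (\<lambda>x. \<Sum>i\<in>I. f i x) \<and> (\<Sum>i\<in>I. mk_L2 (f i)) = mk_L2 (\<lambda>x. \<Sum>i\<in>I. f i x)"
  using assms(1)
proof (induction I rule: finite_induct)
  case empty
  then show ?case by (simp add: Lp2_zero zero_L2_def)
next
  case (insert i I)
  have "Lp 2 (\<lambda>x. f i x + (\<Sum>i\<in>I. f i x))" using insert assms(2) by (intro Lp2_add) auto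
  moreover have "mk_L2 (f i) + (\<Sum>i\<in>I. mk_L2 (f i)) = mk_L2 (\<lambda>x. f i x + (\<Sum>i\<in>I. f i x))"
    using insert assms(2) by (simp add: mk_L2_add)
  ultimately show ?case using insert by simp
qed

lemma mk_L2_scaleR: "Lp 2 f \<Longrightarrow> r *\<^sub>R mk_L2 f = mk_L2 (\<lambda>x. of_real r * f x)"
  by (simp add: scaleR_scaleC mk_L2_scaleC)

lemma Ck_cmult:
  fixes f :: "real ^ 'n::finite \<Rightarrow> 'b::real_normed_algebra"
  shows "Ck k f \<Longrightarrow> Ck k (\<lambda>x. c * f x)"
  by (rule Ck_mult[OF Ck_const])

lemma pd_cmult:
  fixes f :: "real ^ 'n::finite \<Rightarrow> 'b::real_normed_algebra"
  shows "f differentiable (at x) \<Longrightarrow> pd i (\<lambda>x. c * f x) x = c * pd i f x"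
  by (rule pd_linear[OF bounded_linear_mult_right])

lemma Ck2D:
  assumes "Ck 2 f"
  shows "f differentiable (at x)" "pd i f differentiable (at x)" "Ck 1 f" "Ck 1 (pd i f)"
    "continuous_on UNIV f" "continuous_on UNIV (pd i f)" "continuous_on UNIV (pd i (pd j f))"
proof -
  have f: "Ck (Suc (Suc 0)) f" using assms by (simp only: numeral_2_eq_2)
  show "f differentiable (at x)" "pd i f differentiable (at x)" "Ck 1 (pd i f)"
    "continuous_on UNIV (pd i (pd j f))" using f by simp_all
  then show "continuous_on UNIV (pd i f)" by (rule_tac Ck_continuous)
  show "Ck 1 f" using Ck_le[OF assms, of 1] by simp
  show "continuous_on UNIV f" by (rule Ck_continuous[OF assms])
qed

text \<open>Here \<open>s\<close> is the square root of \<open>\<mu>\<close>, given as an explicit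
  exponential so that its derivatives come from those of \<open>v\<close>; \<open>\<kappa>\<close>
  is the normalization. The smallness alternative in \<open>interaction\<close> is already a
  pointwise bound.\<close>

locale stationary_setting =
  fixes \<sigma> \<kappa> :: real and W v s \<mu> :: "real ^ 'n::finite \<Rightarrow> real"
  assumes \<sigma>: "\<sigma> > 0" and \<kappa>: "\<kappa> > 0"
    and W: "Ck 2 W" "periodic W" and W_even: "W (- x) = W x"
    and v: "Ck 2 v" "periodic v"
    and s_eq: "s x = \<kappa> * exp (- (1 / (2 * \<sigma>)) * v x)"
    and \<mu>_eq: "\<mu> x = (s x)\<^sup>2"
    and mass: "(LINT x|torus. (s x)\<^sup>2) = 1"
    and interaction: "H_stable W \<or> (\<exists>B. 0 \<le> B \<and> B < \<sigma> \<and> (\<forall>x. \<bar>W x\<bar> \<le> B))"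
begin

lemma s_pos: "s x > 0"
  using \<kappa> by (simp add: s_eq)

lemma s_fun: "s = (\<lambda>x. \<kappa> * exp (- (1 / (2 * \<sigma>)) * v x))"
  by (rule ext) (rule s_eq)

lemma Ck_s: "Ck 2 s"
  unfolding s_fun by (intro Ck_cmult Ck_exp v)

lemma norm_grad_sq: "(norm (grad f x))\<^sup>2 = (\<Sum>i\<in>UNIV. (pd i f x)\<^sup>2)"
  unfolding power2_norm_eq_inner inner_vec_def grad_def by (simp add: power2_eq_square)

lemma periodic_s: "periodic s"
  using v(2) by (simp add: periodic_def s_eq)

lemmas s_C2 = Ck2D[OF Ck_s]
lemmas W_C2 = Ck2D[OF W(1)]
lemmas v_C2 = Ck2D[OF v(1)]

lemma pd_s: "pd i s x = - (1 / (2 * \<sigma>)) * (s x * pd i v x)"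
proof -
  have d: "(\<lambda>x. - (1 / (2 * \<sigma>)) * v x) differentiable (at x)"
    by (rule Ck2D(1)[OF Ck_cmult[OF v(1)]])
  have "pd i s x = \<kappa> * pd i (\<lambda>x. exp (- (1 / (2 * \<sigma>)) * v x)) x"
    unfolding s_fun by (rule pd_cmult[OF Ck2D(1)[OF Ck_exp[OF Ck_cmult[OF v(1)]]]])
  also have "pd i (\<lambda>x. exp (- (1 / (2 * \<sigma>)) * v x)) x = exp (- (1 / (2 * \<sigma>)) * v x) * pd i (\<lambda>x. - (1 / (2 * \<sigma>)) * v x) x"
    by (rule pd_exp[OF d])
  also have "pd i (\<lambda>x. - (1 / (2 * \<sigma>)) * v x) x = - (1 / (2 * \<sigma>)) * pd i v x"
    by (rule pd_cmult[OF v_C2(1)])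
  finally show ?thesis unfolding s_eq[of x] by (simp only: mult_ac)
qed

lemma pd_pd_s: "pd i (pd i s) x = s x * ((pd i v x)\<^sup>2 / (4 * \<sigma>\<^sup>2) - pd i (pd i v) x / (2 * \<sigma>))"
proof -
  have f: "pd i s = (\<lambda>x. - (1 / (2 * \<sigma>)) * (s x * pd i v x))" by (rule ext) (rule pd_s)
  have d: "(\<lambda>x. s x * pd i v x) differentiable (at x)"
    using Ck_mult[OF s_C2(3) v_C2(4)[of i]] by simp
  have "pd i (pd i s) x = - (1 / (2 * \<sigma>)) * pd i (\<lambda>x. s x * pd i v x) x"
    by (subst f) (rule pd_cmult[OF d])
  also have "pd i (\<lambda>x. s x * pd i v x) x = s x * pd i (pd i v) x + pd i s x * pd i v x"
    by (rule pd_mult[OF s_C2(1) v_C2(2)])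
  finally show ?thesis
    using \<sigma> unfolding pd_s[of i x] by (simp add: field_simps power2_eq_square)
qed

text \<open>The ground state identity: \<open>s\<close> lies in the kernel of \<open>H_loc\<close>.
  It is what cancels the potential term in \<open>K_op_factor\<close>.\<close>

lemma lap_s: "\<sigma> * (\<Sum>i\<in>UNIV. pd i (pd i s) x) = s x * Psi \<sigma> v x"
proof -
  have "\<sigma> * (\<Sum>i\<in>UNIV. pd i (pd i s) x) = s x * (\<Sum>i\<in>UNIV. (pd i v x)\<^sup>2 / (4 * \<sigma>) - pd i (pd i v) x / 2)"
    unfolding sum_distrib_left pd_pd_s
    by (rule sum.cong[OF refl]) (use \<sigma> in \<open>simp add: field_simps power2_eq_square\<close>)
  then show ?thesis
    by (simp add: Psi_def norm_grad_sq lap_def sum_subtractf sum_divide_distrib)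
qed

lemma sqrt_\<mu>: "sqrt (\<mu> x) = s x"
  using s_pos[of x] by (simp add: \<mu>_eq)

lemma pd_\<mu>: "pd i \<mu> x = 2 * s x * pd i s x"
proof -
  have "\<mu> = (\<lambda>x. s x * s x)" by (rule ext) (simp add: \<mu>_eq power2_eq_square)
  then show ?thesis using pd_mult[OF s_C2(1) s_C2(1), of i x] by simp
qed

text \<open>As \<mu> is the square of s, the division by s x disappears. What remains is a sum of
  functions of x times derivatives of W at x - y times s y, so K acts by convolutions with
  \<open>weighted u\<close>.\<close>

lemma kern_eq:
  "kern W \<mu> x y = - ((\<Sum>i\<in>UNIV. 2 * pd i s x * (pd i W (x - y) * s y)) + s x * (lap W (x - y) * s y))"
proof -
  have g: "grad \<mu> x \<bullet> grad W (x - y) = s x * (\<Sum>i\<in>UNIV. 2 * pd i s x * pd i W (x - y))"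
    by (simp add: grad_def inner_vec_def pd_\<mu> sum_distrib_left mult_ac)
  have "kern W \<mu> x y = - (s y / s x) * (s x * (\<Sum>i\<in>UNIV. 2 * pd i s x * pd i W (x - y)) + (s x)\<^sup>2 * lap W (x - y))"
    unfolding kern_def sqrt_\<mu> g unfolding \<mu>_eq[of x] ..
  also have "\<dots> = - (s y * (\<Sum>i\<in>UNIV. 2 * pd i s x * pd i W (x - y)) + s x * (lap W (x - y) * s y))"
    using s_pos[of x] by (simp add: field_simps power2_eq_square)
  also have "s y * (\<Sum>i\<in>UNIV. 2 * pd i s x * pd i W (x - y)) = (\<Sum>i\<in>UNIV. 2 * pd i s x * (pd i W (x - y) * s y))"
    by (simp add: sum_distrib_left mult_ac)
  finally show ?thesis .
qed

lemma cont_Psi: "continuous_on UNIV (Psi \<sigma> v)"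
proof -
  have "Psi \<sigma> v = (\<lambda>x. 1 / (4 * \<sigma>) * (\<Sum>i\<in>UNIV. (pd i v x)\<^sup>2) - 1 / 2 * (\<Sum>i\<in>UNIV. pd i (pd i v) x))"
    by (rule ext) (simp add: Psi_def lap_def norm_grad_sq)
  then show ?thesis
    by (simp only:) (intro continuous_intros v_C2)
qed

lemma lap_W: "continuous_on UNIV (lap W)" "periodic (lap W)"
proof -
  show "continuous_on UNIV (lap W)"
    unfolding lap_def[abs_def] by (intro continuous_intros W_C2)
  have "periodic (pd i (pd i W))" for i
    by (intro periodic_pd W(2) W_C2)
  then show "periodic (lap W)" by (simp add: lap_def periodic_def)
qed

lemma pd_W: "continuous_on UNIV (pd i W)" "periodic (pd i W)"
  by (intro W_C2, intro periodic_pd W(2) W_C2)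

definition weighted :: "'n L2 \<Rightarrow> real ^ 'n \<Rightarrow> complex" where
  "weighted u y = of_real (s y) * rep_L2 u y"

text \<open>The convolution of W with s u: the potential generated by the density perturbation s
  u.\<close>

definition force :: "'n L2 \<Rightarrow> real ^ 'n \<Rightarrow> complex" where
  "force u x = (LINT y|torus. of_real (W (x - y)) * weighted u y)"

lemma Lp2_weighted: "Lp 2 (weighted u)"
  unfolding weighted_def[abs_def] by (rule Lp2_mul[OF s_C2(5) Lp2_rep])

lemma mk_weighted: "mk_L2 (weighted u) = mul_op s u"
  unfolding weighted_def[abs_def] mul_op_def ..

lemma weighted_integrable: "integrable torus (weighted u)"
  by (rule Lp2_integrable[OF Lp2_weighted])

lemma pd_of_real:
  assumes "f differentiable (at x)"
  shows "pd i (\<lambda>x. complex_of_real (f x)) x = of_real (pd i f x)"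
  by (rule pd_linear[OF bounded_linear_of_real assms])

lemma Ck_force: "Ck 2 (force u)"
  unfolding force_def[abs_def]
  using Ck_conv[OF weighted_integrable Ck_linear[OF bounded_linear_of_real W(1)]] .

lemmas force_C2 = Ck2D[OF Ck_force]

lemma periodic_force: "periodic (force u)"
  unfolding force_def[abs_def]
  using periodic_conv[of "\<lambda>x. complex_of_real (W x)"] W(2) by (simp add: periodic_def)

lemma pd_force: "pd i (force u) x = (LINT y|torus. of_real (pd i W (x - y)) * weighted u y)"
  unfolding force_def[abs_def]
  by (simp add: pd_conv[of "\<lambda>x. complex_of_real (W x)", OF Ck_linear[OF bounded_linear_of_real W_C2(3)] weighted_integrable]
      pd_of_real W_C2)

lemma pd_pd_force: "pd i (pd i (force u)) x = (LINT y|torus. of_real (pd i (pd i W) (x - y)) * weighted u y)"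
proof -
  have f: "pd i (force u) = (\<lambda>x. LINT y|torus. of_real (pd i W (x - y)) * weighted u y)" by (rule ext) (rule pd_force)
  show ?thesis
    unfolding f
    by (simp add: pd_conv[of "\<lambda>x. complex_of_real (pd i W x)", OF Ck_linear[OF bounded_linear_of_real W_C2(4)] weighted_integrable]
        pd_of_real W_C2)
qed

definition C_op :: "'n L2 \<Rightarrow> 'n L2" where
  "C_op u = (1 / \<sigma>) *\<^sub>R mul_op s (conv_op W (mul_op s u))"

text \<open>A twice continuously differentiable representative of \<open>C_op u\<close>, on which
  derivatives are taken classically.\<close>

definition potential :: "'n L2 \<Rightarrow> real ^ 'n \<Rightarrow> complex" where
  "potential u x = of_real (1 / \<sigma>) * (of_real (s x) * force u x)"

lemma Ck_sc: "Ck 2 (\<lambda>x. complex_of_real (s x))"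
  by (rule Ck_linear[OF bounded_linear_of_real Ck_s])

lemmas sc_C2 = Ck2D[OF Ck_sc]

lemma C_op_eq: "C_op u = mk_L2 (potential u)"
proof -
  have L: "Lp 2 (force u)" by (rule continuous_Lp2[OF force_C2(5)])
  have "conv_op W (mul_op s u) = mk_L2 (force u)"
    unfolding mk_weighted[symmetric] force_def[abs_def]
    by (rule conv_op_mk_L2[OF W_C2(5) W(2) Lp2_weighted])
  then show ?thesis
    unfolding C_op_def potential_def[abs_def]
    by (simp only: mul_op_mk_L2[OF s_C2(5) L] mk_L2_scaleR[OF Lp2_mul[OF s_C2(5) L]])
qed

lemma Ck_potential: "Ck 2 (potential u)"
  unfolding potential_def[abs_def] by (intro Ck_cmult Ck_mult Ck_sc Ck_force)

lemma periodic_potential: "periodic (potential u)"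
  unfolding potential_def[abs_def] using periodic_s periodic_force[of u] by (simp add: periodic_def)

lemma pd_pd_potential:
  "pd i (pd i (potential u)) x = of_real (1 / \<sigma>) *
     (of_real (s x) * pd i (pd i (force u)) x + 2 * of_real (pd i s x) * pd i (force u) x + of_real (pd i (pd i s) x) * force u x)"
proof -
  let ?S = "\<lambda>x. complex_of_real (s x)"
  have pS: "pd i ?S = (\<lambda>x. of_real (pd i s x))" by (rule ext) (rule pd_of_real[OF s_C2(1)])
  have ppS: "pd i (pd i ?S) x = of_real (pd i (pd i s) x)" unfolding pS by (rule pd_of_real[OF s_C2(2)])
  have prod: "Ck 2 (\<lambda>x. ?S x * force u x)" by (intro Ck_mult Ck_sc Ck_force)
  have p1: "pd i (potential u) = (\<lambda>x. of_real (1 / \<sigma>) * (?S x * pd i (force u) x + pd i ?S x * force u x))"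
  proof
    fix x
    have "pd i (potential u) x = of_real (1 / \<sigma>) * pd i (\<lambda>x. ?S x * force u x) x"
      unfolding potential_def[abs_def] by (rule pd_cmult[OF Ck2D(1)[OF prod]])
    also have "pd i (\<lambda>x. ?S x * force u x) x = ?S x * pd i (force u) x + pd i ?S x * force u x"
      by (rule pd_mult[OF sc_C2(1) force_C2(1)])
    finally show "pd i (potential u) x = of_real (1 / \<sigma>) * (?S x * pd i (force u) x + pd i ?S x * force u x)" .
  qed
  have C1: "Ck 1 (\<lambda>x. ?S x * pd i (force u) x)" "Ck 1 (\<lambda>x. pd i ?S x * force u x)"
    by (intro Ck_mult sc_C2 force_C2)+
  have d: "(\<lambda>x. ?S x * pd i (force u) x) differentiable (at x)" "(\<lambda>x. pd i ?S x * force u x) differentiable (at x)"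
    "(\<lambda>x. ?S x * pd i (force u) x + pd i ?S x * force u x) differentiable (at x)"
    using C1 Ck_add[OF C1] by simp_all
  have "pd i (pd i (potential u)) x = of_real (1 / \<sigma>) * pd i (\<lambda>x. ?S x * pd i (force u) x + pd i ?S x * force u x) x"
    unfolding p1 by (rule pd_cmult[OF d(3)])
  also have "pd i (\<lambda>x. ?S x * pd i (force u) x + pd i ?S x * force u x) x
      = pd i (\<lambda>x. ?S x * pd i (force u) x) x + pd i (\<lambda>x. pd i ?S x * force u x) x"
    by (rule pd_add[OF d(1,2)])
  also have "pd i (\<lambda>x. ?S x * pd i (force u) x) x = ?S x * pd i (pd i (force u)) x + pd i ?S x * pd i (force u) x"
    by (rule pd_mult[OF sc_C2(1) force_C2(2)])
  also have "pd i (\<lambda>x. pd i ?S x * force u x) x = pd i ?S x * pd i (force u) x + pd i (pd i ?S) x * force u x"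
    by (rule pd_mult[OF sc_C2(2) force_C2(1)])
  finally show ?thesis unfolding ppS fun_cong[OF pS] by (simp add: algebra_simps)
qed

lemma C_op_H2: "C_op u \<in> H2"
  unfolding C_op_eq by (rule H2_classical(1)[OF Ck_potential periodic_potential])

definition K_fun :: "'n L2 \<Rightarrow> real ^ 'n \<Rightarrow> complex" where
  "K_fun u x = - ((\<Sum>i\<in>UNIV. of_real (2 * pd i s x) * pd i (force u) x) + of_real (s x) * (\<Sum>i\<in>UNIV. pd i (pd i (force u)) x))"

lemma K_op_eq: "K_op W \<mu> u = mk_L2 (K_fun u)"
proof -
  have int1: "integrable torus (\<lambda>y. complex_of_real (pd i W (x - y)) * weighted u y)" for i x
    by (rule integrable_conv_op[OF pd_W weighted_integrable])
  have int2: "integrable torus (\<lambda>y. complex_of_real (pd i (pd i W) (x - y)) * weighted u y)" for i x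
    by (rule integrable_conv_op[OF W_C2(7) periodic_pd[OF pd_W(2) W_C2(2)] weighted_integrable])
  have "(LINT y|torus. complex_of_real (kern W \<mu> x y) * rep_L2 u y) = K_fun u x" for x
  proof -
    have "(LINT y|torus. complex_of_real (kern W \<mu> x y) * rep_L2 u y) =
      (LINT y|torus. - ((\<Sum>i\<in>UNIV. of_real (2 * pd i s x) * (of_real (pd i W (x - y)) * weighted u y)) +
         of_real (s x) * (\<Sum>i\<in>UNIV. of_real (pd i (pd i W) (x - y)) * weighted u y)))"
      unfolding kern_eq lap_def weighted_def
      by (rule Bochner_Integration.integral_cong[OF refl])
         (simp add: sum_distrib_left sum_distrib_right algebra_simps)
    also have "\<dots> = - ((\<Sum>i\<in>UNIV. of_real (2 * pd i s x) * (LINT y|torus. of_real (pd i W (x - y)) * weighted u y)) +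
         of_real (s x) * (\<Sum>i\<in>UNIV. LINT y|torus. of_real (pd i (pd i W) (x - y)) * weighted u y))"
    proof -
      let ?A = "\<lambda>y. \<Sum>i\<in>UNIV. of_real (2 * pd i s x) * (complex_of_real (pd i W (x - y)) * weighted u y)"
      let ?B = "\<lambda>y. \<Sum>i\<in>UNIV. complex_of_real (pd i (pd i W) (x - y)) * weighted u y"
      have A: "integrable torus ?A" "(LINT y|torus. ?A y) = (\<Sum>i\<in>UNIV. of_real (2 * pd i s x) * (LINT y|torus. of_real (pd i W (x - y)) * weighted u y))"
        using int1 by (simp_all add: Bochner_Integration.integral_sum Bochner_Integration.integrable_sum)
      have B: "integrable torus ?B" "(LINT y|torus. ?B y) = (\<Sum>i\<in>UNIV. LINT y|torus. of_real (pd i (pd i W) (x - y)) * weighted u y)"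
        using int2 by (simp_all add: Bochner_Integration.integral_sum Bochner_Integration.integrable_sum)
      have "(LINT y|torus. - (?A y + of_real (s x) * ?B y)) = - ((LINT y|torus. ?A y) + of_real (s x) * (LINT y|torus. ?B y))"
        using A(1) B(1) by simp
      then show ?thesis by (simp only: A(2) B(2))
    qed
    finally show ?thesis by (simp only: K_fun_def pd_force pd_pd_force)
  qed
  then show ?thesis by (simp add: K_op_def K_fun_def[abs_def])
qed

lemma H_loc_eq: "H_loc \<sigma> v w = - (\<sigma> *\<^sub>R weak_lap w) + mul_op (Psi \<sigma> v) w"
  by (simp add: H_loc_def mul_op_def)

text \<open>Put g = force u / \<sigma>. The product rule splits -\<sigma> times the Laplacian of s g
  into three terms. The one with the Laplacian of s equals -Psi s g by \<open>lap_s\<close> and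
  cancels the potential; those with the gradient and the Laplacian of g form
  \<open>K_fun u\<close>.\<close>

lemma K_op_factor: "K_op W \<mu> u = H_loc \<sigma> v (C_op u)"
proof -
  let ?L = "\<lambda>x. \<Sum>i\<in>UNIV. pd i (pd i (potential u)) x"
  have Lp: "Lp 2 (potential u)" by (rule continuous_Lp2[OF Ck_continuous[OF Ck_potential]])
  have LL: "Lp 2 ?L" by (intro continuous_Lp2 continuous_intros Ck2D(7)[OF Ck_potential])
  have "- (\<sigma> *\<^sub>R mk_L2 ?L) = mk_L2 (\<lambda>x. of_real (- \<sigma>) * ?L x)"
    by (simp only: mk_L2_scaleR[OF LL, of "- \<sigma>", symmetric] scaleR_minus_left)
  then have "H_loc \<sigma> v (C_op u) = mk_L2 (\<lambda>x. of_real (- \<sigma>) * ?L x + of_real (Psi \<sigma> v x) * potential u x)"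
    by (simp only: H_loc_eq C_op_eq H2_classical(2)[OF Ck_potential periodic_potential]
        mul_op_mk_L2[OF cont_Psi Lp] mk_L2_add[OF Lp2_cmult[OF LL] Lp2_mul[OF cont_Psi Lp]])
  also have "(\<lambda>x. of_real (- \<sigma>) * ?L x + of_real (Psi \<sigma> v x) * potential u x) = K_fun u"
  proof
    fix x
    let ?g = "force u x"
    have "of_real (- \<sigma>) * ?L x = - (\<Sum>i\<in>UNIV. of_real (s x) * pd i (pd i (force u)) x +
        of_real (2 * pd i s x) * pd i (force u) x + of_real (pd i (pd i s) x) * ?g)"
      unfolding pd_pd_potential sum_distrib_left sum_negf[symmetric]
      by (rule sum.cong[OF refl]) (use \<sigma> in \<open>simp add: field_simps\<close>)
    also have "\<dots> = K_fun u x - of_real (\<Sum>i\<in>UNIV. pd i (pd i s) x) * ?g"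
      by (simp add: K_fun_def sum.distrib sum_distrib_left sum_distrib_right)
    also have "of_real (\<Sum>i\<in>UNIV. pd i (pd i s) x) * ?g = of_real (Psi \<sigma> v x) * potential u x"
    proof -
      have "(\<Sum>i\<in>UNIV. pd i (pd i s) x) = Psi \<sigma> v x * (1 / \<sigma>) * s x"
        using lap_s[of x] \<sigma> by (simp add: field_simps)
      then show ?thesis by (simp add: potential_def)
    qed
    finally show "of_real (- \<sigma>) * ?L x + of_real (Psi \<sigma> v x) * potential u x = K_fun u x" by simp
  qed
  finally show ?thesis by (simp add: K_op_eq)
qed

text \<open>Boundedness is not visible from \<open>K_op_factor\<close>, where \<open>H_loc\<close>
  is unbounded. It comes from writing K as a finite sum of multiplications and convolutions with
  continuous derivatives of W.\<close>

lemma bounded_linear_K: "bounded_linear (K_op W \<mu>)"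
  and K_scaleC: "K_op W \<mu> (c *\<^sub>C u) = c *\<^sub>C K_op W \<mu> u"
proof -
  define T where "T = (\<lambda>u. (\<Sum>i\<in>UNIV. mul_op (\<lambda>x. - 2 * pd i s x) (conv_op (pd i W) (mul_op s u)))
      + mul_op (\<lambda>x. - s x) (conv_op (lap W) (mul_op s u)))"
  have c1: "continuous_on UNIV (\<lambda>x. - 2 * pd i s x)" for i by (intro continuous_intros s_C2)
  have c2: "continuous_on UNIV (\<lambda>x. - s x)" by (intro continuous_intros s_C2)
  have eq: "K_op W \<mu> u = T u" for u
  proof -
    have Lf: "Lp 2 (pd i (force u))" for i by (rule continuous_Lp2[OF force_C2(6)])
    have LF: "Lp 2 (\<lambda>x. \<Sum>i\<in>UNIV. pd i (pd i (force u)) x)" by (intro continuous_Lp2 continuous_intros force_C2)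
    have 1: "conv_op (pd i W) (mul_op s u) = mk_L2 (pd i (force u))" for i
      unfolding mk_weighted[symmetric] conv_op_mk_L2[OF pd_W Lp2_weighted] pd_force[symmetric] ..
    have lapf: "(LINT y|torus. complex_of_real (lap W (x - y)) * weighted u y) = (\<Sum>i\<in>UNIV. pd i (pd i (force u)) x)" for x
    proof -
      have int2: "integrable torus (\<lambda>y. complex_of_real (pd i (pd i W) (x - y)) * weighted u y)" for i
        by (rule integrable_conv_op[OF W_C2(7) periodic_pd[OF pd_W(2) W_C2(2)] weighted_integrable])
      have "(LINT y|torus. complex_of_real (lap W (x - y)) * weighted u y) =
          (LINT y|torus. (\<Sum>i\<in>UNIV. complex_of_real (pd i (pd i W) (x - y)) * weighted u y))"
        by (simp add: lap_def sum_distrib_right)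
      also have "\<dots> = (\<Sum>i\<in>UNIV. LINT y|torus. complex_of_real (pd i (pd i W) (x - y)) * weighted u y)"
        by (rule Bochner_Integration.integral_sum[OF int2])
      finally show ?thesis by (simp only: pd_pd_force)
    qed
    have 2: "conv_op (lap W) (mul_op s u) = mk_L2 (\<lambda>x. \<Sum>i\<in>UNIV. pd i (pd i (force u)) x)"
      unfolding mk_weighted[symmetric] conv_op_mk_L2[OF lap_W Lp2_weighted] lapf ..
    have S: "Lp 2 (\<lambda>x. \<Sum>i\<in>UNIV. complex_of_real (- 2 * pd i s x) * pd i (force u) x) \<and>
      (\<Sum>i\<in>UNIV. mk_L2 (\<lambda>x. complex_of_real (- 2 * pd i s x) * pd i (force u) x)) =
        mk_L2 (\<lambda>x. \<Sum>i\<in>UNIV. complex_of_real (- 2 * pd i s x) * pd i (force u) x)"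
      by (rule mk_L2_sum[OF finite Lp2_mul[OF c1 Lf]])
    have "T u = mk_L2 (\<lambda>x. (\<Sum>i\<in>UNIV. complex_of_real (- 2 * pd i s x) * pd i (force u) x) +
        complex_of_real (- s x) * (\<Sum>i\<in>UNIV. pd i (pd i (force u)) x))"
      unfolding T_def 1 2 mul_op_mk_L2[OF c1 Lf] mul_op_mk_L2[OF c2 LF]
      using mk_L2_add[OF conjunct1[OF S] Lp2_mul[OF c2 LF]] conjunct2[OF S] by simp
    also have "(\<lambda>x. (\<Sum>i\<in>UNIV. complex_of_real (- 2 * pd i s x) * pd i (force u) x) +
        complex_of_real (- s x) * (\<Sum>i\<in>UNIV. pd i (pd i (force u)) x)) = K_fun u"
      by (rule ext) (simp add: K_fun_def sum_negf)
    finally show ?thesis by (simp add: K_op_eq)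
  qed
  have "bounded_linear T"
    unfolding T_def
    by (intro bounded_linear_add bounded_linear_sum bounded_linear_compose[OF bounded_linear_mul_op[OF c1]]
        bounded_linear_compose[OF bounded_linear_mul_op[OF c2]] bounded_linear_compose[OF bounded_linear_conv_op[OF pd_W]]
        bounded_linear_compose[OF bounded_linear_conv_op[OF lap_W]] bounded_linear_mul_op s_C2)
  moreover have "K_op W \<mu> = T" by (rule ext) (rule eq)
  ultimately show "bounded_linear (K_op W \<mu>)" by simp
  have "T (c *\<^sub>C u) = c *\<^sub>C T u"
    unfolding T_def
    by (simp only: mul_op_scaleC[OF s_C2(5)] conv_op_scaleC[OF pd_W] conv_op_scaleC[OF lap_W] mul_op_scaleC[OF c1]
        mul_op_scaleC[OF c2] cvec.scale_right_distrib cvec.scale_sum_right)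
  then show "K_op W \<mu> (c *\<^sub>C u) = c *\<^sub>C K_op W \<mu> u" by (simp only: eq)
qed

section \<open>The operator M = 1 + C: symmetry and coercivity\<close>

definition M_op :: "'n L2 \<Rightarrow> 'n L2" where
  "M_op u = u + C_op u"

lemma cinner_C_op: "cinner (C_op u) w = of_real (1 / \<sigma>) * cinner (conv_op W (mul_op s u)) (mul_op s w)"
  by (simp only: C_op_def scaleR_scaleC cinner_scaleC_left mul_op_sym[OF s_C2(5)])

text \<open>Here m becomes the coercivity constant of 1 + C. For H-stable W the form of C is
  nonnegative and m = 1; otherwise m = 1 - B / \<sigma>, because the integral of s |u| is at most
  the norm of u.\<close>

lemma C_op_lower: "\<exists>m>0. \<forall>u. - (1 - m) * (norm u)\<^sup>2 \<le> Re (cinner (C_op u) u)"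
proof -
  have Re: "Re (cinner (C_op u) u) = 1 / \<sigma> * Re (cinner (conv_op W (mul_op s u)) (mul_op s u))" for u
    by (simp add: cinner_C_op)
  from interaction show ?thesis
  proof
    assume "H_stable W"
    then have "0 \<le> Re (cinner (C_op u) u)" for u
      unfolding Re using \<sigma> conv_op_H_stable[OF W_C2(5) W(2)] by (intro mult_nonneg_nonneg) auto
    then show ?thesis by (intro exI[of _ 1]) auto
  next
    assume "\<exists>B. 0 \<le> B \<and> B < \<sigma> \<and> (\<forall>x. \<bar>W x\<bar> \<le> B)"
    then obtain B where B: "0 \<le> B" "B < \<sigma>" "\<And>x. \<bar>W x\<bar> \<le> B" by blast
    have Ls: "Lp 2 (\<lambda>x. complex_of_real (s x))" by (rule continuous_Lp2[OF sc_C2(5)])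
    \<comment> \<open>This is the total mass one of the density, the only place where its
      normalization affects the constants.\<close>
    have ns: "norm (mk_L2 (\<lambda>x. complex_of_real (s x))) = 1"
    proof (rule power2_eq_imp_eq)
      show "(norm (mk_L2 (\<lambda>x. complex_of_real (s x))))\<^sup>2 = 1\<^sup>2" by (simp add: norm_mk_L2[OF Ls] mass)
    qed auto
    have "- (1 - (1 - B / \<sigma>)) * (norm u)\<^sup>2 \<le> Re (cinner (C_op u) u)" for u
    proof -
      have "(LINT x|torus. norm (weighted u x)) = (LINT x|torus. norm (complex_of_real (s x)) * norm (rep_L2 u x))"
        by (simp add: weighted_def norm_mult)
      also have "\<dots> \<le> 1 * norm u"
        using integral_norm_mult_le[OF Ls Lp2_rep, of u] by (simp add: ns)
      finally have I: "(LINT x|torus. norm (weighted u x)) \<le> norm u" by simp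
      have "norm (cinner (conv_op W (mul_op s u)) (mul_op s u)) \<le> B * (LINT x|torus. norm (weighted u x))\<^sup>2"
        unfolding mk_weighted[symmetric] by (rule norm_cinner_conv_op_le[OF W_C2(5) W(2) B(3) Lp2_weighted])
      also have "\<dots> \<le> B * (norm u)\<^sup>2"
        using B(1) I by (intro mult_left_mono power_mono) (auto intro: integral_nonneg_AE)
      finally have "- (B * (norm u)\<^sup>2) \<le> Re (cinner (conv_op W (mul_op s u)) (mul_op s u))"
        using abs_Re_le_cmod[of "cinner (conv_op W (mul_op s u)) (mul_op s u)"] by linarith
      then have "1 / \<sigma> * (- (B * (norm u)\<^sup>2)) \<le> 1 / \<sigma> * Re (cinner (conv_op W (mul_op s u)) (mul_op s u))"
        using \<sigma> by (intro mult_left_mono) auto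
      then show ?thesis unfolding Re by simp
    qed
    moreover have "1 - B / \<sigma> > 0" using B \<sigma> by simp
    ultimately show ?thesis by blast
  qed
qed

lemma equivalent_form_M: "\<exists>m. equivalent_form (M_op :: 'n L2 \<Rightarrow> 'n L2) m"
proof -
  obtain m where m: "m > 0" "\<And>u. - (1 - m) * (norm u)\<^sup>2 \<le> Re (cinner (C_op u) u)"
    using C_op_lower by blast
  have "equivalent_form (M_op :: 'n L2 \<Rightarrow> 'n L2) m"
  proof (rule equivalent_form.intro)
    show "bounded_linear (M_op :: 'n L2 \<Rightarrow> 'n L2)"
      unfolding M_op_def[abs_def] C_op_def
      by (intro bounded_linear_add bounded_linear_ident bounded_linear_compose[OF bounded_linear_scaleR_right]
          bounded_linear_compose[OF bounded_linear_mul_op[OF s_C2(5)]] bounded_linear_compose[OF bounded_linear_conv_op[OF W_C2(5) W(2)]]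
          bounded_linear_mul_op[OF s_C2(5)])
    show "M_op (c *\<^sub>C u) = c *\<^sub>C M_op u" for c and u :: "'n L2"
      by (simp only: M_op_def C_op_def mul_op_scaleC[OF s_C2(5)] conv_op_scaleC[OF W_C2(5) W(2)]
          scaleC_scaleR_commute cvec.scale_right_distrib)
    show "cinner (M_op u) w = cinner u (M_op w)" for u w :: "'n L2"
    proof -
      have "cinner (C_op u) w = cinner u (C_op w)"
        unfolding cinner_C_op conv_op_sym[OF W_C2(5) W(2) W_even] mul_op_sym[OF s_C2(5)]
        by (simp only: C_op_def scaleR_scaleC cinner_scaleC_right complex_cnj_complex_of_real)
      then show ?thesis by (simp add: M_op_def cinner_add_left cinner_add_right)
    qed
    show "m > 0" by (rule m)
    show "m * (norm u)\<^sup>2 \<le> Re (cinner (M_op u) u)" for u :: "'n L2"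
    proof -
      have "Re (cinner (M_op u) u) = (norm u)\<^sup>2 + Re (cinner (C_op u) u)"
        by (simp only: M_op_def cinner_add_left cinner_self plus_complex.sel Re_complex_of_real)
      then show ?thesis using m(2)[of u] by (simp add: algebra_simps)
    qed
  qed
  then show ?thesis ..
qed

section \<open>The full operator: symmetry for the new inner product and inversion after a
  shift\<close>

definition H :: "'n L2 \<Rightarrow> 'n L2" where
  "H u = H_loc \<sigma> v u + K_op W \<mu> u"

lemma H_factor: "u \<in> H2 \<Longrightarrow> H u = H_loc \<sigma> v (M_op u)"
  using C_op_H2[of u]
  by (simp add: H_def K_op_factor M_op_def H_loc_eq weak_lap_add mul_op_add[OF cont_Psi] scaleR_add_right)

lemma H_loc_sym:
  assumes "u \<in> H2" "w \<in> H2"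
  shows "cinner (H_loc \<sigma> v u) w = cinner u (H_loc \<sigma> v w)"
  by (simp add: H_loc_eq cinner_add_left cinner_add_right cinner.minus_left cinner.minus_right
      cinner.scaleR_left cinner.scaleR_right cinner.diff_left cinner.diff_right weak_lap_sym[OF assms] mul_op_sym[OF cont_Psi])

lemma H_spectral:
  "\<exists>M m R c. symmetric_compact_resolvent M m (H2 :: 'n L2 set) H R c"
proof -
  obtain m where "equivalent_form (M_op :: 'n L2 \<Rightarrow> 'n L2) m" using equivalent_form_M by blast
  then interpret equivalent_form "M_op :: 'n L2 \<Rightarrow> 'n L2" m .
  \<comment> \<open>H is -\<sigma> times the Laplacian plus this bounded operator. The factorization
    through \<open>M_op\<close> enters below only for symmetry and positivity.\<close>
  define B where "B u = mul_op (Psi \<sigma> v) u + K_op W \<mu> u" for u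
  have B: "bounded_linear B"
    unfolding B_def by (intro bounded_linear_add bounded_linear_mul_op[OF cont_Psi] bounded_linear_K)
  have B_scaleC: "B (c *\<^sub>C u) = c *\<^sub>C B u" for c u
    by (simp only: B_def mul_op_scaleC[OF cont_Psi] K_scaleC cvec.scale_right_distrib)
  obtain \<beta> where \<beta>: "\<beta> \<ge> 0" "\<And>u. norm (B u) \<le> norm u * \<beta>"
    using bounded_linear.nonneg_bounded[OF B] by blast
  obtain \<psi> where \<psi>: "\<psi> \<ge> 0" "\<And>u. norm (mul_op (Psi \<sigma> v) u) \<le> norm u * \<psi>"
    using bounded_linear.nonneg_bounded[OF bounded_linear_mul_op[OF cont_Psi]] by blast
  obtain L where L: "L \<ge> 0" "\<And>u. norm (M_op u) \<le> norm u * L"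
    using M.nonneg_bounded by blast
  \<comment> \<open>The term 2 \<beta> makes B T a contraction with factor 1/2, since T has norm at
    most 1 / c. The term \<psi> \<open>L\<^sup>2\<close> / m lets c b u u absorb the negative part
    of the potential; adding 1 makes this strict and c positive.\<close>
  define c where "c = 2 * \<beta> + \<psi> * L\<^sup>2 / m + 1"
  have c: "c > 0" "2 * \<beta> \<le> c" "\<psi> * L\<^sup>2 < c * m"
    using \<beta>(1) \<psi>(1) m_pos by (auto simp: c_def distrib_right add_nonneg_pos intro!: add_nonneg_nonneg)
  obtain T :: "'n L2 \<Rightarrow> 'n L2" where T_compact: "compact_operator T"
    and T_scaleC: "\<And>a u. T (a *\<^sub>C u) = a *\<^sub>C T u" and T_norm: "\<And>u. norm (T u) \<le> (1 / c) * norm u"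
    and T_H2: "\<And>u. T u \<in> H2" and T1: "\<And>u. - (\<sigma> *\<^sub>R weak_lap (T u)) + c *\<^sub>R T u = u"
    and T2: "\<And>u. u \<in> H2 \<Longrightarrow> T (- (\<sigma> *\<^sub>R weak_lap u) + c *\<^sub>R u) = u"
    using laplace_resolvent[OF \<sigma> c(1)] by blast
  have P: "bounded_linear (\<lambda>u. B (T u))"
    by (rule bounded_linear_compose[OF B compact_operator_linear[OF T_compact]])
  have P_le: "norm (B (T u)) \<le> (1 / 2) * norm u" for u
  proof -
    have "norm (B (T u)) \<le> norm (T u) * \<beta>" by (rule \<beta>)
    also have "\<dots> \<le> (1 / c) * norm u * \<beta>" by (intro mult_right_mono T_norm \<beta>)
    also have "\<dots> = (\<beta> / c) * norm u" by simp
    also have "\<dots> \<le> (1 / 2) * norm u" using c by (intro mult_right_mono) (auto simp: field_simps)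
    finally show ?thesis .
  qed
  define G where "G u = u + B (T u)" for u
  have G: "bij G" "bounded_linear (inv G)"
    unfolding G_def[abs_def] by (rule bij_add_contraction[OF P _ _ P_le]; simp)+
  have G1: "G (inv G f) = f" for f by (rule surj_f_inv_f[OF bij_is_surj[OF G(1)]])
  have G2: "inv G (G f) = f" for f by (rule inv_f_f[OF bij_is_inj[OF G(1)]])
  define R where "R f = T (inv G f)" for f
  \<comment> \<open>(H + c) T = 1 + B T, so T after the inverse of 1 + B T is a right inverse of H +
    c. It is also a left inverse, because every u in \<open>H2\<close> has the form T g.\<close>
  have H_T: "H (T g) + c *\<^sub>R T g = G g" for g
  proof -
    have "H (T g) + c *\<^sub>R T g = (- (\<sigma> *\<^sub>R weak_lap (T g)) + c *\<^sub>R T g) + B (T g)"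
      by (simp add: H_def H_loc_eq B_def)
    then show ?thesis by (simp only: T1 G_def)
  qed
  have "symmetric_compact_resolvent M_op m (H2 :: 'n L2 set) H R c"
  proof
    show "compact_operator R"
      unfolding R_def[abs_def] by (rule compact_operator_compose_right[OF T_compact G(2)])
    show "R (z *\<^sub>C u) = z *\<^sub>C R u" for z u
    proof -
      have "G (z *\<^sub>C inv G u) = z *\<^sub>C u"
        using G1[of u] by (simp add: G_def T_scaleC B_scaleC cvec.scale_right_distrib[symmetric])
      then have "inv G (z *\<^sub>C u) = z *\<^sub>C inv G u" using G2 by metis
      then show ?thesis by (simp add: R_def T_scaleC)
    qed
    show "R f \<in> H2" for f by (simp add: R_def T_H2)
    show "H (R f) + c *\<^sub>R R f = f" for f by (simp add: R_def H_T G1)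
    show "R (H u + c *\<^sub>R u) = u" if "u \<in> H2" for u
    proof -
      define g where "g = - (\<sigma> *\<^sub>R weak_lap u) + c *\<^sub>R u"
      have u: "u = T g" using T2[OF that] by (simp add: g_def)
      show ?thesis unfolding R_def u H_T G2 ..
    qed
    show "closure (H2 :: 'n L2 set) = UNIV" by (rule closure_H2)
    show "cvec.span B \<noteq> UNIV" if "finite B" for B :: "'n L2 set" by (rule infinite_dimensional[OF that])
    have Mu: "M_op u \<in> H2" if "u \<in> H2" for u :: "'n L2"
      unfolding M_op_def by (rule H2_add[OF that C_op_H2])
    \<comment> \<open>Both sides reduce to the inner product of H_loc (M u) with M w, which is
      symmetric since \<open>M_op\<close> preserves \<open>H2\<close>.\<close>
    show "b (H u) w = b u (H w)" if "u \<in> H2" "w \<in> H2" for u w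
    proof -
      have "b (H u) w = cinner (H_loc \<sigma> v (M_op u)) (M_op w)" by (simp add: b_def M_sym H_factor that)
      also have "\<dots> = cinner (M_op u) (H_loc \<sigma> v (M_op w))" by (rule H_loc_sym[OF Mu Mu]) (rule that)+
      finally show ?thesis by (simp add: b_def H_factor that)
    qed
    \<comment> \<open>With w = M u, b (H u) u is the form of \<open>H_loc\<close> at w. The
      Laplacian contributes a nonnegative amount, the potential at least -\<psi>
      \<open>L\<^sup>2\<close> \<open>|u|\<^sup>2\<close>, and c sq u \<ge> c m
      \<open>|u|\<^sup>2\<close> exceeds that loss.\<close>
    show "0 < Re (b (H u + c *\<^sub>R u) u)" if "u \<in> H2" "u \<noteq> 0" for u
    proof -
      let ?w = "M_op u"
      have "b (H u) u = - (of_real \<sigma> * cinner (weak_lap ?w) ?w) + cinner (mul_op (Psi \<sigma> v) ?w) ?w"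
        by (simp add: b_def M_sym H_factor that H_loc_eq cinner_add_left cinner.minus_left cinner.diff_left scaleR_scaleC)
      then have "Re (b (H u + c *\<^sub>R u) u) = - \<sigma> * Re (cinner (weak_lap ?w) ?w) + Re (cinner (mul_op (Psi \<sigma> v) ?w) ?w) + c * sq u"
        by (simp add: b.add_left b.scaleR_left sq_def)
      moreover have "0 \<le> - \<sigma> * Re (cinner (weak_lap ?w) ?w)"
        using \<sigma> weak_lap_nonpos[OF Mu[OF that(1)]] by (simp add: mult_nonneg_nonpos)
      moreover have "- (\<psi> * L\<^sup>2 * (norm u)\<^sup>2) \<le> Re (cinner (mul_op (Psi \<sigma> v) ?w) ?w)"
      proof -
        have "norm (cinner (mul_op (Psi \<sigma> v) ?w) ?w) \<le> norm (mul_op (Psi \<sigma> v) ?w) * norm ?w" by (rule norm_cinner_le)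
        also have "\<dots> \<le> (norm ?w * \<psi>) * norm ?w" by (intro mult_right_mono \<psi>) auto
        also have "\<dots> = \<psi> * (norm ?w)\<^sup>2" by (simp add: power2_eq_square)
        also have "\<dots> \<le> \<psi> * (norm u * L)\<^sup>2" by (intro mult_left_mono power_mono L \<psi>) auto
        finally have "norm (cinner (mul_op (Psi \<sigma> v) ?w) ?w) \<le> \<psi> * L\<^sup>2 * (norm u)\<^sup>2"
          by (simp add: power_mult_distrib mult_ac)
        then show ?thesis
          using abs_Re_le_cmod[of "cinner (mul_op (Psi \<sigma> v) ?w) ?w"] by linarith
      qed
      moreover have "\<psi> * L\<^sup>2 * (norm u)\<^sup>2 < c * m * (norm u)\<^sup>2"
        using c(3) that(2) by (intro mult_strict_right_mono) auto
      moreover have "c * (m * (norm u)\<^sup>2) \<le> c * sq u"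
        using c(1) by (intro mult_left_mono sq_ge) auto
      ultimately show ?thesis by (simp add: mult.assoc)
    qed
  qed
  then show ?thesis by blast
qed

end

theorem proposition2p10:
  fixes \<sigma> \<epsilon> :: real and V W \<mu> :: "real ^ 'n::finite \<Rightarrow> real"
  assumes "\<sigma> > 0" and "\<epsilon> > 0"
    and "periodic V" and "periodic W"
    and "sobolev Linf 1 V" and "sobolev (Lp (max (real CARD('n)) (2 + \<epsilon>))) 2 V"
    and "sobolev Linf 2 W" and "even_in_each_coordinate W"
    and "Ck 2 V" and "Ck 2 W"
    and "H_stable W \<or> esssup torus (\<lambda>x. ereal \<bar>W x\<bar>) < ereal \<sigma>"
    and "stationary_state \<sigma> V W \<mu>"
  shows "let H = H_op \<sigma> V W \<mu> in
    has_compact_resolvent H2 H \<and>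
    (\<exists>(ev :: nat \<Rightarrow> complex) (\<phi> :: nat \<Rightarrow> 'n L2) (\<phi>' :: nat \<Rightarrow> 'n L2).
       spectrum H2 H = range ev \<and>
       (\<forall>n. ev n isolated_in spectrum H2 H \<and> eigenvalue H2 H (ev n) \<and>
            finite_alg_multiplicity H2 H (ev n)) \<and>
       filterlim (\<lambda>n. norm (ev n)) at_top sequentially \<and>
       (\<forall>n. generalized_eigenfunction H2 H (ev n) (\<phi> n)) \<and>
       (\<forall>n. generalized_eigenfunction (adj_dom H2 H) (adj_op H2 H) (cnj (ev n)) (\<phi>' n)) \<and>
       (\<forall>n m. cinner (\<phi> n) (\<phi>' m) = (if n = m then 1 else 0)) \<and>
       closure (cvec.span (range \<phi>)) = UNIV \<and>
       closure (cvec.span (range \<phi>')) = UNIV)"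
proof -
  define v where "v = eff_potential V W \<mu>"
  define Z where "Z = (LINT x|torus. exp (- (1 / \<sigma>) * v x))"
  have prob: "probability_density \<mu>" and \<mu>: "\<mu> x = 1 / Z * exp (- (1 / \<sigma>) * v x)" for x
    using assms(12) by (simp_all add: stationary_state_def Let_def v_def Z_def)
  have \<mu>_int: "integrable torus \<mu>" and mass: "(LINT x|torus. \<mu> x) = 1"
    using prob by (simp_all add: probability_density_def)
  \<comment> \<open>With Z = 0 the quotient 1 / Z is 0 and \<mu> vanishes, against mass one. This
    covers the default value 0 of a non-integrable integrand too.\<close>
  have "Z \<noteq> 0"
  proof
    assume "Z = 0"
    then have "\<mu> = (\<lambda>x. 0)" by (intro ext) (simp add: \<mu>)
    with mass show False by simp
  qed
  moreover have "Z \<ge> 0" unfolding Z_def by (rule integral_nonneg_AE) simp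
  ultimately have Z: "Z > 0" by simp
  have v_fun: "v = (\<lambda>x. V x + (LINT y|torus. W (x - y) * \<mu> y))"
    by (rule ext) (simp add: v_def eff_potential_def conv_def)
  have v: "Ck 2 v" "periodic v"
  proof -
    \<comment> \<open>The derivatives of the convolution fall on W, so integrability of \<mu> is
      enough, and regularity of the stationary state then follows from its exponential form.\<close>
    show "Ck 2 v" unfolding v_fun by (rule Ck_add[OF assms(9) Ck_conv[OF \<mu>_int assms(10)]])
    show "periodic v"
      unfolding v_fun using assms(3) periodic_conv[OF assms(4), of \<mu>] by (simp add: periodic_def)
  qed
  \<comment> \<open>Taking the square root of the Gibbs density halves the exponent, and sqrt (1 /
    Z) becomes the constant \<open>\<kappa>\<close>.\<close>
  have s: "sqrt (\<mu> x) = sqrt (1 / Z) * exp (- (1 / (2 * \<sigma>)) * v x)" for x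
  proof -
    have "exp (- (1 / \<sigma>) * v x) = (exp (- (1 / (2 * \<sigma>)) * v x))\<^sup>2"
      by (simp add: exp_double[symmetric])
    then show ?thesis by (simp only: \<mu> real_sqrt_mult) simp
  qed
  have cW: "continuous_on UNIV W" by (rule Ck_continuous[OF assms(10)])
  have interaction: "H_stable W \<or> (\<exists>B. 0 \<le> B \<and> B < \<sigma> \<and> (\<forall>x. \<bar>W x\<bar> \<le> B))"
    using assms(11)
  proof
    assume "esssup torus (\<lambda>x. ereal \<bar>W x\<bar>) < ereal \<sigma>"
    from esssup_bound[OF cW assms(4) this assms(1)] show ?thesis by metis
  qed simp
  interpret stationary_setting \<sigma> "sqrt (1 / Z)" W v "\<lambda>x. sqrt (\<mu> x)" \<mu>
  proof
    show "\<mu> x = (sqrt (\<mu> x))\<^sup>2" for x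
      using prob by (simp add: probability_density_def)
    then show "(LINT x|torus. (sqrt (\<mu> x))\<^sup>2) = 1" using mass by simp
    show "W (- x) = W x" for x by (rule even_neg[OF assms(8)])
  qed (use assms Z v s interaction in simp_all)
  have H_eq: "H_op \<sigma> V W \<mu> = H"
    by (rule ext) (simp only: H_op_def H_def v_def[symmetric])
  obtain M m R c where "symmetric_compact_resolvent M m (H2 :: 'n L2 set) H R c"
    using H_spectral by blast
  then interpret S: symmetric_compact_resolvent M m "H2 :: 'n L2 set" H R c .
  show ?thesis
    unfolding Let_def H_eq by (rule conjI[OF S.compact_resolvent S.spectral_decomposition])
qed

end
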